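(* For all nonnegative integers $n$, the (nonreduced) Euler characteristic of the space $X_{2,n}$ is $$\chi(X_{2,n})=\frac{1}{24}\left(-3^n+(-1)^{n+1}+2^{n+2}+18+4\cdot 0^n\right),$$ where $0^n=1$ for $n=0$ and $0^n=0$ for $n\ge1$.
   Context: Graphs are finite, undirected and connected; loops and multiple edges are allowed. The genus of $G$ is $|E(G)|-|V(G)|+1$. $\Delta(G)$ is the realization of $G$ as a 1-dimensional CW complex, edges parametrized by $[0,1]$. A graph is stable if it has no bridges and no vertex of valency $2$ unless that vertex is adjacent to a loop. $[n]=\{1,\dots,n\}$. The space $X_{g,n}$ ($g\ge2$, $n\ge0$): let $TM^b_{g,n}$ be the set of isometry classes of triples $(G,l_G,p_G)$ with $G$ a stable graph of genus $g$, $l_G:E(G)\to(0,\infty)$ a length function and $p_G:[n]\to\Delta(G)$ an arbitrary marking function (isometries carry markings to markings). It has the quotient topology from $\coprod_G L(G)\times\Delta(G)^n$, where $L(G)$ is the set of $l:E(G)\to[0,\infty)$ whose zero edges form a forest, and $(l,p)$ is sent to the class of the marked metric graph obtained by contracting all edges of length $0$ (a marked point at relative position $s$ in an edge $e$ of positive length sits at distance $s\,l(e)$ from the corresponding end). $X_{g,n}$ is the subspace of $TM^b_{g,n}$ consisting of points whose representing metric graphs have maximal edge length $1$ and for which the edges of length strictly less than $1$ form a forest (contain no cycles). *)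

theory Defs
  imports
    "HOL-Analysis.Sum_Topology"
    "HOL-Homology.Homology"
    "Graph_Theory.Digraph_Component"
begin

section \<open>Finite connected multigraphs\<close>

text \<open>
  An undirected multigraph with loops is a \<^term>\<open>fin_digraph\<close> whose arcs are its edges;
  the orientation of an arc is only a choice of parametrization of the edge by the unit interval.
  Note that \<^const>\<open>Digraph_Component.connected\<close> ignores orientations and
  requires at least one vertex.
\<close>

definition multigraph :: "('v, 'e) pre_digraph \<Rightarrow> bool" where
  "multigraph G \<longleftrightarrow> fin_digraph G \<and> Digraph_Component.connected G"

definition genus :: "('v, 'e) pre_digraph \<Rightarrow> int" where
  "genus G = int (card (arcs G)) - int (card (verts G)) + 1"

text \<open>A loop contributes 2 to the valency of its vertex.\<close>

definition valency :: "('v, 'e) pre_digraph \<Rightarrow> 'v \<Rightarrow> nat" where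
  "valency G v = card {e \<in> arcs G. tail G e = v} + card {e \<in> arcs G. head G e = v}"

definition loop_at :: "('v, 'e) pre_digraph \<Rightarrow> 'v \<Rightarrow> 'e \<Rightarrow> bool" where
  "loop_at G v e \<longleftrightarrow> e \<in> arcs G \<and> tail G e = v \<and> head G e = v"

definition bridge :: "('v, 'e) pre_digraph \<Rightarrow> 'e \<Rightarrow> bool" where
  "bridge G e \<longleftrightarrow> e \<in> arcs G \<and> \<not> Digraph_Component.connected (pre_digraph.del_arc G e)"

definition stable :: "('v, 'e) pre_digraph \<Rightarrow> bool" where
  "stable G \<longleftrightarrow> (\<forall>e \<in> arcs G. \<not> bridge G e)
     \<and> (\<forall>v \<in> verts G. valency G v = 2 \<longrightarrow> (\<exists>e. loop_at G v e))"

definition stable_graphs :: "nat \<Rightarrow> ('v, 'e) pre_digraph set" where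
  "stable_graphs g = {G. multigraph G \<and> stable G \<and> genus G = int g}"

text \<open>
  A cycle of the undirected graph is a directed cycle after reversing some of the edges.
  Directed cycles do not repeat arcs, so running back and forth along one edge is not a
  cycle, whereas a loop and a pair of parallel edges are cycles.
\<close>

definition reorient :: "'e set \<Rightarrow> ('v, 'e) pre_digraph \<Rightarrow> ('v, 'e) pre_digraph" where
  "reorient R G = \<lparr> verts = verts G, arcs = arcs G,
     tail = (\<lambda>e. if e \<in> R then head G e else tail G e),
     head = (\<lambda>e. if e \<in> R then tail G e else head G e) \<rparr>"

definition is_forest :: "('v, 'e) pre_digraph \<Rightarrow> 'e set \<Rightarrow> bool" where
  "is_forest G F \<longleftrightarrow> F \<subseteq> arcs G
     \<and> \<not> (\<exists>R p. pre_digraph.cycle (reorient R G) p \<and> set p \<subseteq> F)"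

section \<open>Quotient topologies\<close>

text \<open>The quotient topology on the set \<open>Y\<close> along \<open>q\<close>, a map from \<open>X\<close> to \<open>Y\<close>.\<close>

definition quotient_topology :: "'a topology \<Rightarrow> 'b set \<Rightarrow> ('a \<Rightarrow> 'b) \<Rightarrow> 'b topology" where
  "quotient_topology X Y q =
     topology (\<lambda>U. U \<subseteq> Y \<and> openin X {x \<in> topspace X. q x \<in> U})"

lemma openin_quotient_topology:
  fixes X :: "'a topology" and Y :: "'b set"
  shows "openin (quotient_topology X Y q) U \<longleftrightarrow> U \<subseteq> Y \<and> openin X {x \<in> topspace X. q x \<in> U}"
proof -
  have "istopology (\<lambda>U. U \<subseteq> Y \<and> openin X {x \<in> topspace X. q x \<in> U})"
    unfolding istopology_def
  proof (intro conjI allI impI)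
    fix S T
    assume "S \<subseteq> Y \<and> openin X {x \<in> topspace X. q x \<in> S}"
      and "T \<subseteq> Y \<and> openin X {x \<in> topspace X. q x \<in> T}"
    moreover have "{x \<in> topspace X. q x \<in> S \<inter> T}
        = {x \<in> topspace X. q x \<in> S} \<inter> {x \<in> topspace X. q x \<in> T}"
      by auto
    ultimately show "S \<inter> T \<subseteq> Y" "openin X {x \<in> topspace X. q x \<in> S \<inter> T}"
      by auto
  next
    fix \<K> :: "'b set set"
    assume *: "\<forall>K\<in>\<K>. K \<subseteq> Y \<and> openin X {x \<in> topspace X. q x \<in> K}"
    have "{x \<in> topspace X. q x \<in> \<Union>\<K>} = (\<Union>K\<in>\<K>. {x \<in> topspace X. q x \<in> K})"
      by auto
    with * show "\<Union>\<K> \<subseteq> Y" "openin X {x \<in> topspace X. q x \<in> \<Union>\<K>}"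
      by auto
  qed
  then show ?thesis
    by (simp add: quotient_topology_def)
qed

lemma topspace_quotient_topology:
  assumes "q ` topspace X \<subseteq> Y"
  shows "topspace (quotient_topology X Y q) = Y"
proof -
  have "{x \<in> topspace X. q x \<in> Y} = topspace X"
    using assms by auto
  then have "openin (quotient_topology X Y q) Y"
    by (simp add: openin_quotient_topology)
  then show ?thesis
    by (metis openin_quotient_topology openin_subset openin_topspace subset_antisym)
qed

section \<open>The realization of a graph\<close>

text \<open>
  Each point of the realization is a vertex or lies at a parameter strictly between 0 and 1 on a
  unique edge; \<open>edge_point\<close> is the characteristic map of the 1-cell \<open>e\<close>.
\<close>

datatype ('v, 'e) gpoint = Vertex 'v | Interior 'e real

definition gpoints :: "('v, 'e) pre_digraph \<Rightarrow> ('v, 'e) gpoint set" where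
  "gpoints G = Vertex ` verts G \<union> {Interior e s | e s. e \<in> arcs G \<and> 0 < s \<and> s < 1}"

definition edge_point :: "('v, 'e) pre_digraph \<Rightarrow> 'e \<Rightarrow> real \<Rightarrow> ('v, 'e) gpoint" where
  "edge_point G e s =
     (if s = 0 then Vertex (tail G e) else if s = 1 then Vertex (head G e) else Interior e s)"

definition realization :: "('v, 'e) pre_digraph \<Rightarrow> ('v, 'e) gpoint topology" where
  "realization G = quotient_topology
     (sum_topology (\<lambda>_. top_of_set {0..1}) (arcs G)) (gpoints G) (\<lambda>(e, s). edge_point G e s)"

section \<open>Marked metric graphs\<close>

type_synonym ('v, 'e) marked_graph =
  "('v, 'e) pre_digraph \<times> ('e \<Rightarrow> real) \<times> (nat \<Rightarrow> ('v, 'e) gpoint)"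

text \<open>
  \<open>joined G l x r y\<close>: some path of length \<open>r\<close> that moves finitely many times
  monotonically inside a closed edge leads from \<open>x\<close> to \<open>y\<close>.
\<close>

inductive joined ::
  "('v, 'e) pre_digraph \<Rightarrow> ('e \<Rightarrow> real) \<Rightarrow> ('v, 'e) gpoint \<Rightarrow> real \<Rightarrow> ('v, 'e) gpoint \<Rightarrow> bool"
  for G :: "('v, 'e) pre_digraph" and l :: "'e \<Rightarrow> real" and x :: "('v, 'e) gpoint" where
  start: "x \<in> gpoints G \<Longrightarrow> joined G l x 0 x"
| move: "joined G l x r (edge_point G e s) \<Longrightarrow> e \<in> arcs G \<Longrightarrow> s \<in> {0..1} \<Longrightarrow> t \<in> {0..1} \<Longrightarrow>
    joined G l x (r + l e * \<bar>s - t\<bar>) (edge_point G e t)"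

definition path_dist ::
  "('v, 'e) pre_digraph \<Rightarrow> ('e \<Rightarrow> real) \<Rightarrow> ('v, 'e) gpoint \<Rightarrow> ('v, 'e) gpoint \<Rightarrow> real" where
  "path_dist G l x y = Inf {r. joined G l x r y}"

definition isometric ::
  "nat \<Rightarrow> ('v, 'e) marked_graph \<Rightarrow> ('w, 'f) marked_graph \<Rightarrow> bool" where
  "isometric n M M' \<longleftrightarrow> (case (M, M') of ((G, l, p), (G', l', p')) \<Rightarrow>
     \<exists>\<phi>. bij_betw \<phi> (gpoints G) (gpoints G')
       \<and> (\<forall>x \<in> gpoints G. \<forall>y \<in> gpoints G. path_dist G' l' (\<phi> x) (\<phi> y) = path_dist G l x y)
       \<and> (\<forall>i \<in> {1..n}. \<phi> (p i) = p' i))"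

definition marked_graphs :: "nat \<Rightarrow> nat \<Rightarrow> ('v, 'e) marked_graph set" where
  "marked_graphs g n = {(G, l, p). G \<in> stable_graphs g
     \<and> l \<in> arcs G \<rightarrow>\<^sub>E {0<..} \<and> p \<in> {1..n} \<rightarrow>\<^sub>E gpoints G}"

text \<open>
  Every finite graph is isomorphic to one whose vertices and edges are natural numbers, so the
  isometry class of a marked metric graph over arbitrary types is represented by its members over
  the natural numbers.
\<close>

definition isometry_class ::
  "nat \<Rightarrow> nat \<Rightarrow> ('v, 'e) marked_graph \<Rightarrow> (nat, nat) marked_graph set" where
  "isometry_class g n M = {M' \<in> marked_graphs g n. isometric n M M'}"

section \<open>Contraction\<close>

text \<open>The vertex set of the component of \<open>v\<close> in the spanning subgraph with edge set \<open>F\<close>.\<close>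

definition component_of :: "('v, 'e) pre_digraph \<Rightarrow> 'e set \<Rightarrow> 'v \<Rightarrow> 'v set" where
  "component_of G F v = {w. v \<rightarrow>\<^sup>*\<^bsub>mk_symmetric (G\<lparr>arcs := F\<rparr>)\<^esub> w}"

definition contract_graph :: "('v, 'e) pre_digraph \<Rightarrow> 'e set \<Rightarrow> ('v set, 'e) pre_digraph" where
  "contract_graph G F = \<lparr> verts = component_of G F ` verts G, arcs = arcs G - F,
     tail = (\<lambda>e. component_of G F (tail G e)), head = (\<lambda>e. component_of G F (head G e)) \<rparr>"

fun contract_point ::
  "('v, 'e) pre_digraph \<Rightarrow> 'e set \<Rightarrow> ('v, 'e) gpoint \<Rightarrow> ('v set, 'e) gpoint" where
  "contract_point G F (Vertex v) = Vertex (component_of G F v)"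
| "contract_point G F (Interior e s) =
     (if e \<in> F then Vertex (component_of G F (tail G e)) else Interior e s)"

definition zero_edges :: "('v, 'e) pre_digraph \<Rightarrow> ('e \<Rightarrow> real) \<Rightarrow> 'e set" where
  "zero_edges G l = {e \<in> arcs G. l e = 0}"

definition contract :: "nat \<Rightarrow> ('v, 'e) marked_graph \<Rightarrow> ('v set, 'e) marked_graph" where
  "contract n = (\<lambda>(G, l, p). let F = zero_edges G l in
     (contract_graph G F, restrict l (arcs G - F),
      restrict (\<lambda>i. contract_point G F (p i)) {1..n}))"

section \<open>The spaces of marked metric graphs\<close>

definition length_space :: "('v, 'e) pre_digraph \<Rightarrow> ('e \<Rightarrow> real) topology" where
  "length_space G = subtopology (product_topology (\<lambda>_. euclideanreal) (arcs G))
     {l \<in> arcs G \<rightarrow>\<^sub>E {0..}. is_forest G (zero_edges G l)}"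

definition marking_space :: "nat \<Rightarrow> ('v, 'e) pre_digraph \<Rightarrow> (nat \<Rightarrow> ('v, 'e) gpoint) topology" where
  "marking_space n G = product_topology (\<lambda>_. realization G) {1..n}"

definition TMb :: "nat \<Rightarrow> nat \<Rightarrow> (nat, nat) marked_graph set topology" where
  "TMb g n = quotient_topology
     (sum_topology (\<lambda>G. prod_topology (length_space G) (marking_space n G)) (stable_graphs g))
     (isometry_class g n ` (marked_graphs g n :: (nat, nat) marked_graph set))
     (\<lambda>M :: (nat, nat) marked_graph. isometry_class g n (contract n M))"

definition X_space :: "nat \<Rightarrow> nat \<Rightarrow> (nat, nat) marked_graph set topology" where
  "X_space g n = subtopology (TMb g n)
     {c. \<forall>(G, l, p) \<in> c. Max (l ` arcs G) = 1 \<and> is_forest G {e \<in> arcs G. l e < 1}}"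

section \<open>Euler characteristic\<close>

text \<open>Rank of an abelian group: the largest size of a \<open>\<int>\<close>-linearly independent subset.\<close>

definition int_independent :: "('a, 'b) monoid_scheme \<Rightarrow> 'a set \<Rightarrow> bool" where
  "int_independent A S \<longleftrightarrow> S \<subseteq> carrier A \<and> finite S
     \<and> (\<forall>c :: 'a \<Rightarrow> int. finprod A (\<lambda>x. x [^]\<^bsub>A\<^esub> c x) S = \<one>\<^bsub>A\<^esub> \<longrightarrow> (\<forall>x \<in> S. c x = 0))"

definition finite_rank :: "('a, 'b) monoid_scheme \<Rightarrow> bool" where
  "finite_rank A \<longleftrightarrow> (\<exists>N. \<forall>S. int_independent A S \<longrightarrow> card S \<le> N)"

definition group_rank :: "('a, 'b) monoid_scheme \<Rightarrow> nat" where
  "group_rank A = Max (card ` {S. int_independent A S})"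

definition betti :: "nat \<Rightarrow> 'a topology \<Rightarrow> nat" where
  "betti k X = group_rank (homology_group (int k) X)"

definition finite_homology :: "'a topology \<Rightarrow> bool" where
  "finite_homology X \<longleftrightarrow> (\<forall>k::nat. finite_rank (homology_group (int k) X))
     \<and> finite {k. betti k X \<noteq> 0}"

text \<open>Meaningful only for spaces with \<^const>\<open>finite_homology\<close>.\<close>

definition euler_characteristic :: "'a topology \<Rightarrow> int" where
  "euler_characteristic X = (\<Sum>k | betti k X \<noteq> 0. (-1) ^ k * int (betti k X))"

end

theory Submission
  imports Defs "HOL-Analysis.Abstract_Topological_Spaces" "HOL-Combinatorics.Permutations"
begin

text \<open>
  A stable graph of genus two is a theta graph (two vertices joined by three edges) or a rose (two
  loops at one vertex). Any two edges of the theta graph form a cycle, and so does a loop. Hence in a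
  point of \<open>X_space 2 n\<close> all edges have length 1, except that one edge of a theta graph may
  be shorter. With \<open>\<Theta>\<close> for the theta graph, \<open>X_space 2 n\<close> is therefore the
  image of the cylinder \<open>[0,1] \<times> \<Theta>\<^sup>n\<close>, where \<open>a \<in> [0,1]\<close> is the length
  of the edge 2 and \<open>a = 0\<close> collapses \<open>\<Theta>\<close> to the rose. This map is continuous,
  closed and onto (\<open>cylinder_class_continuous\<close>, \<open>cylinder_class_closed\<close>,
  \<open>cylinder_class_surj\<close>). Isometries of metric graphs without vertices of valency two are
  induced by graph isomorphisms, so the points with the same image are related by
  automorphisms (\<open>point_class_eq_iff\<close>): of \<open>\<Theta>\<close> with the edge 2 fixed, for
  \<open>0 < a < 1\<close> (a group of order 4), of \<open>\<Theta>\<close> for \<open>a = 1\<close> (order 12), and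
  of the rose, after collapsing, for \<open>a = 0\<close> (order 8).

  Cut every edge at its midpoint. An automorphism that maps an open half-edge to itself fixes it
  pointwise; so the products of vertices, midpoints and open half-edges over the levels
  \<open>a = 0\<close>, \<open>0 < a < 1\<close> and \<open>a = 1\<close> descend to a decomposition of
  \<open>X_space 2 n\<close> into open cells, one for every orbit of an automorphism group on
  \<open>n\<close>-tuples of vertices, midpoints and half-edges. The characteristic maps of these cells are
  closed, so the Euler characteristic is the alternating number of cells
  (\<open>euler_characteristic_cells\<close>, from the long exact sequence of a pair and excision).

  The sign of a tuple is a product over its entries. By Burnside's lemma the alternating number of
  orbits is the average, over the group, of the \<open>n\<close>-th power of the number of fixed vertices
  and midpoints minus the number of fixed half-edges. The averages for the three groups are
  \<open>orbit_sum_Bottom\<close>, \<open>orbit_sum_Middle\<close> and \<open>orbit_sum_Top\<close>; the middle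
  level counts negatively because the parameter contributes one more dimension.
\<close>

section \<open>Rank of abelian groups\<close>

abbreviation lincomb :: "('a, 'b) monoid_scheme \<Rightarrow> ('i \<Rightarrow> 'a) \<Rightarrow> ('i \<Rightarrow> int) \<Rightarrow> 'i set \<Rightarrow> 'a" where
  "lincomb A x c J \<equiv> finprod A (\<lambda>j. x j [^]\<^bsub>A\<^esub> c j) J"

context comm_group
begin

lemma lincomb_closed: "x ` J \<subseteq> carrier G \<Longrightarrow> lincomb G x c J \<in> carrier G"
  by (intro finprod_closed) auto

lemma lincomb_add:
  assumes "finite J" "x ` J \<subseteq> carrier G"
  shows "lincomb G x c J \<otimes> lincomb G x d J = lincomb G x (\<lambda>j. c j + d j) J"
proof -
  have "lincomb G x (\<lambda>j. c j + d j) J = finprod G (\<lambda>j. x j [^] c j \<otimes> x j [^] d j) J"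
    using assms by (intro finprod_cong') (auto simp: int_pow_mult)
  also have "\<dots> = lincomb G x c J \<otimes> lincomb G x d J"
    using assms by (intro finprod_multf) auto
  finally show ?thesis by simp
qed

lemma lincomb_pow:
  assumes "finite J" "x ` J \<subseteq> carrier G"
  shows "lincomb G x c J [^] (k::int) = lincomb G x (\<lambda>j. c j * k) J"
  using assms
proof (induction J rule: finite_induct)
  case empty
  then show ?case by simp
next
  case (insert i J)
  then show ?case
    by (subst (1 2) finprod_insert) (auto simp: int_pow_distrib int_pow_pow lincomb_closed)
qed

lemma lincomb_zero: "x ` J \<subseteq> carrier G \<Longrightarrow> (\<And>j. j \<in> J \<Longrightarrow> c j = 0) \<Longrightarrow> lincomb G x c J = \<one>"
  by (intro finprod_one_eqI) auto

lemma lincomb_lincomb: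
  assumes "finite J" "x ` J \<subseteq> carrier G" "finite W"
  shows "lincomb G (\<lambda>u. lincomb G x (C u) J) d W = lincomb G x (\<lambda>j. \<Sum>u\<in>W. C u j * d u) J"
  using assms(3)
proof (induction W rule: finite_induct)
  case empty
  then show ?case by (simp add: assms lincomb_zero)
next
  case (insert u W)
  then show ?case using assms
    by (subst finprod_insert) (auto simp: lincomb_closed lincomb_pow lincomb_add)
qed

lemma lincomb_union:
  assumes "finite J" "finite K" "J \<inter> K = {}" "x ` (J \<union> K) \<subseteq> carrier G"
  shows "lincomb G x c (J \<union> K) = lincomb G x c J \<otimes> lincomb G x c K"
  using assms by (intro finprod_Un_disjoint) auto

lemma lincomb_single:
  assumes "finite J" "i \<in> J" "x ` J \<subseteq> carrier G"
  shows "lincomb G x (\<lambda>j. if j = i then k else 0) J = x i [^] k"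
proof -
  have "lincomb G x (\<lambda>j. if j = i then k else 0) J = finprod G (\<lambda>j. if i = j then x j [^] k else \<one>) J"
    using assms by (intro finprod_cong') auto
  also have "\<dots> = x i [^] k"
    using assms by (subst finprod_singleton) auto
  finally show ?thesis .
qed

end

lemma hom_lincomb:
  assumes "comm_group A" "comm_group B" "f \<in> hom A B" "finite J" "x ` J \<subseteq> carrier A"
  shows "f (lincomb A x c J) = lincomb B (\<lambda>j. f (x j)) c J"
proof -
  interpret A: comm_group A by fact
  interpret B: comm_group B by fact
  interpret group_hom A B f by unfold_locales fact
  show ?thesis
    using assms(4,5)
  proof (induction J rule: finite_induct)
    case empty
    then show ?case by simp
  next
    case (insert i J)
    then show ?case
      by (subst A.finprod_insert, simp, simp, force, force, subst B.finprod_insert)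
        (auto simp: A.lincomb_closed hom_int_pow)
  qed
qed

definition rank_bounded_in :: "('a, 'b) monoid_scheme \<Rightarrow> 'a set \<Rightarrow> bool" where
  "rank_bounded_in A K \<longleftrightarrow> (\<exists>N. \<forall>S. int_independent A S \<and> S \<subseteq> K \<longrightarrow> card S \<le> N)"

definition rank_in :: "('a, 'b) monoid_scheme \<Rightarrow> 'a set \<Rightarrow> nat" where
  "rank_in A K = Max (card ` {S. int_independent A S \<and> S \<subseteq> K})"

lemma finite_rank_carrier: "finite_rank A \<longleftrightarrow> rank_bounded_in A (carrier A)"
  and group_rank_carrier: "group_rank A = rank_in A (carrier A)"
proof -
  have "int_independent A S \<and> S \<subseteq> carrier A \<longleftrightarrow> int_independent A S" for S
    unfolding int_independent_def by (rule iffI; elim conjE; intro conjI; assumption)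
  then show "finite_rank A \<longleftrightarrow> rank_bounded_in A (carrier A)" "group_rank A = rank_in A (carrier A)"
    unfolding finite_rank_def rank_bounded_in_def group_rank_def rank_in_def by simp_all
qed

lemma int_independent_empty [simp]: "int_independent A {}"
  by (simp add: int_independent_def)

lemma rank_bounded_in_finite:
  assumes "rank_bounded_in A K" shows "finite (card ` {S. int_independent A S \<and> S \<subseteq> K})"
proof -
  obtain N where "\<forall>S. int_independent A S \<and> S \<subseteq> K \<longrightarrow> card S \<le> N"
    using assms unfolding rank_bounded_in_def by blast
  then have "card ` {S. int_independent A S \<and> S \<subseteq> K} \<subseteq> {..N}" by blast
  then show ?thesis using finite_subset by blast
qed

lemma card_le_rank_in:
  assumes "rank_bounded_in A K" "int_independent A S" "S \<subseteq> K"
  shows "card S \<le> rank_in A K"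
  unfolding rank_in_def using rank_bounded_in_finite[OF assms(1)] assms(2,3)
  by (intro Max_ge) auto

lemma rank_in_attained:
  assumes "rank_bounded_in A K"
  obtains S where "int_independent A S" "S \<subseteq> K" "card S = rank_in A K"
proof -
  have "rank_in A K \<in> card ` {S. int_independent A S \<and> S \<subseteq> K}"
    unfolding rank_in_def
    by (rule Max_in[OF rank_bounded_in_finite[OF assms]]) (auto intro!: exI[of _ "{}"])
  then show ?thesis using that by auto
qed

lemma rank_in_leI:
  assumes "\<And>S. int_independent A S \<Longrightarrow> S \<subseteq> K \<Longrightarrow> card S \<le> N"
  shows "rank_bounded_in A K" "rank_in A K \<le> N"
proof -
  show b: "rank_bounded_in A K"
    unfolding rank_bounded_in_def using assms by blast
  show "rank_in A K \<le> N"
    using rank_in_attained[OF b] assms by metis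
qed

lemma rank_bounded_in_subset: "rank_bounded_in A L \<Longrightarrow> K \<subseteq> L \<Longrightarrow> rank_bounded_in A K"
  unfolding rank_bounded_in_def by blast

lemma rank_in_mono: "rank_bounded_in A L \<Longrightarrow> K \<subseteq> L \<Longrightarrow> rank_in A K \<le> rank_in A L"
  using card_le_rank_in[of A L] by (intro rank_in_leI) auto

text \<open>For a family the coefficients may be chosen separately at every index, so independence also shows
  that the family has no repetitions.\<close>

lemma independent_family_card:
  assumes A: "comm_group A" and J: "finite J" "x ` J \<subseteq> carrier A"
    and ind: "\<And>c. lincomb A x c J = \<one>\<^bsub>A\<^esub> \<Longrightarrow> \<forall>j\<in>J. c j = 0"
  shows "int_independent A (x ` J)" "card (x ` J) = card J"
proof -
  interpret comm_group A by fact
  have inj: "inj_on x J"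
  proof (rule inj_onI, rule ccontr)
    fix i j assume ij: "i \<in> J" "j \<in> J" "x i = x j" "i \<noteq> j"
    let ?c = "\<lambda>l. (if l = i then 1 else 0) + (if l = j then -1 else 0) :: int"
    have "lincomb A x ?c J = x i [^]\<^bsub>A\<^esub> (1::int) \<otimes>\<^bsub>A\<^esub> x j [^]\<^bsub>A\<^esub> (-1::int)"
      using ij J by (simp add: lincomb_add[symmetric] lincomb_single)
    also have "\<dots> = \<one>\<^bsub>A\<^esub>"
      using ij J by (metis add.right_inverse image_subset_iff int_pow_0 int_pow_mult)
    finally have "?c i = 0" using ind[of ?c] ij(1) by blast
    then show False using ij by simp
  qed
  then show "card (x ` J) = card J" by (rule card_image)
  show "int_independent A (x ` J)"
    unfolding int_independent_def
  proof (intro conjI allI impI)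
    fix c :: "'a \<Rightarrow> int"
    assume "lincomb A (\<lambda>x. x) c (x ` J) = \<one>\<^bsub>A\<^esub>"
    moreover have "lincomb A (\<lambda>x. x) c (x ` J) = lincomb A x (\<lambda>j. c (x j)) J"
      using J inj by (subst finprod_reindex) auto
    ultimately show "\<forall>y\<in>x ` J. c y = 0" using ind[of "\<lambda>j. c (x j)"] by auto
  qed (use J in auto)
qed

lemma int_independentD:
  "int_independent A S \<Longrightarrow> lincomb A (\<lambda>x. x) c S = \<one>\<^bsub>A\<^esub> \<Longrightarrow> x \<in> S \<Longrightarrow> c x = 0"
  unfolding int_independent_def by blast

text \<open>Independent elements of the kernel together with lifts of independent elements of the image
  are independent.\<close>

lemma independent_kernel_image:
  assumes A: "comm_group A" and B: "comm_group B" and f: "f \<in> hom A B"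
    and S: "int_independent A S" "S \<subseteq> kernel A B f"
    and T: "int_independent B T" "T \<subseteq> f ` carrier A"
  shows "\<exists>U. int_independent A U \<and> card U = card S + card T"
proof -
  interpret A: comm_group A by fact
  interpret B: comm_group B by fact
  interpret group_hom A B f by unfold_locales fact
  define t where "t = inv_into (carrier A) f"
  have t: "t y \<in> carrier A" "f (t y) = y" if "y \<in> T" for y
    using that T(2) unfolding t_def by (auto intro: inv_into_into f_inv_into_f)
  have fin: "finite S" "finite T" and SA: "S \<subseteq> carrier A" and TB: "T \<subseteq> carrier B"
    using S T unfolding int_independent_def by auto
  have injt: "inj_on t T" using t(2) by (metis inj_onI)
  have fS: "f x = \<one>\<^bsub>B\<^esub>" if "x \<in> S" for x using S(2) that unfolding kernel_def by auto
  have tC: "t ` T \<subseteq> carrier A" using t by auto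
  have d0: "d y = 0" if eq: "lincomb A (\<lambda>x. x) c S \<otimes>\<^bsub>A\<^esub> lincomb A t d T = \<one>\<^bsub>A\<^esub>"
    and y: "y \<in> T" for c d y
  proof -
    have "\<one>\<^bsub>B\<^esub> = f (lincomb A (\<lambda>x. x) c S) \<otimes>\<^bsub>B\<^esub> f (lincomb A t d T)"
      using hom_mult[OF A.lincomb_closed[of "\<lambda>x. x" S c] A.lincomb_closed[of t T d]] eq tC SA by simp
    also have "f (lincomb A (\<lambda>x. x) c S) = lincomb B (\<lambda>j. f j) c S"
      using fin SA by (intro hom_lincomb A B f) auto
    also have "\<dots> = \<one>\<^bsub>B\<^esub>"
      using fS by (intro B.finprod_one_eqI) auto
    also have "f (lincomb A t d T) = lincomb B (\<lambda>j. f (t j)) d T"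
      using fin tC by (intro hom_lincomb A B f) auto
    also have "\<dots> = lincomb B (\<lambda>j. j) d T"
      using t TB by (intro B.finprod_cong') auto
    finally have "lincomb B (\<lambda>j. j) d T = \<one>\<^bsub>B\<^esub>"
      using TB B.lincomb_closed[of "\<lambda>x. x" T d] by simp
    then show ?thesis using int_independentD[OF T(1)] y by blast
  qed
  have c0: "c x = 0" if eq: "lincomb A (\<lambda>x. x) c S \<otimes>\<^bsub>A\<^esub> lincomb A t d T = \<one>\<^bsub>A\<^esub>"
    and x: "x \<in> S" for c d x
  proof -
    have "lincomb A t d T = \<one>\<^bsub>A\<^esub>"
      using d0[OF eq] tC by (intro A.lincomb_zero) auto
    then have "lincomb A (\<lambda>x. x) c S = \<one>\<^bsub>A\<^esub>"
      using eq SA A.lincomb_closed[of "\<lambda>x. x" S c] by simp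
    then show ?thesis using int_independentD[OF S(1)] x by blast
  qed
  have disj: "S \<inter> t ` T = {}"
  proof (rule ccontr)
    assume "S \<inter> t ` T \<noteq> {}"
    then obtain y where y: "y \<in> T" "t y \<in> S" by blast
    then have "y = \<one>\<^bsub>B\<^esub>" using t(2) fS by metis
    then have "lincomb B (\<lambda>x. x) (\<lambda>j. if j = y then 1 else 0) T = \<one>\<^bsub>B\<^esub>"
      using y fin TB by (subst B.lincomb_single) auto
    from int_independentD[OF T(1) this y(1)] show False by simp
  qed
  have "int_independent A (S \<union> t ` T)"
    unfolding int_independent_def
  proof (intro conjI allI impI)
    fix c :: "'a \<Rightarrow> int"
    assume "lincomb A (\<lambda>x. x) c (S \<union> t ` T) = \<one>\<^bsub>A\<^esub>"
    moreover have "lincomb A (\<lambda>x. x) c (S \<union> t ` T)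
        = lincomb A (\<lambda>x. x) c S \<otimes>\<^bsub>A\<^esub> lincomb A (\<lambda>x. x) c (t ` T)"
      using fin SA tC disj by (intro A.lincomb_union) auto
    moreover have "lincomb A (\<lambda>x. x) c (t ` T) = lincomb A t (\<lambda>y. c (t y)) T"
      using tC injt by (subst A.finprod_reindex) auto
    ultimately have eq: "lincomb A (\<lambda>x. x) c S \<otimes>\<^bsub>A\<^esub> lincomb A t (\<lambda>y. c (t y)) T = \<one>\<^bsub>A\<^esub>"
      by simp
    show "\<forall>x\<in>S \<union> t ` T. c x = 0" using c0[OF eq] d0[OF eq] by auto
  qed (use fin SA tC in auto)
  moreover have "card (S \<union> t ` T) = card S + card T"
    using fin disj by (simp add: card_Un_disjoint card_image injt)
  ultimately show ?thesis by blast
qed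

text \<open>Conversely, choose inside an independent set \<open>U\<close> a subset \<open>V\<close> that is maximal among those
  with independent image. Every other \<open>u \<in> U\<close> then satisfies a relation modulo the kernel with the
  elements of \<open>V\<close>, and the resulting kernel elements are independent.\<close>

lemma independent_split:
  assumes A: "comm_group A" and B: "comm_group B" and f: "f \<in> hom A B"
    and U: "int_independent A U"
  shows "\<exists>S T. int_independent A S \<and> S \<subseteq> kernel A B f \<and> int_independent B T \<and> T \<subseteq> f ` carrier A
     \<and> card U = card S + card T"
proof -
  interpret A: comm_group A by fact
  interpret B: comm_group B by fact
  interpret group_hom A B f by unfold_locales fact
  have finU: "finite U" and UA: "U \<subseteq> carrier A" using U unfolding int_independent_def by auto
  define ind where "ind V \<longleftrightarrow> (\<forall>c. lincomb B f c V = \<one>\<^bsub>B\<^esub> \<longrightarrow> (\<forall>v\<in>V. c v = 0))" for V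
  have "\<exists>V\<in>{V. V \<subseteq> U \<and> ind V}. \<forall>W\<in>{V. V \<subseteq> U \<and> ind V}. V \<subseteq> W \<longrightarrow> V = W"
  proof (rule finite_has_maximal)
    show "finite {V. V \<subseteq> U \<and> ind V}" using finU by simp
    have "ind {}" by (simp add: ind_def)
    then show "{V. V \<subseteq> U \<and> ind V} \<noteq> {}" by blast
  qed
  then obtain V where V: "V \<subseteq> U" "ind V" and maxV: "\<And>W. W \<subseteq> U \<Longrightarrow> ind W \<Longrightarrow> V \<subseteq> W \<Longrightarrow> V = W"
    unfolding Bex_def Ball_def mem_Collect_eq by (elim exE conjE) metis
  have fV: "f ` V \<subseteq> carrier B" "finite V" using V UA finU finite_subset by auto
  have Vind: "\<forall>v\<in>V. c v = 0" if "lincomb B f c V = \<one>\<^bsub>B\<^esub>" for c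
    using V(2) that by (simp add: ind_def)
  note T = independent_family_card[OF B fV(2,1) Vind]
  have "\<forall>u\<in>U - V. \<exists>c. lincomb B f c (insert u V) = \<one>\<^bsub>B\<^esub> \<and> c u \<noteq> 0"
  proof
    fix u assume u: "u \<in> U - V"
    then have "\<not> ind (insert u V)" using maxV[of "insert u V"] V by blast
    then obtain c v where c: "lincomb B f c (insert u V) = \<one>\<^bsub>B\<^esub>" "v \<in> insert u V" "c v \<noteq> 0"
      by (auto simp: ind_def)
    have "c u \<noteq> 0"
    proof
      assume cu: "c u = 0"
      have "lincomb B f c (insert u V) = f u [^]\<^bsub>B\<^esub> c u \<otimes>\<^bsub>B\<^esub> lincomb B f c V"
        using u UA fV by (intro B.finprod_insert) auto
      then have "lincomb B f c V = \<one>\<^bsub>B\<^esub>"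
        using cu c fV B.lincomb_closed[of f V c] by simp
      then show False using Vind[of c] c cu by auto
    qed
    then show "\<exists>c. lincomb B f c (insert u V) = \<one>\<^bsub>B\<^esub> \<and> c u \<noteq> 0" using c by blast
  qed
  then obtain c where c: "\<And>u. u \<in> U - V \<Longrightarrow> lincomb B f (c u) (insert u V) = \<one>\<^bsub>B\<^esub> \<and> c u u \<noteq> 0"
    by metis
  define C where "C u v = (if v \<in> insert u V then c u v else 0)" for u v
  define g where "g u = lincomb A (\<lambda>x. x) (C u) U" for u
  have gker: "g u \<in> kernel A B f" if u: "u \<in> U - V" for u
  proof -
    have "f (g u) = lincomb B f (C u) U"
      unfolding g_def using finU UA by (intro hom_lincomb A B f) auto
    also have "U = insert u V \<union> (U - insert u V)" using u V by auto
    also have "lincomb B f (C u) \<dots> = lincomb B f (C u) (insert u V) \<otimes>\<^bsub>B\<^esub> lincomb B f (C u) (U - insert u V)"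
      using finU UA V fV u by (intro B.lincomb_union) auto
    also have "lincomb B f (C u) (U - insert u V) = \<one>\<^bsub>B\<^esub>"
      using UA by (intro B.lincomb_zero) (auto simp: C_def)
    also have "lincomb B f (C u) (insert u V) = lincomb B f (c u) (insert u V)"
      using UA u fV by (intro B.finprod_cong') (auto simp: C_def)
    finally show ?thesis
      using c[OF u] UA A.lincomb_closed[of "\<lambda>x. x" U] unfolding kernel_def g_def by simp
  qed
  have gA: "g ` (U - V) \<subseteq> carrier A" using gker unfolding kernel_def by auto
  have gind: "\<forall>u\<in>U - V. d u = 0" if d: "lincomb A g d (U - V) = \<one>\<^bsub>A\<^esub>" for d
  proof
    fix u assume u: "u \<in> U - V"
    have "lincomb A g d (U - V) = lincomb A (\<lambda>x. x) (\<lambda>v. \<Sum>u\<in>U - V. C u v * d u) U"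
      unfolding g_def using finU UA by (intro A.lincomb_lincomb) auto
    then have "(\<Sum>w\<in>U - V. C w u * d w) = 0"
      using int_independentD[OF U, of "\<lambda>v. \<Sum>u\<in>U - V. C u v * d u"] d u by simp
    moreover have "(\<Sum>w\<in>U - V. C w u * d w) = (\<Sum>w\<in>U - V. if w = u then c u u * d u else 0)"
      using u by (intro sum.cong) (auto simp: C_def)
    ultimately show "d u = 0" using c[OF u] u finU by simp
  qed
  have finUV: "finite (U - V)" using finU by simp
  note S = independent_family_card[OF A finUV gA gind]
  have "card U = card (U - V) + card V"
    using V finU by (metis card_Diff_subset card_mono fV(2) le_add_diff_inverse2)
  then show ?thesis
    using S T V UA gker by (intro exI[of _ "g ` (U - V)"] exI[of _ "f ` V"]) auto
qed

theorem rank_kernel_image: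
  assumes A: "comm_group A" and B: "comm_group B" and f: "f \<in> hom A B"
  shows "finite_rank A \<longleftrightarrow> rank_bounded_in A (kernel A B f) \<and> rank_bounded_in B (f ` carrier A)"
    and "finite_rank A \<Longrightarrow> group_rank A = rank_in A (kernel A B f) + rank_in B (f ` carrier A)"
proof -
  have up: "card U \<le> rank_in A (kernel A B f) + rank_in B (f ` carrier A)"
    if b: "rank_bounded_in A (kernel A B f)" "rank_bounded_in B (f ` carrier A)"
      and U: "int_independent A U" for U
    using independent_split[OF A B f U] card_le_rank_in[OF b(1)] card_le_rank_in[OF b(2)]
    by (metis add_mono)
  have down: "rank_bounded_in A (kernel A B f) \<and> rank_bounded_in B (f ` carrier A)"
    if fr: "finite_rank A"
  proof
    show "rank_bounded_in A (kernel A B f)"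
      using fr unfolding finite_rank_carrier
      by (rule rank_bounded_in_subset) (auto simp: kernel_def)
    show "rank_bounded_in B (f ` carrier A)"
    proof (rule rank_in_leI)
      fix T assume "int_independent B T" "T \<subseteq> f ` carrier A"
      then obtain U where "int_independent A U" "card U = card T"
        using independent_kernel_image[OF A B f int_independent_empty] by auto
      then show "card T \<le> rank_in A (carrier A)"
        using fr card_le_rank_in unfolding finite_rank_carrier
        by (metis int_independent_def)
    qed
  qed
  show iff: "finite_rank A \<longleftrightarrow> rank_bounded_in A (kernel A B f) \<and> rank_bounded_in B (f ` carrier A)"
    using down up unfolding finite_rank_def by blast
  assume fr: "finite_rank A"
  then have b: "rank_bounded_in A (kernel A B f)" "rank_bounded_in B (f ` carrier A)"
    using iff by auto
  have "group_rank A \<le> rank_in A (kernel A B f) + rank_in B (f ` carrier A)"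
    unfolding group_rank_carrier using up[OF b] by (intro rank_in_leI)
  moreover have "rank_in A (kernel A B f) + rank_in B (f ` carrier A) \<le> group_rank A"
  proof -
    obtain S where S: "int_independent A S" "S \<subseteq> kernel A B f" "card S = rank_in A (kernel A B f)"
      using rank_in_attained[OF b(1)] by blast
    obtain T where T: "int_independent B T" "T \<subseteq> f ` carrier A" "card T = rank_in B (f ` carrier A)"
      using rank_in_attained[OF b(2)] by blast
    obtain U where U: "int_independent A U" "card U = card S + card T"
      using independent_kernel_image[OF A B f S(1,2) T(1,2)] by blast
    then have "card U \<le> rank_in A (carrier A)"
      using fr card_le_rank_in unfolding finite_rank_carrier by (metis int_independent_def)
    then show ?thesis using U S T unfolding group_rank_carrier by simp
  qed
  ultimately show "group_rank A = rank_in A (kernel A B f) + rank_in B (f ` carrier A)" by simp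
qed

lemma rank_in_one:
  assumes "comm_group A"
  shows "rank_bounded_in A {\<one>\<^bsub>A\<^esub>}" "rank_in A {\<one>\<^bsub>A\<^esub>} = 0"
proof -
  interpret comm_group A by fact
  have "S = {}" if "int_independent A S" "S \<subseteq> {\<one>\<^bsub>A\<^esub>}" for S
  proof (rule ccontr)
    assume "S \<noteq> {}"
    then have S: "S = {\<one>\<^bsub>A\<^esub>}" using that by auto
    have "lincomb A (\<lambda>x. x) (\<lambda>_. 1) S = \<one>\<^bsub>A\<^esub>"
      by (intro finprod_one_eqI) (auto simp: S)
    then show False using int_independentD[OF that(1), of "\<lambda>_. 1" "\<one>\<^bsub>A\<^esub>"] S by simp
  qed
  then have "card S \<le> 0" if "int_independent A S" "S \<subseteq> {\<one>\<^bsub>A\<^esub>}" for S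
    using that by (metis card.empty le_refl)
  from rank_in_leI[of A "{\<one>\<^bsub>A\<^esub>}" 0, OF this]
  show "rank_bounded_in A {\<one>\<^bsub>A\<^esub>}" "rank_in A {\<one>\<^bsub>A\<^esub>} = 0" by simp_all
qed

lemma rank_trivial_group:
  assumes "comm_group A" "trivial_group A"
  shows "finite_rank A" "group_rank A = 0"
  using rank_in_one[OF assms(1)] assms(2)
  unfolding finite_rank_carrier group_rank_carrier trivial_group_def by auto

lemma rank_iso:
  assumes A: "comm_group A" and B: "comm_group B" and iso: "A \<cong> B"
  shows "finite_rank A \<longleftrightarrow> finite_rank B" "finite_rank B \<Longrightarrow> group_rank A = group_rank B"
proof -
  obtain f where f: "f \<in> iso A B" using iso unfolding is_iso_def by blast
  interpret A: comm_group A by fact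
  interpret B: comm_group B by fact
  interpret group_hom A B f using f by unfold_locales (auto simp: iso_def)
  have fh: "f \<in> hom A B" by (rule homh)
  have "kernel A B f = {\<one>\<^bsub>A\<^esub>}" "f ` carrier A = carrier B"
    using f unfolding iso_def bij_betw_def kernel_def
    by (auto dest: inj_onD) (metis A.one_closed hom_one inj_onD)
  note * = this
  show fin: "finite_rank A \<longleftrightarrow> finite_rank B"
    using rank_kernel_image(1)[OF A B fh] rank_in_one[OF A] * finite_rank_carrier by metis
  show "finite_rank B \<Longrightarrow> group_rank A = group_rank B"
    using rank_kernel_image(2)[OF A B fh] rank_in_one[OF A] * fin group_rank_carrier by (metis add_0)
qed

lemma rank_integer_group: "finite_rank integer_group" "group_rank integer_group = 1"
proof -
  interpret comm_group integer_group by (rule abelian_integer_group)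
  have le: "card S \<le> 1" if S: "int_independent integer_group S" for S
  proof (rule ccontr)
    assume "\<not> card S \<le> 1"
    moreover have finS: "finite S" using S unfolding int_independent_def by auto
    ultimately obtain a b where ab: "a \<in> S" "b \<in> S" "a \<noteq> b"
      using card_le_Suc0_iff_eq[of S] by auto
    let ?c = "\<lambda>l. (if l = a then b else 0) + (if l = b then -a else 0) :: int"
    have "lincomb integer_group (\<lambda>x. x) ?c S = a [^]\<^bsub>integer_group\<^esub> b \<otimes>\<^bsub>integer_group\<^esub> b [^]\<^bsub>integer_group\<^esub> (-a)"
      using ab finS
      by (simp add: lincomb_add[symmetric] lincomb_single del: group_int_pow_integer_group)
    also have "\<dots> = \<one>\<^bsub>integer_group\<^esub>" by simp
    finally have c: "lincomb integer_group (\<lambda>x. x) ?c S = \<one>\<^bsub>integer_group\<^esub>" .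
    then have "b = 0" "a = 0"
      using int_independentD[OF S c ab(1)] int_independentD[OF S c ab(2)] ab by auto
    then show False using ab by simp
  qed
  then show fin: "finite_rank integer_group" unfolding finite_rank_def by blast
  have "int_independent integer_group {1::int}"
    unfolding int_independent_def by (auto simp: finprod_insert)
  then have "card {1::int} \<le> group_rank integer_group"
    unfolding group_rank_carrier using fin[unfolded finite_rank_carrier]
    by (intro card_le_rank_in) auto
  moreover have "group_rank integer_group \<le> 1"
    unfolding group_rank_carrier using le by (intro rank_in_leI) auto
  ultimately show "group_rank integer_group = 1" by simp
qed

section \<open>Euler characteristics of pairs\<close>

lemma euler_characteristic_atMost:
  assumes "\<And>k. k > N \<Longrightarrow> betti k X = 0"
  shows "euler_characteristic X = (\<Sum>k\<le>N. (-1) ^ k * int (betti k X))"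
  unfolding euler_characteristic_def
proof (rule sum.mono_neutral_left)
  show "{k. betti k X \<noteq> 0} \<subseteq> {..N}"
    using assms by (metis (mono_tags) atMost_iff mem_Collect_eq not_le subsetI)
qed auto

text \<open>The long exact sequence of the pair splits every homology rank of \<open>A\<close>, \<open>X\<close> and \<open>(X, A)\<close> into
  the ranks of a kernel and an image; the alternating sum of the ranks of the connecting
  homomorphisms telescopes.\<close>

lemma euler_characteristic_pair:
  fixes X :: "'a topology" and A :: "'a set"
  assumes fin: "finite_homology (subtopology X A)"
    and rel: "\<And>k::nat. finite_rank (relative_homology_group (int k) X A)"
      "\<And>k::nat. group_rank (relative_homology_group (int k) X A) = (if k = d then 1 else 0)"
  shows "finite_homology X"
    and "euler_characteristic X = euler_characteristic (subtopology X A) + (- 1) ^ d"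
proof -
  define HA where "HA p = homology_group p (subtopology X A)" for p
  define HX where "HX p = homology_group p X" for p
  define HR where "HR p = relative_homology_group p X A" for p
  define i where "i p = hom_induced p (subtopology X A) {} X {} id" for p
  define j where "j p = hom_induced p X {} X A id" for p
  define b where "b p = hom_boundary p X A" for p
  note defs = HA_def HX_def HR_def i_def j_def b_def
  have comm: "comm_group (HA p)" "comm_group (HX p)" "comm_group (HR p)" for p
    unfolding defs by (rule abelian_relative_homology_group)+
  have homs: "i p \<in> hom (HA p) (HX p)" "j p \<in> hom (HX p) (HR p)" "b p \<in> hom (HR p) (HA (p - 1))" for p
    unfolding defs by (auto simp: hom_induced_hom hom_boundary_hom)
  have ex: "kernel (HX p) (HR p) (j p) = i p ` carrier (HA p)"
    "kernel (HR p) (HA (p - 1)) (b p) = j p ` carrier (HX p)"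
    "kernel (HA (p - 1)) (HX (p - 1)) (i (p - 1)) = b p ` carrier (HR p)" for p
    using homology_exactness_axiom_3[of p X A] homology_exactness_axiom_1[of p X A]
      homology_exactness_axiom_2[of p X A] unfolding defs by simp_all
  \<comment> \<open>By exactness these are the ranks of the images of the connecting homomorphism, of the
    inclusion and of the projection to relative homology.\<close>
  define \<alpha> where "\<alpha> p = rank_in (HA p) (kernel (HA p) (HX p) (i p))" for p
  define \<beta> where "\<beta> p = rank_in (HX p) (i p ` carrier (HA p))" for p
  define \<gamma> where "\<gamma> p = rank_in (HR p) (j p ` carrier (HX p))" for p
  have finA: "finite_rank (HA (int k))" for k
    using fin unfolding finite_homology_def HA_def by blast
  have finR: "finite_rank (HR (int k))" for k using rel(1) unfolding HR_def by blast
  note rkA = rank_kernel_image[OF comm(1) comm(2) homs(1)]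
  note rkX = rank_kernel_image[OF comm(2) comm(3) homs(2)]
  note rkR = rank_kernel_image[OF comm(3) comm(1) homs(3)]
  have finX: "finite_rank (HX (int k))" for k
    using rkX(1)[of "int k"] rkA(1)[of "int k"] rkR(1)[of "int k"] finA[of k] finR[of k] ex by metis
  have rA: "group_rank (HA (int k)) = \<alpha> (int k) + \<beta> (int k)" for k
    using rkA(2)[OF finA] unfolding \<alpha>_def \<beta>_def .
  have rX: "group_rank (HX (int k)) = \<beta> (int k) + \<gamma> (int k)" for k
    using rkX(2)[OF finX[of k]] unfolding \<gamma>_def \<beta>_def ex(1) .
  have rR: "group_rank (HR (int k)) = \<gamma> (int k) + \<alpha> (int k - 1)" for k
    using rkR(2)[OF finR[of k]] unfolding \<gamma>_def \<alpha>_def ex(2) ex(3) .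
  have "\<alpha> (-1) = 0"
  proof -
    have "trivial_group (HA (-1))" unfolding HA_def by simp
    then have "kernel (HA (-1)) (HX (-1)) (i (-1)) \<subseteq> {\<one>\<^bsub>HA (-1)\<^esub>}"
      unfolding trivial_group_def kernel_def by auto
    then show ?thesis
      unfolding \<alpha>_def using rank_in_one[OF comm(1), of "-1"]
        rank_in_mono[of "HA (-1)" "{\<one>\<^bsub>HA (-1)\<^esub>}"] by simp
  qed
  obtain N where N: "\<And>k. k \<ge> N \<Longrightarrow> betti k (subtopology X A) = 0" "d < N"
  proof -
    have "finite (insert d {k. betti k (subtopology X A) \<noteq> 0})"
      using fin unfolding finite_homology_def by simp
    then obtain N where "\<forall>k\<in>insert d {k. betti k (subtopology X A) \<noteq> 0}. k < N"
      by (meson finite_nat_set_iff_bounded)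
    then have "\<And>k. k \<ge> N \<Longrightarrow> betti k (subtopology X A) = 0" "d < N"
      by (auto simp: not_less[symmetric])
    then show ?thesis using that by blast
  qed
  have bA: "betti k (subtopology X A) = \<alpha> (int k) + \<beta> (int k)" for k
    using rA unfolding betti_def HA_def by simp
  have bX: "betti k X = \<beta> (int k) + \<gamma> (int k)" for k
    using rX unfolding betti_def HX_def by simp
  have bR: "(if k = d then 1 else 0) = \<gamma> (int k) + \<alpha> (int k - 1)" for k
    using rR rel(2) unfolding HR_def by simp
  have bX0: "betti k X = 0" if "k \<ge> N" for k
    using N(1)[OF that] bA[of k] bX[of k] bR[of k] N(2) that by simp
  have "finite {k. betti k X \<noteq> 0}"
  proof (rule finite_subset)
    show "{k. betti k X \<noteq> 0} \<subseteq> {..N}"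
    proof
      fix k assume "k \<in> {k. betti k X \<noteq> 0}"
      then show "k \<in> {..N}" using bX0[of k] by (cases "k \<ge> N") auto
    qed
  qed simp
  then show "finite_homology X"
    unfolding finite_homology_def using finX unfolding HX_def by blast
  have tele: "(\<Sum>k\<le>M. (-1) ^ k * (int (\<alpha> (int k)) + int (\<alpha> (int k - 1)))) = (-1) ^ M * int (\<alpha> (int M))" for M
  proof (induction M)
    case 0
    then show ?case using \<open>\<alpha> (-1) = 0\<close> by simp
  next
    case (Suc M)
    then show ?case by (simp add: algebra_simps)
  qed
  have "(\<Sum>k\<le>N. (-1) ^ k * int (betti k X)) =
      (\<Sum>k\<le>N. (-1) ^ k * int (betti k (subtopology X A))) + (\<Sum>k\<le>N. (-1) ^ k * (if k = d then 1 else 0))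
      - (\<Sum>k\<le>N. (-1) ^ k * (int (\<alpha> (int k)) + int (\<alpha> (int k - 1))))"
  proof -
    have "int (betti k X) = int (betti k (subtopology X A)) + (if k = d then 1 else 0)
        - (int (\<alpha> (int k)) + int (\<alpha> (int k - 1)))" for k
      using bA[of k] bX[of k] bR[of k] by (simp split: if_splits)
    note * = this
    show ?thesis
      unfolding * by (simp only: right_diff_distrib distrib_left sum.distrib sum_subtractf)
  qed
  moreover have "\<alpha> (int N) = 0" using N(1)[of N] bA[of N] by simp
  moreover have "(\<Sum>k\<le>N. (-1) ^ k * (if k = d then 1 else 0)) = ((-1) ^ d :: int)"
    using N(2) by (simp add: if_distrib[where f="\<lambda>x. _ * x"] cong: if_cong)
  ultimately show "euler_characteristic X = euler_characteristic (subtopology X A) + (- 1) ^ d"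
    using euler_characteristic_atMost[of N X] euler_characteristic_atMost[of N "subtopology X A"]
      bX0 N(1) tele[of N] by simp
qed

section \<open>The standard cube and attached cells\<close>

abbreviation real_space :: "nat set \<Rightarrow> (nat \<Rightarrow> real) topology" where
  "real_space J \<equiv> product_topology (\<lambda>_. euclideanreal) J"

definition closed_box :: "nat set \<Rightarrow> (nat \<Rightarrow> real) set" where
  "closed_box J = (\<Pi>\<^sub>E j\<in>J. {-1..1})"

definition open_box :: "nat set \<Rightarrow> (nat \<Rightarrow> real) set" where
  "open_box J = (\<Pi>\<^sub>E j\<in>J. {-1<..<1})"

definition cube :: "nat set \<Rightarrow> (nat \<Rightarrow> real) topology" where
  "cube J = subtopology (real_space J) (closed_box J)"

definition sup_norm :: "nat set \<Rightarrow> (nat \<Rightarrow> real) \<Rightarrow> real" where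
  "sup_norm J x = Max (insert 0 ((\<lambda>j. \<bar>x j\<bar>) ` J))"

lemma topspace_cube [simp]: "topspace (cube J) = closed_box J"
  by (auto simp: cube_def closed_box_def PiE_def)

lemma open_box_subset: "open_box J \<subseteq> closed_box J"
  unfolding open_box_def closed_box_def by (rule PiE_mono) auto

lemma Hausdorff_cube: "Hausdorff_space (cube J)"
  unfolding cube_def by (intro Hausdorff_space_subtopology) (simp add: Hausdorff_space_product_topology)

lemma compact_cube: "compact_space (cube J)"
proof -
  have "cube J = product_topology (\<lambda>_. top_of_set {-1..1}) J"
    unfolding cube_def closed_box_def by (simp add: subtopology_product_topology)
  then show ?thesis
    by (simp add: compact_space_product_topology compact_space_subtopology compactin_euclidean_iff)
qed

lemma continuous_map_into_real_space:
  "continuous_map Y (subtopology (real_space J) S) f \<longleftrightarrow>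
     f ` topspace Y \<subseteq> S \<inter> extensional J \<and> (\<forall>j\<in>J. continuous_map Y euclideanreal (\<lambda>y. f y j))"
  by (auto simp: continuous_map_in_subtopology continuous_map_componentwise image_subset_iff Pi_iff)

lemma continuous_map_coordinate:
  assumes "continuous_map Y (subtopology (real_space J) S) f" "j \<in> J"
  shows "continuous_map Y euclideanreal (\<lambda>y. f y j)"
  using assms by (simp add: continuous_map_into_real_space)

lemma sup_norm_le_iff: "finite J \<Longrightarrow> 0 \<le> r \<Longrightarrow> sup_norm J x \<le> r \<longleftrightarrow> (\<forall>j\<in>J. \<bar>x j\<bar> \<le> r)"
  unfolding sup_norm_def by simp

lemma sup_norm_less_iff: "finite J \<Longrightarrow> 0 < r \<Longrightarrow> sup_norm J x < r \<longleftrightarrow> (\<forall>j\<in>J. \<bar>x j\<bar> < r)"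
  unfolding sup_norm_def by simp

lemma sup_norm_nonneg: "finite J \<Longrightarrow> 0 \<le> sup_norm J x"
  unfolding sup_norm_def by simp

lemma sup_norm_scale:
  assumes "finite J" "0 \<le> c" shows "sup_norm J (\<lambda>j\<in>J. c * x j) = c * sup_norm J x"
proof -
  have "c * Max (insert 0 ((\<lambda>j. \<bar>x j\<bar>) ` J)) = Max ((*) c ` insert 0 ((\<lambda>j. \<bar>x j\<bar>) ` J))"
    using assms by (intro mono_Max_commute) (auto intro!: monoI mult_left_mono)
  also have "(*) c ` insert 0 ((\<lambda>j. \<bar>x j\<bar>) ` J) = insert 0 ((\<lambda>j. \<bar>(\<lambda>j\<in>J. c * x j) j\<bar>) ` J)"
    using assms by (auto simp: image_iff abs_mult)
  finally show ?thesis by (simp add: sup_norm_def)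
qed

lemma continuous_map_sup_norm:
  assumes "finite J" "\<And>j. j \<in> J \<Longrightarrow> continuous_map Y euclideanreal (\<lambda>y. f y j)"
  shows "continuous_map Y euclideanreal (\<lambda>y. sup_norm J (f y))"
  using assms
proof (induction J rule: finite_induct)
  case empty
  then show ?case by (simp add: sup_norm_def)
next
  case (insert i J)
  have "sup_norm (insert i J) (f y) = max \<bar>f y i\<bar> (sup_norm J (f y))" for y
    unfolding sup_norm_def using insert(1)
    by (simp add: insert_commute[of 0] max.left_commute)
  then show ?case
    using insert by (auto intro!: continuous_intros)
qed

lemma closed_box_iff: "finite J \<Longrightarrow> x \<in> closed_box J \<longleftrightarrow> x \<in> extensional J \<and> sup_norm J x \<le> 1"
  by (auto simp: closed_box_def sup_norm_le_iff PiE_def abs_le_iff Pi_iff)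

lemma open_box_iff: "finite J \<Longrightarrow> x \<in> open_box J \<longleftrightarrow> x \<in> extensional J \<and> sup_norm J x < 1"
  by (auto simp: open_box_def sup_norm_less_iff PiE_def abs_less_iff Pi_iff)

definition outer_box :: "nat set \<Rightarrow> (nat \<Rightarrow> real) set" where
  "outer_box J = {x \<in> open_box J. 1/2 < sup_norm J x}"

definition dilate :: "nat set \<Rightarrow> real \<Rightarrow> (nat \<Rightarrow> real) \<Rightarrow> nat \<Rightarrow> real" where
  "dilate J c x = (\<lambda>j\<in>J. c * x j)"

lemma dilate_extensional [simp]: "dilate J c x \<in> extensional J"
  by (simp add: dilate_def)

lemma sup_norm_dilate: "finite J \<Longrightarrow> 0 \<le> c \<Longrightarrow> sup_norm J (dilate J c x) = c * sup_norm J x"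
  unfolding dilate_def by (rule sup_norm_scale)

lemma dilate_one: "x \<in> extensional J \<Longrightarrow> dilate J 1 x = x"
  unfolding dilate_def by (auto simp: extensional_def)

lemma continuous_map_sqrt:
  "continuous_map Y euclideanreal f \<Longrightarrow> continuous_map Y euclideanreal (\<lambda>y. sqrt (f y))"
  by (simp add: continuous_map_atin tendsto_real_sqrt)

lemma continuous_map_dilate:
  assumes "continuous_map Y euclideanreal c" "\<And>j. j \<in> J \<Longrightarrow> continuous_map Y euclideanreal (\<lambda>y. f y j)"
    and "\<And>y. y \<in> topspace Y \<Longrightarrow> dilate J (c y) (f y) \<in> S"
  shows "continuous_map Y (subtopology (real_space J) S) (\<lambda>y. dilate J (c y) (f y))"
  unfolding continuous_map_into_real_space
proof (intro conjI ballI)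
  show "(\<lambda>y. dilate J (c y) (f y)) ` topspace Y \<subseteq> S \<inter> extensional J"
    using assms(3) by auto
  fix j assume j: "j \<in> J"
  have "continuous_map Y euclideanreal (\<lambda>y. c y * f y j)"
    using assms j by (intro continuous_intros) auto
  then show "continuous_map Y euclideanreal (\<lambda>y. dilate J (c y) (f y) j)"
    using j by (simp add: dilate_def)
qed

lemma continuous_map_snd_coordinate:
  assumes "j \<in> J"
  shows "continuous_map (prod_topology (top_of_set {0..1::real}) (subtopology (real_space J) S))
      euclideanreal (\<lambda>p. snd p j)"
  using assms by (intro continuous_map_coordinate[OF continuous_map_snd])

lemma continuous_map_fst_interval:
  "continuous_map (prod_topology (top_of_set {0..1::real}) Z) euclideanreal fst"
  using continuous_map_fst continuous_map_into_fulltopology by blast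

lemma contractible_open_box:
  assumes "finite J" shows "contractible_space (subtopology (real_space J) (open_box J))"
proof -
  let ?X = "subtopology (real_space J) (open_box J)"
  have top: "topspace ?X = open_box J" by (auto simp: open_box_def PiE_def)
  have "continuous_map (prod_topology (top_of_set {0..1}) ?X) ?X (\<lambda>p. dilate J (1 - fst p) (snd p))"
  proof (rule continuous_map_dilate)
    show "continuous_map (prod_topology (top_of_set {0..1}) ?X) euclideanreal (\<lambda>p. 1 - fst p)"
      by (intro continuous_map_diff continuous_map_fst_interval) simp
    fix p assume p: "p \<in> topspace (prod_topology (top_of_set {0..1::real}) ?X)"
    then have "(1 - fst p) * sup_norm J (snd p) < 1"
      using assms by (auto simp: open_box_iff)
        (smt (verit, best) mult_left_le_one_le sup_norm_nonneg)
    then show "dilate J (1 - fst p) (snd p) \<in> open_box J"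
      using assms p by (auto simp: open_box_iff sup_norm_dilate)
  qed (rule continuous_map_snd_coordinate)
  then have "homotopic_with (\<lambda>_. True) ?X ?X id (\<lambda>_. \<lambda>j\<in>J. 0)"
    by (subst homotopic_with, simp, intro exI[of _ "\<lambda>p. dilate J (1 - fst p) (snd p)"])
      (auto simp: open_box_iff assms dilate_one, simp add: dilate_def)
  then show ?thesis unfolding contractible_space_def by blast
qed

text \<open>Both maps are radial: Euclidean normalization onto the sphere, and rescaling to maximum norm 3/4
  back. The coordinates are renumbered by initial natural numbers, on which \<open>nsphere\<close> is defined.\<close>

lemma outer_box_homotopy_equivalent_nsphere:
  assumes J: "finite J" "J \<noteq> {}"
  shows "subtopology (real_space J) (outer_box J) homotopy_equivalent_space nsphere (card J - 1)"
proof -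
  define d where "d = card J"
  have d: "d > 0" using J unfolding d_def by (simp add: card_gt_0_iff)
  obtain b where b: "bij_betw b {..<d} J"
    using ex_bij_betw_nat_finite[OF J(1)] unfolding d_def atLeast0LessThan by blast
  define b' where "b' = inv_into {..<d} b"
  have bb': "b (b' j) = j" "b' j < d" if "j \<in> J" for j
    using b that unfolding b'_def
    by (auto simp: bij_betw_def f_inv_into_f)
  have b'b: "b' (b i) = i" "b i \<in> J" if "i < d" for i
    using b that unfolding b'_def by (auto simp: bij_betw_def)
  let ?P = "subtopology (real_space J) (outer_box J)"
  have topP: "topspace ?P = outer_box J" by (auto simp: outer_box_def open_box_def PiE_def)
  have topS: "topspace (nsphere (card J - 1)) = {x. (\<Sum>i<d. (x i)\<^sup>2) = 1 \<and> (\<forall>i\<ge>d. x i = 0)}"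
  proof -
    have "{..card J - 1} = {..<d}" "\<And>i. (card J - 1 < i) = (d \<le> i)"
      using d unfolding d_def by auto
    then show ?thesis by (simp add: nsphere)
  qed
  define N :: "(nat \<Rightarrow> real) \<Rightarrow> real" where "N x = sqrt (\<Sum>i<d. (x (b i))\<^sup>2)" for x
  have Npos: "N x > 0" if "0 < sup_norm J x" for x
  proof -
    have "\<not> (\<forall>j\<in>J. \<bar>x j\<bar> \<le> 0)"
      using that sup_norm_le_iff[OF J(1), of 0 x] by simp
    then obtain j where j: "j \<in> J" "x j \<noteq> 0" by auto
    have "0 < (\<Sum>i<d. (x (b i))\<^sup>2)"
      using j bb'[OF j(1)] by (intro sum_pos2[of _ "b' j"]) auto
    then show ?thesis unfolding N_def by simp
  qed
  define f where "f x = (\<lambda>i. if i < d then x (b i) / N x else 0)" for x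
  define w where "w y = (\<lambda>j\<in>J. y (b' j))" for y :: "nat \<Rightarrow> real"
  define g where "g y = dilate J (3/4 / sup_norm J (w y)) (w y)" for y
  have pos: "0 < sup_norm J x" if "x \<in> outer_box J" for x
    using that unfolding outer_box_def by auto
  have wpos: "0 < sup_norm J (w y)" if y: "y \<in> topspace (nsphere (card J - 1))" for y
  proof (rule ccontr)
    assume "\<not> 0 < sup_norm J (w y)"
    then have "\<forall>j\<in>J. w y j = 0" using sup_norm_le_iff[OF J(1), of 0 "w y"] by simp
    then have "\<forall>i<d. y i = 0" using b'b unfolding w_def by fastforce
    then show False using y unfolding topS by simp
  qed
  have contN: "continuous_map ?P euclideanreal N"
    unfolding N_def
    by (intro continuous_map_sqrt continuous_map_sum continuous_map_real_pow)
      (auto intro!: continuous_map_coordinate[OF continuous_map_id[unfolded id_def]] b'b)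
  have contf: "continuous_map ?P (nsphere (card J - 1)) f"
  proof -
    have "continuous_map ?P euclideanreal (\<lambda>x. f x i)" for i
    proof (cases "i < d")
      case True
      have "continuous_map ?P euclideanreal (\<lambda>x. x (b i) / N x)"
        using contN pos Npos topP True b'b
        by (intro continuous_map_real_divide)
         (auto intro!: continuous_map_coordinate[OF continuous_map_id[unfolded id_def]] simp: less_imp_neq[symmetric])
      then show ?thesis using True by (simp add: f_def)
    qed (simp add: f_def)
    moreover have "f x \<in> topspace (nsphere (card J - 1))" if "x \<in> outer_box J" for x
    proof -
      have "(\<Sum>i<d. (x (b i) / N x)\<^sup>2) = (\<Sum>i<d. (x (b i))\<^sup>2) / (N x)\<^sup>2"
        by (simp add: power_divide sum_divide_distrib)
      also have "(N x)\<^sup>2 = (\<Sum>i<d. (x (b i))\<^sup>2)"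
        unfolding N_def by (simp add: sum_nonneg)
      finally show ?thesis
        using Npos[OF pos[OF that]] unfolding topS f_def N_def by auto
    qed
    ultimately show ?thesis
      using topP topS unfolding nsphere
      by (auto simp: continuous_map_in_subtopology continuous_map_componentwise_UNIV image_subset_iff Pi_iff)
  qed
  have contw: "continuous_map (nsphere (card J - 1)) euclideanreal (\<lambda>y. w y j)" if "j \<in> J" for j
    using that unfolding w_def nsphere
    by (auto intro!: continuous_map_from_subtopology continuous_map_product_projection)
  have gP: "g y \<in> outer_box J" if y: "y \<in> topspace (nsphere (card J - 1))" for y
    using wpos[OF y] J unfolding g_def outer_box_def
    by (simp add: open_box_iff sup_norm_dilate)
  have contg: "continuous_map (nsphere (card J - 1)) ?P g"
    unfolding g_def
  proof (rule continuous_map_dilate)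
    show "continuous_map (nsphere (card J - 1)) euclideanreal (\<lambda>y. 3 / 4 / sup_norm J (w y))"
      using wpos contw J by (intro continuous_map_real_divide continuous_map_sup_norm)
        (auto simp: less_imp_neq[symmetric])
  qed (use contw gP g_def in auto)
  have fg: "f (g y) = y" if y: "y \<in> topspace (nsphere (card J - 1))" for y
  proof -
    let ?c = "3/4 / sup_norm J (w y)"
    have c: "?c > 0" using wpos[OF y] by simp
    have gy: "g y (b i) = ?c * y i" if "i < d" for i
      using b'b[OF that] by (simp add: g_def dilate_def w_def)
    have "N (g y) = sqrt (\<Sum>i<d. ?c\<^sup>2 * (y i)\<^sup>2)"
      unfolding N_def by (intro arg_cong[where f=sqrt] sum.cong) (simp_all only: gy lessThan_iff power_mult_distrib)
    also have "\<dots> = sqrt (?c\<^sup>2 * 1)"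
      using y unfolding topS by (simp only: sum_distrib_left[symmetric]) simp
    also have "\<dots> = ?c" using c by (simp add: real_sqrt_abs)
    finally have "N (g y) = ?c" .
    then have "f (g y) i = y i" for i
      using gy c y unfolding f_def topS by auto
    then show ?thesis by blast
  qed
  have gf: "g (f x) = dilate J (3/4 / sup_norm J x) x" if x: "x \<in> outer_box J" for x
  proof -
    have "w (f x) = dilate J (1 / N x) x"
      using bb' by (auto simp: w_def f_def dilate_def)
    moreover have "sup_norm J (dilate J (1 / N x) x) = 1 / N x * sup_norm J x"
      using Npos[OF pos[OF x]] by (intro sup_norm_dilate J) simp
    ultimately show ?thesis
      using Npos[OF pos[OF x]] pos[OF x] unfolding g_def by (auto simp: dilate_def)
  qed
  have "homotopic_with (\<lambda>_. True) ?P ?P id (g \<circ> f)"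
  proof -
    let ?h = "\<lambda>p. dilate J ((1 - fst p) + fst p * (3/4 / sup_norm J (snd p))) (snd p)"
    have "continuous_map (prod_topology (top_of_set {0..1}) ?P) ?P ?h"
    proof (rule continuous_map_dilate)
      show "continuous_map (prod_topology (top_of_set {0..1}) ?P) euclideanreal
          (\<lambda>p. (1 - fst p) + fst p * (3/4 / sup_norm J (snd p)))"
        using J pos topP
        by (intro continuous_intros continuous_map_fst_interval continuous_map_snd_coordinate continuous_map_sup_norm)
          (auto simp: less_imp_neq[symmetric])
      fix p assume p: "p \<in> topspace (prod_topology (top_of_set {0..1::real}) ?P)"
      obtain t x where tx: "p = (t, x)" "0 \<le> t" "t \<le> 1" "x \<in> outer_box J"
        using p topP by (cases p) auto
      define s where "s = sup_norm J x"
      have s: "1/2 < s" "s < 1" using tx J unfolding s_def outer_box_def by (auto simp: open_box_iff)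
      have "sup_norm J (?h p) = ((1 - t) + t * (3/4 / s)) * s"
        using tx s J unfolding s_def by (simp add: sup_norm_dilate)
      also have "\<dots> = (1 - t) * s + t * (3/4)" using s by (simp add: field_simps)
      finally have eq: "sup_norm J (?h p) = (1 - t) * s + t * (3/4)" .
      have "(1 - t) * s + t * (3/4) < 1" "1/2 < (1 - t) * s + t * (3/4)"
        using convex_bound_lt[of s 1 "3/4" "1 - t" t] convex_bound_lt[of "-s" "-(1/2)" "-(3/4)" "1 - t" t] tx s
        by (auto simp: algebra_simps)
      then show "?h p \<in> outer_box J"
        using eq J unfolding outer_box_def by (simp add: open_box_iff)
    qed (rule continuous_map_snd_coordinate)
    then show ?thesis
      using J topP gf
      by (subst homotopic_with, simp, intro exI[of _ ?h])
        (auto simp: outer_box_def open_box_iff dilate_one)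
  qed
  moreover have "homotopic_with (\<lambda>_. True) (nsphere (card J - 1)) (nsphere (card J - 1)) (f \<circ> g) id"
    using fg contf contg by (intro homotopic_with_equal) (auto intro: continuous_map_compose)
  ultimately show ?thesis
    unfolding homotopy_equivalent_space_def using contf contg homotopic_with_symD by blast
qed

text \<open>An open cube is contractible, so its homology relative to the outer shell is the reduced homology of
  a sphere, one degree lower. Without coordinates the shell is empty and the cube is a point.\<close>

lemma rank_open_box_outer_box:
  assumes J: "finite J"
  defines "R \<equiv> \<lambda>k::nat. relative_homology_group (int k) (subtopology (real_space J) (open_box J)) (outer_box J)"
  shows "finite_rank (R k)" "group_rank (R k) = (if k = card J then 1 else 0)"
proof -
  have comm: "comm_group (R k)" unfolding R_def by (rule abelian_relative_homology_group)
  have "if k = card J then R k \<cong> integer_group else trivial_group (R k)"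
  proof (cases "J = {}")
    case True
    have "open_box J = {\<lambda>_. undefined}" by (simp add: True open_box_def)
    moreover have "sup_norm J x = 0" for x by (simp add: True sup_norm_def)
    ultimately have ob: "outer_box J = {}" "topspace (subtopology (real_space J) (open_box J)) = {\<lambda>_. undefined}"
      by (auto simp: outer_box_def True)
    show ?thesis
      using homology_coefficients[OF ob(2)] homology_dimension_axiom[OF ob(2), of "int k"] True
      unfolding R_def ob(1) by auto
  next
    case False
    let ?X = "subtopology (real_space J) (open_box J)"
    have sub: "subtopology ?X (outer_box J) = subtopology (real_space J) (outer_box J)"
      by (simp add: subtopology_subtopology outer_box_def Int_absorb1 Collect_conj_eq Int_commute Int_assoc[symmetric])
    have ne: "topspace ?X \<inter> outer_box J \<noteq> {}"
    proof -
      obtain j where "j \<in> J" using False by blast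
      have "(\<lambda>j\<in>J. 3/4) \<in> outer_box J"
      proof -
        have "(\<lambda>j\<in>J. 3/4) = (\<lambda>j\<in>J. 3/4 * (\<lambda>_. 1) j :: real)" by simp
        moreover have "sup_norm J (\<lambda>_. 1) = 1"
          using False J by (auto simp: sup_norm_def image_constant_conv)
        ultimately have "sup_norm J (\<lambda>j\<in>J. 3/4) = 3/4"
          using sup_norm_scale[OF J, of "3/4" "\<lambda>_. 1"] by simp
        then show ?thesis using J by (simp add: outer_box_def open_box_iff)
      qed
      moreover have "outer_box J \<subseteq> topspace ?X" by (auto simp: outer_box_def open_box_def PiE_def)
      ultimately show ?thesis by blast
    qed
    have 1: "R k \<cong> reduced_homology_group (int k - 1) (subtopology (real_space J) (outer_box J))"
      using isomorphic_group_relative_homology_of_contractible[OF contractible_open_box[OF J] ne] sub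
      unfolding R_def by metis
    have 2: "reduced_homology_group (int k - 1) (subtopology (real_space J) (outer_box J))
        \<cong> reduced_homology_group (int k - 1) (nsphere (card J - 1))"
      by (rule homotopy_equivalent_space_imp_isomorphic_reduced_homology_groups
          [OF outer_box_homotopy_equivalent_nsphere[OF J False]])
    have cJ: "card J > 0" using J False by (simp add: card_gt_0_iff)
    have 3: "R k \<cong> reduced_homology_group (int k - 1) (nsphere (card J - 1))"
      using 1 2 iso_trans by blast
    show ?thesis
    proof (cases "k = card J")
      case True
      then have "int k - 1 = int (card J - 1)" using cJ by simp
      then show ?thesis
        using 3 reduced_homology_group_nsphere(1)[of "card J - 1"] True iso_trans by metis
    next
      case False
      then have "int k - 1 \<noteq> int (card J - 1)" using cJ by auto
      then have "trivial_group (reduced_homology_group (int k - 1) (nsphere (card J - 1)))"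
        by (rule reduced_homology_group_nsphere(2))
      moreover have "group (R k)" unfolding R_def by simp
      ultimately show ?thesis
        using 3 False isomorphic_group_triviality[of "R k"] group_reduced_homology_group by metis
    qed
  qed
  then show "finite_rank (R k)" "group_rank (R k) = (if k = card J then 1 else 0)"
    using rank_trivial_group[OF comm] rank_iso[OF comm abelian_integer_group] rank_integer_group
    by (auto split: if_splits)
qed

text \<open>Stretching the inner half of the cube over the whole cube, radially, fixes the boundary, so it
  extends by the identity to the space the cube is attached to. This deforms the complement of the
  inner half of the cell into \<open>A\<close>, and excision of \<open>A\<close> then leaves an open cube.\<close>

lemma relative_homology_attached_cell:
  fixes X :: "'a topology"
  assumes J: "finite J" and cont: "continuous_map (cube J) X \<phi>" and closed: "closed_map (cube J) X \<phi>"
    and inj: "inj_on \<phi> (open_box J)" and A: "closedin X A"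
    and cell: "\<phi> ` open_box J = topspace X - A" and bd: "\<phi> ` (closed_box J - open_box J) \<subseteq> A"
  shows "relative_homology_group p X A \<cong>
    relative_homology_group p (subtopology (real_space J) (open_box J)) (outer_box J)"
proof -
  let ?I = "top_of_set {0..1::real}"
  \<comment> \<open>The denominator moves from 1 to the maximum of 1/2 and the norm: at time 1 the outer half of
    the cube has reached the boundary, where the denominator is always 1.\<close>
  define stretch where
    "stretch t x = dilate J (1 / ((1 - t) + t * max (1/2) (sup_norm J x))) x" for t x
  define R where
    "R p = (if snd p \<in> A then snd p else \<phi> (stretch (fst p) (inv_into (open_box J) \<phi> (snd p))))" for p
  have AX: "A \<subseteq> topspace X" using A closedin_subset by blast
  have \<phi>A: "\<phi> x \<in> A \<longleftrightarrow> x \<notin> open_box J" if "x \<in> closed_box J" for x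
    using that cell bd by blast
  have \<phi>X: "\<phi> x \<in> topspace X" if "x \<in> closed_box J" for x
    using that continuous_map_image_subset_topspace[OF cont] by (simp only: topspace_cube) blast
  have denom: "1/2 \<le> (1 - t) + t * max (1/2) s" "s \<le> 1 \<Longrightarrow> s \<le> (1 - t) + t * max (1/2) s"
    "s \<le> 1 \<Longrightarrow> (1 - t) + t * max (1/2) s \<le> 1"
    if "0 \<le> t" "t \<le> 1" for t s :: real
  proof -
    have "t * (1/2) \<le> t * max (1/2) s" using that by (intro mult_left_mono) auto
    then show "1/2 \<le> (1 - t) + t * max (1/2) s" using that by simp
    assume s: "s \<le> 1"
    have "(1 - t) * s \<le> (1 - t) * 1" using that s by (intro mult_left_mono) auto
    moreover have "t * s \<le> t * max (1/2) s" using that by (intro mult_left_mono) auto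
    ultimately show "s \<le> (1 - t) + t * max (1/2) s" by (simp add: algebra_simps)
    have "t * max (1/2) s \<le> t * 1" using that s by (intro mult_left_mono) auto
    then show "(1 - t) + t * max (1/2) s \<le> 1" by simp
  qed
  have sup_stretch: "sup_norm J (stretch t x) = sup_norm J x / ((1 - t) + t * max (1/2) (sup_norm J x))"
    if "0 \<le> t" "t \<le> 1" for t x
    using denom(1)[OF that, of "sup_norm J x"] J unfolding stretch_def by (simp add: sup_norm_dilate)
  have stretch_box: "stretch t x \<in> closed_box J" if "0 \<le> t" "t \<le> 1" "x \<in> closed_box J" for t x
  proof -
    have "sup_norm J x \<le> 1" using that J by (simp add: closed_box_iff)
    then have "sup_norm J (stretch t x) \<le> 1"
      using denom[OF that(1,2), of "sup_norm J x"] sup_stretch[OF that(1,2), of x] by (simp add: divide_le_eq)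
    then show ?thesis using J by (simp add: closed_box_iff stretch_def)
  qed
  have stretch_bd: "stretch t x = x" if "x \<in> closed_box J" "x \<notin> open_box J" for t x
  proof -
    have "sup_norm J x = 1" using that J by (auto simp: closed_box_iff open_box_iff)
    then show ?thesis using that J by (simp add: stretch_def closed_box_iff dilate_one)
  qed
  have stretch_0: "stretch 0 x = x" if "x \<in> closed_box J" for x
    using that J by (simp add: stretch_def closed_box_iff dilate_one)
  have R\<phi>: "R (t, \<phi> x) = \<phi> (stretch t x)" if x: "x \<in> closed_box J" for t x
  proof (cases "x \<in> open_box J")
    case True
    then have "inv_into (open_box J) \<phi> (\<phi> x) = x" using inj by simp
    then show ?thesis using \<phi>A[OF x] True by (simp add: R_def)
  next
    case False
    then show ?thesis using \<phi>A[OF x] stretch_bd[OF x] by (simp add: R_def)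
  qed
  have RA: "R (t, y) = y" if "y \<in> A" for t y using that by (simp add: R_def)
  have cover: "\<exists>x\<in>open_box J. y = \<phi> x" if "y \<in> topspace X" "y \<notin> A" for y
    using that cell by blast
  have obox: "x \<in> closed_box J" if "x \<in> open_box J" for x using that open_box_subset by blast
  have contR: "continuous_map (prod_topology ?I X) X R"
    unfolding continuous_map_closedin
  proof (intro conjI allI impI)
    show "R \<in> topspace (prod_topology ?I X) \<rightarrow> topspace X"
    proof
      fix q assume "q \<in> topspace (prod_topology ?I X)"
      then obtain t y where q: "q = (t, y)" "0 \<le> t" "t \<le> 1" "y \<in> topspace X" by auto
      show "R q \<in> topspace X"
      proof (cases "y \<in> A")
        case False
        then obtain x where "x \<in> open_box J" "y = \<phi> x" using cover q by blast
        then show ?thesis using R\<phi> obox stretch_box \<phi>X q by auto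
      qed (use q RA in auto)
    qed
    fix C assume C: "closedin X C"
    let ?D = "{q \<in> topspace (prod_topology ?I (cube J)). \<phi> (stretch (fst q) (snd q)) \<in> C}"
    let ?\<Phi> = "\<lambda>(t, x). (id t, \<phi> x)"
    have "{q \<in> topspace (prod_topology ?I X). R q \<in> C} = {0..1} \<times> (A \<inter> C) \<union> ?\<Phi> ` ?D"
    proof (intro equalityI subsetI)
      fix q assume "q \<in> {q \<in> topspace (prod_topology ?I X). R q \<in> C}"
      then obtain t y where q: "q = (t, y)" "0 \<le> t" "t \<le> 1" "y \<in> topspace X" "R (t, y) \<in> C" by auto
      show "q \<in> {0..1} \<times> (A \<inter> C) \<union> ?\<Phi> ` ?D"
      proof (cases "y \<in> A")
        case True
        then show ?thesis using q RA by auto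
      next
        case False
        then obtain x where x: "x \<in> open_box J" "y = \<phi> x" using cover q by blast
        then have "(t, x) \<in> ?D" using q R\<phi>[OF obox] obox by auto
        then have "?\<Phi> (t, x) \<in> ?\<Phi> ` ?D" by blast
        then show ?thesis using q x by simp
      qed
    next
      fix q assume "q \<in> {0..1} \<times> (A \<inter> C) \<union> ?\<Phi> ` ?D"
      then show "q \<in> {q \<in> topspace (prod_topology ?I X). R q \<in> C}"
        using RA AX R\<phi> \<phi>X by (auto simp: subset_iff)
    qed
    moreover have "closedin (prod_topology ?I X) ({0..1} \<times> (A \<inter> C))"
      using A C by (simp add: closedin_prod_Times_iff closedin_Int)
    moreover have "closedin (prod_topology ?I X) (?\<Phi> ` ?D)"
    proof -
      have "proper_map (cube J) X \<phi>"
        unfolding proper_map_def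
      proof (intro conjI ballI closed)
        fix y assume "y \<in> topspace X"
        show "compactin (cube J) {x \<in> topspace (cube J). \<phi> x = y}"
        proof (cases "\<exists>x\<in>closed_box J. \<phi> x = y")
          case True
          then obtain x where x: "x \<in> closed_box J" "\<phi> x = y" by blast
          have "closedin (cube J) {x}"
            using Hausdorff_cube x(1) by (simp add: closedin_Hausdorff_sing_eq)
          then have "closedin X (\<phi> ` {x})" using closed unfolding closed_map_def by blast
          then have "closedin (cube J) {z \<in> topspace (cube J). \<phi> z \<in> {y}}"
            using x cont by (intro closedin_continuous_map_preimage[of _ X]) auto
          then show ?thesis using closedin_compact_space[OF compact_cube] by simp
        next
          case False
          then have "{x \<in> topspace (cube J). \<phi> x = y} = {}" by auto
          then show ?thesis by (metis compactin_empty)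
        qed
      qed
      then have "proper_map (prod_topology ?I (cube J)) (prod_topology ?I X) ?\<Phi>"
        unfolding proper_map_prod by (simp add: proper_map_id[unfolded id_def] id_def)
      then have "closed_map (prod_topology ?I (cube J)) (prod_topology ?I X) ?\<Phi>"
        by (rule proper_imp_closed_map)
      moreover have "closedin (prod_topology ?I (cube J)) ?D"
      proof (rule closedin_continuous_map_preimage[OF _ C])
        have "continuous_map (prod_topology ?I (cube J)) (subtopology (real_space J) (closed_box J))
            (\<lambda>q. stretch (fst q) (snd q))"
          unfolding stretch_def
        proof (rule continuous_map_dilate)
          have "(1 - fst q) + fst q * max (1/2) (sup_norm J (snd q)) \<noteq> 0"
            if "q \<in> topspace (prod_topology ?I (cube J))" for q
            using denom(1)[of "fst q" "sup_norm J (snd q)"] that by auto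
          then show "continuous_map (prod_topology ?I (cube J)) euclideanreal
             (\<lambda>q. 1 / (1 - fst q + fst q * max (1/2) (sup_norm J (snd q))))"
            using J by (intro continuous_intros continuous_map_fst_interval continuous_map_sup_norm
                continuous_map_snd_coordinate[of _ J "closed_box J", folded cube_def]) auto
        qed (use stretch_box in \<open>auto simp: stretch_def[symmetric]
            intro: continuous_map_snd_coordinate[of _ J "closed_box J", folded cube_def]\<close>)
        then show "continuous_map (prod_topology ?I (cube J)) X (\<lambda>q. \<phi> (stretch (fst q) (snd q)))"
          using cont continuous_map_compose[of _ "cube J" _ X \<phi>] by (simp add: o_def cube_def)
      qed
      ultimately show ?thesis unfolding closed_map_def by blast
    qed
    ultimately show "closedin (prod_topology ?I X) {q \<in> topspace (prod_topology ?I X). R q \<in> C}"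
      by (simp add: closedin_Un)
  qed
  define K where "K = {x \<in> closed_box J. sup_norm J x \<le> 1/2}"
  define B where "B = topspace X - \<phi> ` K"
  have K: "K \<subseteq> open_box J" unfolding K_def using J by (auto simp: closed_box_iff open_box_iff)
  have "closedin (cube J) {x \<in> topspace (cube J). sup_norm J x \<in> {..1/2}}"
    using J by (intro closedin_continuous_map_preimage[of _ euclideanreal] continuous_map_sup_norm)
      (auto simp: cube_def intro: continuous_map_coordinate[OF continuous_map_id[unfolded id_def]])
  then have "closedin (cube J) K" by (simp add: K_def)
  then have openB: "openin X B"
    using closed unfolding B_def closed_map_def by (simp add: openin_diff)
  have AB: "A \<subseteq> B" unfolding B_def using AX \<phi>A K obox by blast
  have B\<phi>: "\<phi> x \<in> B \<longleftrightarrow> x \<notin> K" if "x \<in> closed_box J" for x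
  proof
    assume "x \<notin> K"
    show "\<phi> x \<in> B"
    proof (cases "x \<in> open_box J")
      case True
      then show ?thesis unfolding B_def using \<phi>X[OF that] inj K \<open>x \<notin> K\<close>
        by (auto dest: inj_onD)
    qed (use \<phi>A that AB in blast)
  qed (auto simp: B_def)
  have RB: "R (t, y) \<in> B" if t: "0 \<le> t" "t \<le> 1" and y: "y \<in> B" for t y
  proof (cases "y \<in> A")
    case False
    then obtain x where x: "x \<in> open_box J" "y = \<phi> x" using cover y unfolding B_def by blast
    then have xK: "x \<notin> K" using B\<phi> obox y by blast
    have s: "1/2 < sup_norm J x" "sup_norm J x < 1"
      using xK x obox J unfolding K_def by (auto simp: open_box_iff)
    have "sup_norm J x \<le> sup_norm J (stretch t x)"
      using sup_stretch[OF t, of x] denom[OF t, of "sup_norm J x"] s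
      by (simp add: le_divide_eq mult_left_le)
    then have "stretch t x \<notin> K" using s unfolding K_def by auto
    then show ?thesis using B\<phi> R\<phi> stretch_box t x obox by metis
  qed (use RA y in auto)
  have R1B: "R (1, y) \<in> A" if y: "y \<in> B" for y
  proof (cases "y \<in> A")
    case False
    then obtain x where x: "x \<in> open_box J" "y = \<phi> x" using cover y unfolding B_def by blast
    then have xK: "x \<notin> K" using B\<phi> obox y by blast
    have s: "1/2 < sup_norm J x" using xK x obox J unfolding K_def by auto
    have "sup_norm J (stretch 1 x) = 1" using sup_stretch[of 1 x] s by simp
    then have "stretch 1 x \<notin> open_box J" using J by (simp add: open_box_iff)
    then show ?thesis using \<phi>A R\<phi> stretch_box[of 1 x] x obox by auto
  qed (use RA y in auto)
  have R0: "R (0, y) = y" if y: "y \<in> topspace X" for y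
  proof (cases "y \<in> A")
    case False
    then obtain x where x: "x \<in> open_box J" "y = \<phi> x" using cover y by blast
    then show ?thesis using R\<phi> obox stretch_0 by simp
  qed (use RA in auto)
  have hom: "homotopic_with (\<lambda>h. h \<in> S \<rightarrow> S) X X id (\<lambda>y. R (1, y))"
    if S: "S \<subseteq> topspace X" "\<And>t y. 0 \<le> t \<Longrightarrow> t \<le> 1 \<Longrightarrow> y \<in> S \<Longrightarrow> R (t, y) \<in> S" for S
  proof (subst homotopic_with)
    show "(h \<in> S \<rightarrow> S) \<longleftrightarrow> (k \<in> S \<rightarrow> S)" if "\<And>x. x \<in> topspace X \<Longrightarrow> h x = k x" for h k
      using that S(1) by (auto simp: Pi_iff subset_iff)
    show "\<exists>h. continuous_map (prod_topology ?I X) X h \<and> (\<forall>x\<in>topspace X. h (0, x) = id x) \<and>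
        (\<forall>x\<in>topspace X. h (1, x) = R (1, x)) \<and> (\<forall>t\<in>{0..1}. (\<lambda>x. h (t, x)) \<in> S \<rightarrow> S)"
      using contR R0 S(2) by (intro exI[of _ R]) auto
  qed
  have BX: "B \<subseteq> topspace X" unfolding B_def by blast
  have homA: "homotopic_with (\<lambda>h. h \<in> A \<rightarrow> A) X X id (\<lambda>y. R (1, y))"
    using RA by (intro hom AX) simp
  have homB: "homotopic_with (\<lambda>h. h \<in> B \<rightarrow> B) X X id (\<lambda>y. R (1, y))"
    by (intro hom BX RB)
  have contR1: "continuous_map X X (\<lambda>y. R (1, y))"
    using homA homotopic_with_imp_continuous_maps by blast
  have 1: "relative_homology_group p X A \<cong> relative_homology_group p X B"
  proof -
    have "hom_induced p X A X B id \<in> iso (relative_homology_group p X A) (relative_homology_group p X B)"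
      by (rule homotopy_equivalence_relative_homology_group_isomorphism[where g="\<lambda>y. R (1, y)"])
       (use contR1 R1B AB homotopic_with_symD[OF homA] homotopic_with_symD[OF homB] in auto)
    then show ?thesis by (rule is_isoI)
  qed
  have 2: "relative_homology_group p (subtopology X (topspace X - A)) (B - A) \<cong> relative_homology_group p X B"
  proof -
    have "X closure_of A \<subseteq> X interior_of B"
      using A openB AB by (simp add: closure_of_closedin interior_of_openin)
    from homology_excision_axiom[OF this BX, of p] show ?thesis
      by (simp add: is_isoI)
  qed
  have 3: "relative_homology_group p (subtopology (real_space J) (open_box J)) (outer_box J) \<cong>
      relative_homology_group p (subtopology X (topspace X - A)) (B - A)"
  proof -
    have eq: "{x \<in> topspace (cube J). \<phi> x \<in> topspace X - A} = open_box J"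
      using \<phi>A \<phi>X obox by auto
    have sub: "subtopology (cube J) (open_box J) = subtopology (real_space J) (open_box J)"
      using open_box_subset[of J] by (simp add: cube_def subtopology_subtopology Int_absorb1)
    have top: "topspace (subtopology (real_space J) (open_box J)) = open_box J"
      by (auto simp: open_box_def PiE_def)
    have "homeomorphic_map (subtopology (real_space J) (open_box J)) (subtopology X (topspace X - A)) \<phi>"
    proof (rule bijective_closed_imp_homeomorphic_map)
      show "continuous_map (subtopology (real_space J) (open_box J)) (subtopology X (topspace X - A)) \<phi>"
        using cont cell unfolding sub[symmetric]
        by (auto simp: continuous_map_in_subtopology continuous_map_from_subtopology)
      show "closed_map (subtopology (real_space J) (open_box J)) (subtopology X (topspace X - A)) \<phi>"
        using closed_map_restriction[OF closed eq] sub by simp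
    qed (use cell inj top in auto)
    moreover have "\<phi> ` outer_box J = B - A"
    proof
      show "\<phi> ` outer_box J \<subseteq> B - A"
      proof
        fix y assume "y \<in> \<phi> ` outer_box J"
        then obtain x where x: "x \<in> open_box J" "1/2 < sup_norm J x" "y = \<phi> x"
          unfolding outer_box_def by blast
        then show "y \<in> B - A" using B\<phi>[OF obox] \<phi>A[OF obox] by (simp add: K_def)
      qed
      show "B - A \<subseteq> \<phi> ` outer_box J"
      proof
        fix y assume y: "y \<in> B - A"
        then obtain x where x: "x \<in> open_box J" "y = \<phi> x" using cover BX by blast
        then have "x \<in> outer_box J" using y B\<phi> obox by (auto simp: outer_box_def K_def)
        then show "y \<in> \<phi> ` outer_box J" using x by blast
      qed
    qed
    ultimately have "hom_induced p (subtopology (real_space J) (open_box J)) (outer_box J)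
        (subtopology X (topspace X - A)) (B - A) \<phi> \<in> iso
        (relative_homology_group p (subtopology (real_space J) (open_box J)) (outer_box J))
        (relative_homology_group p (subtopology X (topspace X - A)) (B - A))"
      using top by (intro homeomorphic_map_relative_homology_iso) (auto simp: outer_box_def)
    then show ?thesis by (rule is_isoI)
  qed
  show ?thesis
    using 1 2 3 iso_trans group.iso_sym group_relative_homology_group by metis
qed

lemma attach_cell:
  fixes X :: "'a topology"
  assumes "finite J" "continuous_map (cube J) X \<phi>" "closed_map (cube J) X \<phi>"
    "inj_on \<phi> (open_box J)" "closedin X A"
    "\<phi> ` open_box J = topspace X - A" "\<phi> ` (closed_box J - open_box J) \<subseteq> A"
    and fin: "finite_homology (subtopology X A)"
  shows "finite_homology X"
    and "euler_characteristic X = euler_characteristic (subtopology X A) + (- 1) ^ card J"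
proof -
  have *: "finite_rank (relative_homology_group (int k) X A)"
    "group_rank (relative_homology_group (int k) X A) = (if k = card J then 1 else 0)" for k :: nat
    using rank_iso[OF abelian_relative_homology_group abelian_relative_homology_group
        relative_homology_attached_cell[OF assms(1-7), of "int k"]]
      rank_open_box_outer_box[OF assms(1), of k] by auto
  show "finite_homology X"
    "euler_characteristic X = euler_characteristic (subtopology X A) + (- 1) ^ card J"
    using euler_characteristic_pair[OF fin *] by auto
qed

text \<open>A cell of the largest dimension can be removed: the boundary condition makes the union of the other open
  cells equal to the union of their closed cells, which is closed.\<close>

theorem euler_characteristic_cells:
  fixes X :: "'a topology" and J :: "'i \<Rightarrow> nat set"
  assumes I: "finite I" and J: "\<And>i. i \<in> I \<Longrightarrow> finite (J i)"
    and cont: "\<And>i. i \<in> I \<Longrightarrow> continuous_map (cube (J i)) X (\<phi> i)"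
    and closed: "\<And>i. i \<in> I \<Longrightarrow> closed_map (cube (J i)) X (\<phi> i)"
    and inj: "\<And>i. i \<in> I \<Longrightarrow> inj_on (\<phi> i) (open_box (J i))"
    and cover: "topspace X = (\<Union>i\<in>I. \<phi> i ` open_box (J i))"
    and disj: "\<And>i j. i \<in> I \<Longrightarrow> j \<in> I \<Longrightarrow> i \<noteq> j \<Longrightarrow> \<phi> i ` open_box (J i) \<inter> \<phi> j ` open_box (J j) = {}"
    and bd: "\<And>i. i \<in> I \<Longrightarrow> \<phi> i ` (closed_box (J i) - open_box (J i)) \<subseteq>
        (\<Union>j\<in>{j \<in> I. card (J j) < card (J i)}. \<phi> j ` open_box (J j))"
  shows "finite_homology X \<and> euler_characteristic X = (\<Sum>i\<in>I. (- 1) ^ card (J i))"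
  using assms
proof (induction "card I" arbitrary: I X)
  case 0
  then have "topspace X = {}" "I = {}" by auto
  then have triv: "trivial_group (homology_group (int k) X)" for k
    by (simp add: trivial_homology_group_empty)
  have b: "betti k X = 0" for k
    unfolding betti_def by (intro rank_trivial_group abelian_relative_homology_group triv)
  have "finite_rank (homology_group (int k) X)" for k
    by (intro rank_trivial_group abelian_relative_homology_group triv)
  then show ?case
    using \<open>I = {}\<close> b unfolding finite_homology_def euler_characteristic_def by simp
next
  case (Suc m)
  note I = Suc.prems(1) and J = Suc.prems(2) and cont = Suc.prems(3) and closed = Suc.prems(4)
    and inj = Suc.prems(5) and cover = Suc.prems(6) and disj = Suc.prems(7) and bd = Suc.prems(8)
  have "I \<noteq> {}" using Suc.hyps(2) by auto
  then have "Max ((\<lambda>i. card (J i)) ` I) \<in> (\<lambda>i. card (J i)) ` I"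
    using I by (intro Max_in) auto
  then obtain i where i: "i \<in> I" and "Max ((\<lambda>i. card (J i)) ` I) = card (J i)" by blast
  then have max: "card (J j) \<le> card (J i)" if "j \<in> I" for j
    using I that by (metis Max_ge finite_imageI imageI)
  define I' where "I' = I - {i}"
  define A where "A = (\<Union>j\<in>I'. \<phi> j ` open_box (J j))"
  have I': "finite I'" "m = card I'" "I' \<subseteq> I" and insI: "I = insert i I'" "i \<notin> I'"
    using I i Suc.hyps(2) unfolding I'_def by auto
  have bdA: "\<phi> j ` (closed_box (J j) - open_box (J j)) \<subseteq>
      (\<Union>k\<in>{k \<in> I'. card (J k) < card (J j)}. \<phi> k ` open_box (J k))" if j: "j \<in> I" for j
  proof -
    have "{k \<in> I. card (J k) < card (J j)} \<subseteq> {k \<in> I'. card (J k) < card (J j)}"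
      using max[OF j] unfolding I'_def by auto
    then show ?thesis using bd[OF j] by blast
  qed
  have Aclosed_box: "A = (\<Union>j\<in>I'. \<phi> j ` closed_box (J j))"
  proof
    show "A \<subseteq> (\<Union>j\<in>I'. \<phi> j ` closed_box (J j))"
      unfolding A_def using open_box_subset by blast
    show "(\<Union>j\<in>I'. \<phi> j ` closed_box (J j)) \<subseteq> A"
    proof (intro UN_least image_subsetI)
      fix j x assume jx: "j \<in> I'" "x \<in> closed_box (J j)"
      show "\<phi> j x \<in> A"
      proof (cases "x \<in> open_box (J j)")
        case True
        then show ?thesis using jx unfolding A_def by blast
      next
        case False
        then have "\<phi> j x \<in> \<phi> j ` (closed_box (J j) - open_box (J j))" using jx by blast
        then show ?thesis using bdA[of j] jx I' unfolding A_def by blast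
      qed
    qed
  qed
  have "closedin X (\<phi> j ` closed_box (J j))" if "j \<in> I" for j
    using closed[OF that] closedin_topspace[of "cube (J j)"] unfolding closed_map_def topspace_cube by blast
  then have A: "closedin X A"
    unfolding Aclosed_box using I' by (intro closedin_Union) auto
  have AX: "A \<subseteq> topspace X" using A closedin_subset by blast
  then have topA: "topspace (subtopology X A) = A" by auto
  have IH: "finite_homology (subtopology X A) \<and>
      euler_characteristic (subtopology X A) = (\<Sum>j\<in>I'. (- 1) ^ card (J j))"
  proof (rule Suc.hyps(1))
    show "continuous_map (cube (J j)) (subtopology X A) (\<phi> j)" if "j \<in> I'" for j
      using cont[of j] that I' Aclosed_box by (auto simp: continuous_map_in_subtopology)
    show "closed_map (cube (J j)) (subtopology X A) (\<phi> j)" if "j \<in> I'" for j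
      unfolding closed_map_def
    proof (intro allI impI)
      fix C assume C: "closedin (cube (J j)) C"
      then have "C \<subseteq> closed_box (J j)" using closedin_subset topspace_cube by metis
      then have "\<phi> j ` C \<subseteq> A" using that Aclosed_box by blast
      moreover have "closedin X (\<phi> j ` C)"
        using closed[of j] that I' C unfolding closed_map_def by blast
      ultimately show "closedin (subtopology X A) (\<phi> j ` C)"
        using A by (simp add: closedin_closed_subtopology)
    qed
    show "\<phi> j ` open_box (J j) \<inter> \<phi> k ` open_box (J k) = {}" if "j \<in> I'" "k \<in> I'" "j \<noteq> k" for j k
      using disj[of j k] that I' by blast
    show "\<phi> j ` (closed_box (J j) - open_box (J j)) \<subseteq>
        (\<Union>k\<in>{k \<in> I'. card (J k) < card (J j)}. \<phi> k ` open_box (J k))" if "j \<in> I'" for j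
      using bdA[of j] that I' by blast
    show "topspace (subtopology X A) = (\<Union>i\<in>I'. \<phi> i ` open_box (J i))"
      using topA A_def by simp
  qed (use I' J inj in auto)
  have cell: "\<phi> i ` open_box (J i) = topspace X - A"
  proof -
    have "\<phi> i ` open_box (J i) \<inter> A = {}"
      using disj[OF i] insI I' unfolding A_def by blast
    moreover have "topspace X = \<phi> i ` open_box (J i) \<union> A"
      using cover insI unfolding A_def by auto
    ultimately show ?thesis by blast
  qed
  have bdi: "\<phi> i ` (closed_box (J i) - open_box (J i)) \<subseteq> A"
    using bdA[OF i] unfolding A_def by blast
  show ?case
    using attach_cell[OF J[OF i] cont[OF i] closed[OF i] inj[OF i] A cell bdi] IH insI I' by simp
qed

section \<open>Metric graphs and their isometries\<close>

lemma connected_cut: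
  assumes conn: "Digraph_Component.connected G" and u: "u \<in> verts G" "u \<in> S" and v: "v \<in> verts G"
    and cut: "\<And>e. e \<in> arcs G \<Longrightarrow> tail G e \<in> S \<longleftrightarrow> head G e \<in> S"
  shows "v \<in> S"
proof -
  have "u \<rightarrow>\<^sup>*\<^bsub>mk_symmetric G\<^esub> v"
    using conn u v unfolding Digraph_Component.connected_def strongly_connected_def by auto
  then have "(u, v) \<in> rtrancl_on (verts G) (parcs (mk_symmetric G))"
    by (simp add: reachable_def)
  then show ?thesis
  proof (induction rule: rtrancl_on_induct)
    case base
    show ?case by (rule u)
  next
    case (step y z)
    then show ?case using cut by (auto simp: parcs_mk_symmetric)
  qed
qed

lemma connected_complete:
  assumes "verts G \<noteq> {}"
    and adj: "\<And>u v. u \<in> verts G \<Longrightarrow> v \<in> verts G \<Longrightarrow> u \<noteq> v \<Longrightarrow>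
      \<exists>e\<in>arcs G. tail G e = u \<and> head G e = v \<or> tail G e = v \<and> head G e = u"
  shows "Digraph_Component.connected G"
proof -
  have "u \<rightarrow>\<^sup>*\<^bsub>mk_symmetric G\<^esub> v" if uv: "u \<in> verts G" "v \<in> verts G" for u v
  proof (cases "u = v")
    case True
    then show ?thesis using uv by (simp add: reachable_def)
  next
    case False
    then have "(u, v) \<in> parcs (mk_symmetric G)" using adj[OF uv] by (auto simp: parcs_mk_symmetric)
    then have "(u, v) \<in> rtrancl_on (verts G) (parcs (mk_symmetric G))"
      using uv by (intro rtrancl_on_into_rtrancl_on[OF rtrancl_on_refl]) auto
    then show ?thesis by (simp add: reachable_def)
  qed
  then show ?thesis
    using assms(1) unfolding Digraph_Component.connected_def strongly_connected_def by auto
qed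

lemma min_min_lipschitz:
  "\<bar>a - a'\<bar> \<le> d \<Longrightarrow> \<bar>b - b'\<bar> \<le> d \<Longrightarrow> 0 \<le> d \<Longrightarrow> \<bar>min c (min a b) - min c (min a' b')\<bar> \<le> d"
  for a b c d :: real
  by (auto simp: min_def abs_if split: if_splits)

lemma min_lipschitz: "\<bar>min c a - min c b\<bar> \<le> \<bar>a - b\<bar>" for a b c :: real
  by (auto simp: min_def abs_if)

locale metric_graph =
  fixes G :: "('v, 'e) pre_digraph" and l :: "'e \<Rightarrow> real"
  assumes multigraph: "multigraph G" and pos: "e \<in> arcs G \<Longrightarrow> 0 < l e"
begin

lemma wf: "e \<in> arcs G \<Longrightarrow> tail G e \<in> verts G" "e \<in> arcs G \<Longrightarrow> head G e \<in> verts G"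
  and fin: "finite (arcs G)" "finite (verts G)"
proof -
  interpret fin_digraph G using multigraph by (simp add: multigraph_def)
  show "e \<in> arcs G \<Longrightarrow> tail G e \<in> verts G" "e \<in> arcs G \<Longrightarrow> head G e \<in> verts G"
    "finite (arcs G)" "finite (verts G)" by auto
qed

lemma edge_point_gpoints: "e \<in> arcs G \<Longrightarrow> s \<in> {0..1} \<Longrightarrow> edge_point G e s \<in> gpoints G"
  using wf by (auto simp: edge_point_def gpoints_def)

lemma Interior_gpoints [simp]: "Interior e s \<in> gpoints G \<longleftrightarrow> e \<in> arcs G \<and> 0 < s \<and> s < 1"
  by (auto simp: gpoints_def)

lemma Vertex_gpoints [simp]: "Vertex v \<in> gpoints G \<longleftrightarrow> v \<in> verts G"
  by (auto simp: gpoints_def)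

lemma edge_point_interior: "0 < s \<Longrightarrow> s < 1 \<Longrightarrow> edge_point G e s = Interior e s"
  by (simp add: edge_point_def)

lemma joined_edge:
  "e \<in> arcs G \<Longrightarrow> s \<in> {0..1} \<Longrightarrow> t \<in> {0..1} \<Longrightarrow>
    joined G l (edge_point G e s) (l e * \<bar>s - t\<bar>) (edge_point G e t)"
  using joined.move[OF joined.start[OF edge_point_gpoints]] by fastforce

lemma joined_trans: "joined G l y r' z \<Longrightarrow> joined G l x r y \<Longrightarrow> joined G l x (r + r') z"
proof (induction rule: joined.induct)
  case (move r' e s t)
  from joined.move[OF move.IH[OF move.prems] move.hyps(2-4)] show ?case by (simp add: add.assoc)
qed simp

lemma joined_nonneg: "joined G l x r y \<Longrightarrow> 0 \<le> r"
  by (induction rule: joined.induct) (use pos in \<open>auto simp: less_imp_le\<close>)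

lemma joined_lipschitz:
  assumes "joined G l x r y"
    and "\<And>e s t. e \<in> arcs G \<Longrightarrow> s \<in> {0..1} \<Longrightarrow> t \<in> {0..1} \<Longrightarrow>
      \<bar>f (edge_point G e s) - f (edge_point G e t)\<bar> \<le> l e * \<bar>s - t\<bar>"
  shows "\<bar>f x - f y\<bar> \<le> r"
  using assms(1)
proof (induction rule: joined.induct)
  case (move r e s t)
  then show ?case using assms(2)[OF move.hyps(2-4)] by linarith
qed simp

lemma joined_exists:
  assumes x: "x \<in> gpoints G" and y: "y \<in> gpoints G"
  shows "\<exists>r. joined G l x r y"
proof -
  have end0: "\<exists>e s. z = edge_point G e s \<and> e \<in> arcs G \<and> s \<in> {0..1}" if z: "z \<in> gpoints G" "z \<notin> range Vertex" for z
  proof -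
    obtain e s where "z = Interior e s" "e \<in> arcs G" "0 < s" "s < 1" using z by (cases z) auto
    then show ?thesis by (intro exI[of _ e] exI[of _ s]) (auto simp: edge_point_interior)
  qed
  have tov: "\<exists>v r. v \<in> verts G \<and> joined G l z r (Vertex v) \<and> joined G l (Vertex v) r z" if z: "z \<in> gpoints G" for z
  proof (cases "z \<in> range Vertex")
    case True
    then obtain v where "z = Vertex v" by blast
    then show ?thesis using z joined.start[of z G l] by (intro exI[of _ v] exI[of _ 0]) auto
  next
    case False
    then obtain e s where e: "z = edge_point G e s" "e \<in> arcs G" "s \<in> {0..1}" using end0 z by blast
    have "edge_point G e 0 = Vertex (tail G e)" by (simp add: edge_point_def)
    then show ?thesis
      using joined_edge[OF e(2,3), of 0] joined_edge[OF e(2) _ e(3), of 0] e wf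
      by (intro exI[of _ "tail G e"] exI[of _ "l e * s"]) simp
  qed
  obtain u r where u: "u \<in> verts G" "joined G l x r (Vertex u)" using tov[OF x] by blast
  obtain v r' where v: "v \<in> verts G" "joined G l (Vertex v) r' y" using tov[OF y] by blast
  have "v \<in> {w. \<exists>r. joined G l x r (Vertex w)}"
  proof (rule connected_cut[of G u])
    show "Digraph_Component.connected G" using multigraph by (simp add: multigraph_def)
    fix e assume e: "e \<in> arcs G"
    have "joined G l (Vertex (tail G e)) (l e) (Vertex (head G e))"
      "joined G l (Vertex (head G e)) (l e) (Vertex (tail G e))"
      using joined_edge[OF e, of 0 1] joined_edge[OF e, of 1 0] by (simp_all add: edge_point_def)
    from this[THEN joined_trans]
    show "tail G e \<in> {w. \<exists>r. joined G l x r (Vertex w)} \<longleftrightarrow> head G e \<in> {w. \<exists>r. joined G l x r (Vertex w)}"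
      by blast
  qed (use u v in auto)
  then obtain r'' where "joined G l x r'' (Vertex v)" by blast
  from joined_trans[OF v(2) this] show ?thesis by (rule exI)
qed

lemma path_dist_le: "joined G l x r y \<Longrightarrow> path_dist G l x y \<le> r"
  unfolding path_dist_def using joined_nonneg
  by (intro cInf_lower) (auto intro!: bdd_belowI[of _ 0])

lemma path_dist_edge_le:
  "e \<in> arcs G \<Longrightarrow> s \<in> {0..1} \<Longrightarrow> t \<in> {0..1} \<Longrightarrow>
    path_dist G l (edge_point G e s) (edge_point G e t) \<le> l e * \<bar>s - t\<bar>"
  by (intro path_dist_le joined_edge)

text \<open>Lower bounds for distances come from functions that are 1-Lipschitz along every edge.\<close>

lemma path_dist_ge:
  assumes "x \<in> gpoints G" "y \<in> gpoints G"
    and "\<And>e s t. e \<in> arcs G \<Longrightarrow> s \<in> {0..1} \<Longrightarrow> t \<in> {0..1} \<Longrightarrow>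
      \<bar>f (edge_point G e s) - f (edge_point G e t)\<bar> \<le> l e * \<bar>s - t\<bar>"
  shows "\<bar>f x - f y\<bar> \<le> path_dist G l x y"
  unfolding path_dist_def using joined_exists[OF assms(1,2)]
  by (intro cInf_greatest) (auto intro: joined_lipschitz[OF _ assms(3)])

text \<open>The distance along the edge, cut off at the distance \<open>\<epsilon>\<close> to the nearer end and
  constant outside the edge, is 1-Lipschitz along every edge.\<close>

lemma path_dist_interior_ge:
  assumes e: "e \<in> arcs G" and s: "0 < s" "s < 1" and y: "y \<in> gpoints G"
  defines "\<epsilon> \<equiv> l e * min s (1 - s)"
  shows "(case y of Vertex v \<Rightarrow> \<epsilon> | Interior e' t \<Rightarrow> if e' = e then min \<epsilon> (l e * \<bar>t - s\<bar>) else \<epsilon>)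
    \<le> path_dist G l (Interior e s) y"
proof -
  define f where "f z = (case z of Vertex v \<Rightarrow> \<epsilon> | Interior e' t \<Rightarrow>
      if e' = e then min \<epsilon> (l e * \<bar>t - s\<bar>) else \<epsilon>)" for z :: "('v, 'e) gpoint"
  have l: "0 < l e" using pos e by simp
  have \<epsilon>: "0 < \<epsilon>" "\<epsilon> \<le> l e * s" "\<epsilon> \<le> l e * (1 - s)"
    using l s unfolding \<epsilon>_def by auto
  have fe: "f (edge_point G e t) = min \<epsilon> (l e * \<bar>t - s\<bar>)" if "t \<in> {0..1}" for t
    using that \<epsilon> s by (auto simp: f_def edge_point_def)
  have fe': "f (edge_point G e' t) = \<epsilon>" if "e' \<noteq> e" for e' t
    using that by (auto simp: f_def edge_point_def)
  have "\<bar>f (edge_point G e' t) - f (edge_point G e' t')\<bar> \<le> l e' * \<bar>t - t'\<bar>"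
    if "e' \<in> arcs G" "t \<in> {0..1}" "t' \<in> {0..1}" for e' t t'
  proof (cases "e' = e")
    case True
    have "\<bar>l e * \<bar>t - s\<bar> - l e * \<bar>t' - s\<bar>\<bar> = l e * \<bar>\<bar>t - s\<bar> - \<bar>t' - s\<bar>\<bar>"
      using l by (simp add: abs_mult right_diff_distrib[symmetric])
    also have "\<dots> \<le> l e * \<bar>t - t'\<bar>" using l by (intro mult_left_mono) auto
    finally have "\<bar>l e * \<bar>t - s\<bar> - l e * \<bar>t' - s\<bar>\<bar> \<le> l e * \<bar>t - t'\<bar>" .
    then show ?thesis
      unfolding True fe[OF that(2)] fe[OF that(3)] by (rule order_trans[OF min_lipschitz])
  next
    case False
    then show ?thesis using fe' pos[OF that(1)] by simp
  qed
  from path_dist_ge[of "Interior e s" y f, OF _ y this] have "\<bar>f (Interior e s) - f y\<bar> \<le> path_dist G l (Interior e s) y"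
    using e s by simp
  moreover have "f (Interior e s) = 0" using \<epsilon> by (simp add: f_def)
  ultimately show ?thesis unfolding f_def by linarith
qed

lemma interior_ball:
  assumes e: "e \<in> arcs G" and s: "0 < s" "s < 1" and y: "y \<in> gpoints G" and r: "r < l e * min s (1 - s)"
  shows "path_dist G l (Interior e s) y = r \<longleftrightarrow> (\<exists>t. 0 < t \<and> t < 1 \<and> y = Interior e t \<and> l e * \<bar>t - s\<bar> = r)"
proof -
  have up: "path_dist G l (Interior e s) (Interior e t) \<le> l e * \<bar>t - s\<bar>" if "0 < t" "t < 1" for t
    using path_dist_edge_le[OF e, of s t] s that by (simp add: edge_point_interior abs_minus_commute)
  note low = path_dist_interior_ge[OF e s y]
  show ?thesis
  proof
    assume d: "path_dist G l (Interior e s) y = r"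
    then obtain t where t: "y = Interior e t"
      using low r by (cases y) (auto split: if_splits)
    then have "0 < t" "t < 1" using y by auto
    then show "\<exists>t. 0 < t \<and> t < 1 \<and> y = Interior e t \<and> l e * \<bar>t - s\<bar> = r"
      using up[of t] low d t r by (intro exI[of _ t]) (auto simp: min_def split: if_splits)
  next
    assume "\<exists>t. 0 < t \<and> t < 1 \<and> y = Interior e t \<and> l e * \<bar>t - s\<bar> = r"
    then show "path_dist G l (Interior e s) y = r"
      using up low r by (auto simp: min_def split: if_splits) (meson order.antisym)+
  qed
qed

lemma interior_sphere_card:
  assumes e: "e \<in> arcs G" and s: "0 < s" "s < 1" and r: "0 < r" "r < l e * min s (1 - s)"
  shows "card {y \<in> gpoints G. path_dist G l (Interior e s) y = r} = 2"
proof -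
  have l: "0 < l e" using pos e by simp
  have "l e * min s (1 - s) \<le> l e * s" "l e * min s (1 - s) \<le> l e * (1 - s)"
    using l by (auto intro: mult_left_mono)
  then have "r < l e * s" "r < l e * (1 - s)" using r(2) by linarith+
  then have rl: "0 < r / l e" "r / l e < s" "r / l e < 1 - s"
    using r(1) l by (auto simp: pos_divide_less_eq mult.commute)
  have "{y \<in> gpoints G. path_dist G l (Interior e s) y = r} = {Interior e (s - r / l e), Interior e (s + r / l e)}"
  proof (intro equalityI subsetI)
    fix y :: "('v, 'e) gpoint"
    assume "y \<in> {y \<in> gpoints G. path_dist G l (Interior e s) y = r}"
    then obtain t where t: "y = Interior e t" "l e * \<bar>t - s\<bar> = r"
      using interior_ball[OF e s _ r(2)] by auto
    then have "\<bar>t - s\<bar> = r / l e" using l by (simp add: field_simps)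
    then show "y \<in> {Interior e (s - r / l e), Interior e (s + r / l e)}" using t by (auto simp: abs_if split: if_splits)
  next
    fix y :: "('v, 'e) gpoint"
    assume y: "y \<in> {Interior e (s - r / l e), Interior e (s + r / l e)}"
    then obtain t where t: "y = Interior e t" "\<bar>t - s\<bar> = r / l e" "0 < t" "t < 1"
      using rl s by auto
    then have "y \<in> gpoints G" "l e * \<bar>t - s\<bar> = r" using e l by auto
    then show "y \<in> {y \<in> gpoints G. path_dist G l (Interior e s) y = r}"
      using interior_ball[OF e s _ r(2)] t by auto
  qed
  moreover have "s - r / l e \<noteq> s + r / l e" using rl(1) by linarith
  ultimately show ?thesis by (simp only: card_2_iff) (metis gpoint.inject(2))
qed

text \<open>Because \<open>2 * \<epsilon>\<close> is at most every edge length, the balls of radius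
  \<open>\<epsilon>\<close> around the two ends of an edge do not meet, even if the edge is a loop; this makes the
  cut-off distance from the vertex 1-Lipschitz along every edge.\<close>

lemma vertex_ball:
  assumes v: "v \<in> verts G" and \<epsilon>: "\<And>e. e \<in> arcs G \<Longrightarrow> 2 * \<epsilon> \<le> l e" and r: "0 < r" "r < \<epsilon>"
    and y: "y \<in> gpoints G"
  shows "path_dist G l (Vertex v) y = r \<longleftrightarrow>
    (\<exists>e\<in>arcs G. tail G e = v \<and> y = Interior e (r / l e) \<or> head G e = v \<and> y = Interior e (1 - r / l e))"
proof -
  define F where "F e s = min \<epsilon> (min (if tail G e = v then l e * s else \<epsilon>) (if head G e = v then l e * (1 - s) else \<epsilon>))"
    for e s
  define f where "f z = (case z of Vertex w \<Rightarrow> if w = v then 0 else \<epsilon> | Interior e s \<Rightarrow> F e s)"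
    for z :: "('v, 'e) gpoint"
  have f: "f (edge_point G e s) = F e s" if "e \<in> arcs G" "s \<in> {0..1}" for e s
    using \<epsilon>[OF that(1)] r pos[OF that(1)] by (auto simp: f_def F_def edge_point_def)
  have lip: "\<bar>f (edge_point G e s) - f (edge_point G e t)\<bar> \<le> l e * \<bar>s - t\<bar>"
    if "e \<in> arcs G" "s \<in> {0..1}" "t \<in> {0..1}" for e s t
  proof -
    have "\<bar>l e * s - l e * t\<bar> = l e * \<bar>s - t\<bar>" "\<bar>l e * (1 - s) - l e * (1 - t)\<bar> = l e * \<bar>s - t\<bar>"
      using pos[OF that(1)] by (auto simp: abs_mult right_diff_distrib[symmetric] abs_minus_commute)
    moreover have "0 \<le> l e * \<bar>s - t\<bar>" using pos[OF that(1)] by simp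
    ultimately show ?thesis unfolding f[OF that(1,2)] f[OF that(1,3)] F_def
      by (intro min_min_lipschitz) (simp_all split: if_split)
  qed
  have "\<bar>f (Vertex v) - f y\<bar> \<le> path_dist G l (Vertex v) y"
    using path_dist_ge[of "Vertex v" y f, OF _ y lip] v by simp
  then have low: "f y \<le> path_dist G l (Vertex v) y" by (simp add: f_def)
  have upt: "path_dist G l (Vertex v) (Interior e s) \<le> l e * s" if "e \<in> arcs G" "tail G e = v" "0 < s" "s < 1" for e s
    using path_dist_edge_le[OF that(1), of 0 s] that by (simp add: edge_point_def)
  have uph: "path_dist G l (Vertex v) (Interior e s) \<le> l e * (1 - s)" if "e \<in> arcs G" "head G e = v" "0 < s" "s < 1" for e s
    using path_dist_edge_le[OF that(1), of 1 s] that by (simp add: edge_point_def)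
  have d0: "path_dist G l (Vertex v) (Vertex v) \<le> 0"
    using path_dist_le[OF joined.start] v by simp
  show ?thesis
  proof
    assume d: "path_dist G l (Vertex v) y = r"
    show "\<exists>e\<in>arcs G. tail G e = v \<and> y = Interior e (r / l e) \<or> head G e = v \<and> y = Interior e (1 - r / l e)"
    proof (cases y)
      case (Vertex w)
      then show ?thesis using d low r d0 by (auto simp: f_def split: if_splits)
    next
      case (Interior e s)
      then have e: "e \<in> arcs G" "0 < s" "s < 1" using y by auto
      have "F e s \<le> r" using low d Interior by (simp add: f_def)
      then consider "tail G e = v" "l e * s \<le> r" | "head G e = v" "l e * (1 - s) \<le> r"
        using r unfolding F_def min_def by (auto split: if_splits)
      then show ?thesis
      proof cases
        case 1
        then have "l e * s = r" using upt[OF e(1) 1(1) e(2,3)] d Interior by simp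
        then show ?thesis using 1 e Interior pos[OF e(1)] by (intro bexI[of _ e]) auto
      next
        case 2
        then have "l e * (1 - s) = r" using uph[OF e(1) 2(1) e(2,3)] d Interior by simp
        then have "1 - s = r / l e" using pos[OF e(1)] by (simp add: field_simps)
        then have "s = 1 - r / l e" by simp
        then show ?thesis using 2 e Interior by (intro bexI[of _ e]) auto
      qed
    qed
  next
    assume "\<exists>e\<in>arcs G. tail G e = v \<and> y = Interior e (r / l e) \<or> head G e = v \<and> y = Interior e (1 - r / l e)"
    then obtain e where e: "e \<in> arcs G"
      and or: "tail G e = v \<and> y = Interior e (r / l e) \<or> head G e = v \<and> y = Interior e (1 - r / l e)" by blast
    have l: "0 < l e" "2 * r < l e" using pos[OF e] \<epsilon>[OF e] r by auto
    then have rl: "0 < r / l e" "r / l e < 1" "l e * (1 - r / l e) = l e - r" using r by (auto simp: field_simps)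
    from or show "path_dist G l (Vertex v) y = r"
    proof
      assume t: "tail G e = v \<and> y = Interior e (r / l e)"
      then have "F e (r / l e) = r" using l rl r unfolding F_def by auto
      then show ?thesis using t low upt[OF e, of "r / l e"] rl l by (auto simp: f_def)
    next
      assume h: "head G e = v \<and> y = Interior e (1 - r / l e)"
      then have "F e (1 - r / l e) = r" using l rl r unfolding F_def by auto
      then show ?thesis using h low uph[OF e, of "1 - r / l e"] rl l by (auto simp: f_def)
    qed
  qed
qed

lemma small_radius: "\<exists>\<epsilon>>0. \<forall>e\<in>arcs G. 2 * \<epsilon> \<le> l e"
proof -
  define m where "m = Min (insert 1 (l ` arcs G))"
  have "m \<in> insert 1 (l ` arcs G)" unfolding m_def using fin by (intro Min_in) auto
  then have "0 < m" using pos by auto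
  moreover have "m \<le> l e" if "e \<in> arcs G" for e unfolding m_def using fin that by simp
  ultimately show ?thesis by (intro exI[of _ "m / 2"]) auto
qed

lemma vertex_sphere_card:
  assumes v: "v \<in> verts G" and \<epsilon>: "\<And>e. e \<in> arcs G \<Longrightarrow> 2 * \<epsilon> \<le> l e" and r: "0 < r" "r < \<epsilon>"
  shows "card {y \<in> gpoints G. path_dist G l (Vertex v) y = r} = valency G v"
proof -
  let ?T = "(\<lambda>e. Interior e (r / l e)) ` {e \<in> arcs G. tail G e = v} :: ('v, 'e) gpoint set"
  let ?H = "(\<lambda>e. Interior e (1 - r / l e)) ` {e \<in> arcs G. head G e = v} :: ('v, 'e) gpoint set"
  have rl: "0 < r / l e" "r / l e < 1 / 2" if "e \<in> arcs G" for e
    using pos[OF that] \<epsilon>[OF that] r by (auto simp: field_simps)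
  then have rl1: "r / l e < 1" if "e \<in> arcs G" for e using rl(2)[OF that] by linarith
  have "{y \<in> gpoints G. path_dist G l (Vertex v) y = r} = ?T \<union> ?H"
  proof (intro equalityI subsetI)
    fix y assume "y \<in> {y \<in> gpoints G. path_dist G l (Vertex v) y = r}"
    then show "y \<in> ?T \<union> ?H" using vertex_ball[OF v \<epsilon> r] by auto
  next
    fix y assume y: "y \<in> ?T \<union> ?H"
    then have "y \<in> gpoints G" using rl rl1 by auto
    then show "y \<in> {y \<in> gpoints G. path_dist G l (Vertex v) y = r}"
      using vertex_ball[OF v \<epsilon> r] y by auto
  qed
  moreover have "?T \<inter> ?H = {}" using rl by fastforce
  ultimately show ?thesis
    using fin unfolding valency_def by (simp add: card_Un_disjoint card_image inj_on_def)
qed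

end

fun graph_map :: "('v \<Rightarrow> 'w) \<Rightarrow> ('e \<Rightarrow> 'f) \<Rightarrow> ('e \<Rightarrow> bool) \<Rightarrow> ('v, 'e) gpoint \<Rightarrow> ('w, 'f) gpoint" where
  "graph_map fv fe fl (Vertex v) = Vertex (fv v)"
| "graph_map fv fe fl (Interior e s) = Interior (fe e) (if fl e then 1 - s else s)"

definition graph_iso ::
  "('v, 'e) pre_digraph \<Rightarrow> ('w, 'f) pre_digraph \<Rightarrow> ('v \<Rightarrow> 'w) \<Rightarrow> ('e \<Rightarrow> 'f) \<Rightarrow> ('e \<Rightarrow> bool) \<Rightarrow> bool" where
  "graph_iso G G' fv fe fl \<longleftrightarrow> bij_betw fv (verts G) (verts G') \<and> bij_betw fe (arcs G) (arcs G')
     \<and> (\<forall>e\<in>arcs G. tail G' (fe e) = fv (if fl e then head G e else tail G e)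
          \<and> head G' (fe e) = fv (if fl e then tail G e else head G e))"

lemma graph_map_edge_point:
  assumes "graph_iso G G' fv fe fl" "e \<in> arcs G"
  shows "graph_map fv fe fl (edge_point G e s) = edge_point G' (fe e) (if fl e then 1 - s else s)"
  using assms unfolding graph_iso_def by (auto simp: edge_point_def)

lemma graph_map_bij:
  assumes "graph_iso G G' fv fe fl"
  shows "bij_betw (graph_map fv fe fl) (gpoints G) (gpoints G')"
  unfolding bij_betw_def
proof
  have fv: "inj_on fv (verts G)" "fv ` verts G = verts G'" and fe: "inj_on fe (arcs G)" "fe ` arcs G = arcs G'"
    using assms unfolding graph_iso_def bij_betw_def by auto
  show "inj_on (graph_map fv fe fl) (gpoints G)"
  proof (rule inj_onI)
    fix x y
    assume xy: "x \<in> gpoints G" "y \<in> gpoints G" "graph_map fv fe fl x = graph_map fv fe fl y"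
    show "x = y"
    proof (cases x)
      case (Vertex v)
      then obtain w where "y = Vertex w" using xy(3) by (cases y) auto
      then show ?thesis using Vertex xy inj_onD[OF fv(1), of v w] by (auto simp: gpoints_def)
    next
      case (Interior e s)
      then obtain e' s' where y: "y = Interior e' s'" using xy(3) by (cases y) auto
      then have "e = e'" using Interior xy inj_onD[OF fe(1), of e e'] by (auto simp: gpoints_def)
      then show ?thesis using Interior xy y by (auto split: if_splits)
    qed
  qed
  show "graph_map fv fe fl ` gpoints G = gpoints G'"
  proof (intro equalityI subsetI)
    fix y assume "y \<in> gpoints G'"
    then consider w where "w \<in> verts G'" "y = Vertex w"
      | f s where "f \<in> arcs G'" "0 < s" "s < 1" "y = Interior f s" by (auto simp: gpoints_def)
    then show "y \<in> graph_map fv fe fl ` gpoints G"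
    proof cases
      case 1
      then obtain v where "v \<in> verts G" "w = fv v" using fv(2) by blast
      then show ?thesis using 1 by (intro image_eqI[of _ _ "Vertex v"]) (auto simp: gpoints_def)
    next
      case 2
      then obtain e where "e \<in> arcs G" "f = fe e" using fe(2) by blast
      then show ?thesis using 2
        by (intro image_eqI[of _ _ "Interior e (if fl e then 1 - s else s)"]) (auto simp: gpoints_def)
    qed
  next
    fix y assume "y \<in> graph_map fv fe fl ` gpoints G"
    then show "y \<in> gpoints G'"
      using imageI[of _ "verts G" fv] imageI[of _ "arcs G" fe] unfolding fv(2) fe(2)
      by (auto simp: gpoints_def)
  qed
qed

lemma graph_iso_inverse:
  assumes iso: "graph_iso G G' fv fe fl"
    and wf: "\<And>e. e \<in> arcs G \<Longrightarrow> tail G e \<in> verts G \<and> head G e \<in> verts G"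
  shows "\<exists>gv ge gl. graph_iso G' G gv ge gl \<and> (\<forall>e\<in>arcs G. ge (fe e) = e)
    \<and> (\<forall>x\<in>gpoints G. graph_map gv ge gl (graph_map fv fe fl x) = x)"
proof -
  define gv where "gv = inv_into (verts G) fv"
  define ge where "ge = inv_into (arcs G) fe"
  have fv: "bij_betw fv (verts G) (verts G')" and fe: "bij_betw fe (arcs G) (arcs G')"
    using iso unfolding graph_iso_def by auto
  have gv: "gv (fv v) = v" if "v \<in> verts G" for v
    using fv that unfolding gv_def bij_betw_def by simp
  have ge: "ge (fe e) = e" if "e \<in> arcs G" for e
    using fe that unfolding ge_def bij_betw_def by simp
  have "graph_iso G' G gv ge (fl \<circ> ge)"
    unfolding graph_iso_def
  proof (intro conjI ballI)
    show "bij_betw gv (verts G') (verts G)" "bij_betw ge (arcs G') (arcs G)"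
      unfolding gv_def ge_def using fv fe by (auto intro: bij_betw_inv_into)
    fix f assume "f \<in> arcs G'"
    then obtain e where e: "e \<in> arcs G" "f = fe e" using fe unfolding bij_betw_def by blast
    then show "tail G (ge f) = gv (if (fl \<circ> ge) f then head G' f else tail G' f)"
      "head G (ge f) = gv (if (fl \<circ> ge) f then tail G' f else head G' f)"
      using iso ge gv wf unfolding graph_iso_def by auto
  qed
  moreover have "\<forall>x\<in>gpoints G. graph_map gv ge (fl \<circ> ge) (graph_map fv fe fl x) = x"
    using gv ge by (auto simp: gpoints_def)
  ultimately show ?thesis using ge by blast
qed

lemma joined_graph_map:
  assumes iso: "graph_iso G G' fv fe fl" and len: "\<And>e. e \<in> arcs G \<Longrightarrow> l' (fe e) = l e"
    and "joined G l x r y"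
  shows "joined G' l' (graph_map fv fe fl x) r (graph_map fv fe fl y)"
  using assms(3)
proof (induction rule: joined.induct)
  case start
  then show ?case using graph_map_bij[OF iso] by (auto simp: bij_betw_def intro: joined.start)
next
  case (move r e s t)
  have "joined G' l' (graph_map fv fe fl x)
      (r + l' (fe e) * \<bar>(if fl e then 1 - s else s) - (if fl e then 1 - t else t)\<bar>)
      (edge_point G' (fe e) (if fl e then 1 - t else t))"
  proof (rule joined.move)
    show "joined G' l' (graph_map fv fe fl x) r (edge_point G' (fe e) (if fl e then 1 - s else s))"
      using move.IH graph_map_edge_point[OF iso move.hyps(2)] by simp
    show "fe e \<in> arcs G'" using iso move.hyps(2) unfolding graph_iso_def bij_betw_def by auto
  qed (use move.hyps in auto)
  moreover have "l' (fe e) * \<bar>(if fl e then 1 - s else s) - (if fl e then 1 - t else t)\<bar> = l e * \<bar>s - t\<bar>"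
    using len[OF move.hyps(2)] by (simp add: abs_minus_commute)
  ultimately show ?case using graph_map_edge_point[OF iso move.hyps(2)] by simp
qed

lemma path_dist_graph_map:
  assumes iso: "graph_iso G G' fv fe fl" and len: "\<And>e. e \<in> arcs G \<Longrightarrow> l' (fe e) = l e"
    and wf: "\<And>e. e \<in> arcs G \<Longrightarrow> tail G e \<in> verts G \<and> head G e \<in> verts G"
    and x: "x \<in> gpoints G" and y: "y \<in> gpoints G"
  shows "path_dist G' l' (graph_map fv fe fl x) (graph_map fv fe fl y) = path_dist G l x y"
proof -
  obtain gv ge gl where g: "graph_iso G' G gv ge gl" "\<forall>e\<in>arcs G. ge (fe e) = e"
    "\<forall>x\<in>gpoints G. graph_map gv ge gl (graph_map fv fe fl x) = x"
    using graph_iso_inverse[OF iso wf] by blast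
  have len': "l (ge f) = l' f" if "f \<in> arcs G'" for f
  proof -
    obtain e where e: "e \<in> arcs G" "f = fe e"
      using \<open>f \<in> arcs G'\<close> iso unfolding graph_iso_def bij_betw_def by blast
    then show ?thesis using len[OF e(1)] g(2) by simp
  qed
  have "joined G' l' (graph_map fv fe fl x) r (graph_map fv fe fl y) \<longleftrightarrow> joined G l x r y" for r
  proof
    assume j: "joined G' l' (graph_map fv fe fl x) r (graph_map fv fe fl y)"
    have "joined G l (graph_map gv ge gl (graph_map fv fe fl x)) r (graph_map gv ge gl (graph_map fv fe fl y))"
      by (rule joined_graph_map[where l=l', OF g(1) _ j]) (rule len')
    then show "joined G l x r y" by (simp only: g(3)[rule_format, OF x] g(3)[rule_format, OF y])
  next
    assume "joined G l x r y"
    then show "joined G' l' (graph_map fv fe fl x) r (graph_map fv fe fl y)"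
      by (rule joined_graph_map[where l'=l', OF iso, rotated]) (rule len)
  qed
  then show ?thesis by (simp only: path_dist_def)
qed

lemma graph_iso_isometric:
  assumes iso: "graph_iso G G' fv fe fl" and len: "\<And>e. e \<in> arcs G \<Longrightarrow> l' (fe e) = l e"
    and wf: "\<And>e. e \<in> arcs G \<Longrightarrow> tail G e \<in> verts G \<and> head G e \<in> verts G"
    and p: "\<And>i. i \<in> {1..n} \<Longrightarrow> graph_map fv fe fl (p i) = p' i"
  shows "isometric n (G, l, p) (G', l', p')"
  unfolding isometric_def prod.case
  using graph_map_bij[OF iso] path_dist_graph_map[OF iso, of l' l] len wf p
  by (intro exI[of _ "graph_map fv fe fl"]) auto

lemma isometric_refl: "isometric n M M"
  unfolding isometric_def by (auto split: prod.split intro!: exI[of _ "\<lambda>x. x"] simp: bij_betw_def)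

lemma isometric_trans:
  assumes "isometric n M M'" "isometric n M' M''"
  shows "isometric n M M''"
proof -
  obtain G l p where M: "M = (G, l, p)" by (cases M)
  obtain G' l' p' where M': "M' = (G', l', p')" by (cases M')
  obtain G'' l'' p'' where M'': "M'' = (G'', l'', p'')" by (cases M'')
  obtain f where f: "bij_betw f (gpoints G) (gpoints G')"
    "\<forall>x\<in>gpoints G. \<forall>y\<in>gpoints G. path_dist G' l' (f x) (f y) = path_dist G l x y"
    "\<forall>i\<in>{1..n}. f (p i) = p' i" using assms(1) unfolding M M' isometric_def by auto
  obtain g where g: "bij_betw g (gpoints G') (gpoints G'')"
    "\<forall>x\<in>gpoints G'. \<forall>y\<in>gpoints G'. path_dist G'' l'' (g x) (g y) = path_dist G' l' x y"
    "\<forall>i\<in>{1..n}. g (p' i) = p'' i" using assms(2) unfolding M'' M' isometric_def by auto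
  show ?thesis
    unfolding M M'' isometric_def prod.case
    using f g bij_betw_trans[OF f(1) g(1)] bij_betwE[OF f(1)]
    by (intro exI[of _ "g \<circ> f"]) auto
qed

lemma isometric_sym:
  assumes "isometric n (G, l, p) (G', l', p')" and p: "\<And>i. i \<in> {1..n} \<Longrightarrow> p i \<in> gpoints G"
  shows "isometric n (G', l', p') (G, l, p)"
proof -
  obtain f where f: "bij_betw f (gpoints G) (gpoints G')"
    "\<forall>x\<in>gpoints G. \<forall>y\<in>gpoints G. path_dist G' l' (f x) (f y) = path_dist G l x y"
    "\<forall>i\<in>{1..n}. f (p i) = p' i" using assms(1) unfolding isometric_def by auto
  define g where "g = inv_into (gpoints G) f"
  have g: "bij_betw g (gpoints G') (gpoints G)" "\<And>y. y \<in> gpoints G' \<Longrightarrow> f (g y) = y \<and> g y \<in> gpoints G"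
    "\<And>x. x \<in> gpoints G \<Longrightarrow> g (f x) = x"
    unfolding g_def using bij_betw_inv_into[OF f(1)] bij_betw_inv_into_right[OF f(1)]
      bij_betw_inv_into_left[OF f(1)] bij_betwE[OF bij_betw_inv_into[OF f(1)]] by simp_all
  have "path_dist G l (g x) (g y) = path_dist G' l' x y" if "x \<in> gpoints G'" "y \<in> gpoints G'" for x y
    using f(2) g(2)[OF that(1)] g(2)[OF that(2)] by (metis (full_types))
  moreover have "g (p' i) = p i" if "i \<in> {1..n}" for i
    using f(3) g(3)[OF p[OF that]] that by (metis (full_types))
  ultimately show ?thesis
    unfolding isometric_def prod.case using g(1) by (intro exI[of _ g]) blast
qed

lemma mult_abs_half_less: "0 < c \<Longrightarrow> 0 < s \<Longrightarrow> s < 1 \<Longrightarrow> c * \<bar>s - 1/2\<bar> < c / 2" for c s :: real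
proof -
  assume c: "0 < c" and "0 < s" "s < 1"
  then have "\<bar>s - 1/2\<bar> < 1/2" by linarith
  from mult_strict_left_mono[OF this c] show ?thesis by simp
qed

text \<open>The isometries in the definition of the space are bijections of points. Valencies of at
  least three make the vertices visible to the metric.\<close>

locale metric_graph_isometry = M: metric_graph G l + M': metric_graph G' l'
  for G :: "('v, 'e) pre_digraph" and l :: "'e \<Rightarrow> real"
    and G' :: "('w, 'f) pre_digraph" and l' :: "'f \<Rightarrow> real" +
  fixes \<phi> :: "('v, 'e) gpoint \<Rightarrow> ('w, 'f) gpoint"
  assumes bij: "bij_betw \<phi> (gpoints G) (gpoints G')"
    and dist: "x \<in> gpoints G \<Longrightarrow> y \<in> gpoints G \<Longrightarrow> path_dist G' l' (\<phi> x) (\<phi> y) = path_dist G l x y"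
    and val: "v \<in> verts G \<Longrightarrow> 3 \<le> valency G v" and val': "w \<in> verts G' \<Longrightarrow> 3 \<le> valency G' w"
begin

lemma \<phi>_gpoints: "x \<in> gpoints G \<Longrightarrow> \<phi> x \<in> gpoints G'"
  using bij bij_betwE by blast

lemma inverse: "metric_graph_isometry G' l' G l (inv_into (gpoints G) \<phi>)"
proof unfold_locales
  show "bij_betw (inv_into (gpoints G) \<phi>) (gpoints G') (gpoints G)"
    using bij by (rule bij_betw_inv_into)
  fix x y assume "x \<in> gpoints G'" "y \<in> gpoints G'"
  then show "path_dist G l (inv_into (gpoints G) \<phi> x) (inv_into (gpoints G) \<phi> y) = path_dist G' l' x y"
    using bij dist[of "inv_into (gpoints G) \<phi> x" "inv_into (gpoints G) \<phi> y"]
    by (auto simp: bij_betw_def f_inv_into_f inv_into_into)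
qed (use val val' in auto)

lemma sphere_card:
  assumes "x \<in> gpoints G"
  shows "card {y \<in> gpoints G. path_dist G l x y = r} = card {y \<in> gpoints G'. path_dist G' l' (\<phi> x) y = r}"
proof (rule bij_betw_same_card[of \<phi>])
  show "bij_betw \<phi> {y \<in> gpoints G. path_dist G l x y = r} {y \<in> gpoints G'. path_dist G' l' (\<phi> x) y = r}"
    unfolding bij_betw_def
  proof
    show "inj_on \<phi> {y \<in> gpoints G. path_dist G l x y = r}"
      using bij unfolding bij_betw_def by (rule conjE) (auto intro: inj_on_subset)
    show "\<phi> ` {y \<in> gpoints G. path_dist G l x y = r} = {y \<in> gpoints G'. path_dist G' l' (\<phi> x) y = r}"
    proof (intro equalityI subsetI)
      fix z assume z: "z \<in> {y \<in> gpoints G'. path_dist G' l' (\<phi> x) y = r}"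
      then obtain y where "y \<in> gpoints G" "z = \<phi> y" using bij unfolding bij_betw_def by blast
      then show "z \<in> \<phi> ` {y \<in> gpoints G. path_dist G l x y = r}" using dist[OF assms] z by auto
    qed (use dist[OF assms] bij_betwE[OF bij] in auto)
  qed
qed

text \<open>A small sphere has as many points as the valency around a vertex, and two points around an
  interior point of an edge.\<close>

lemma vertex_image: assumes v: "v \<in> verts G" shows "\<exists>w. \<phi> (Vertex v) = Vertex w"
proof (rule ccontr)
  assume "\<nexists>w. \<phi> (Vertex v) = Vertex w"
  then obtain e s where e: "\<phi> (Vertex v) = Interior e s" by (cases "\<phi> (Vertex v)") auto
  then have es: "e \<in> arcs G'" "0 < s" "s < 1" using \<phi>_gpoints[of "Vertex v"] v by auto
  obtain \<epsilon> where \<epsilon>: "0 < \<epsilon>" "\<And>e. e \<in> arcs G \<Longrightarrow> 2 * \<epsilon> \<le> l e" using M.small_radius by blast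
  have "0 < l' e * min s (1 - s)" using M'.pos es by simp
  then obtain r where r: "0 < r" "r < \<epsilon>" "r < l' e * min s (1 - s)"
    using \<epsilon>(1) by (metis dense min_less_iff_conj)
  have "valency G v = 2"
    using sphere_card[of "Vertex v" r] M.vertex_sphere_card[OF v \<epsilon>(2) r(1,2)]
      M'.interior_sphere_card[OF es r(1,3)] v e by simp
  then show False using val[OF v] by simp
qed

lemma interior_image:
  assumes e: "e \<in> arcs G" and s: "0 < s" "s < 1"
  shows "\<exists>f t. \<phi> (Interior e s) = Interior f t"
proof (rule ccontr)
  assume "\<nexists>f t. \<phi> (Interior e s) = Interior f t"
  then obtain w where w: "\<phi> (Interior e s) = Vertex w" by (cases "\<phi> (Interior e s)") auto
  then have wv: "w \<in> verts G'" using \<phi>_gpoints[of "Interior e s"] e s by auto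
  obtain \<epsilon> where \<epsilon>: "0 < \<epsilon>" "\<And>e. e \<in> arcs G' \<Longrightarrow> 2 * \<epsilon> \<le> l' e" using M'.small_radius by blast
  have "0 < l e * min s (1 - s)" using M.pos e s by simp
  then obtain r where r: "0 < r" "r < \<epsilon>" "r < l e * min s (1 - s)"
    using \<epsilon>(1) by (metis dense min_less_iff_conj)
  have "valency G' w = 2"
    using sphere_card[of "Interior e s" r] M'.vertex_sphere_card[OF wv \<epsilon>(2) r(1,2)]
      M.interior_sphere_card[OF e s r(1,3)] e s w by simp
  then show False using val'[OF wv] by simp
qed

text \<open>The open ball of radius \<open>l e / 2\<close> about the midpoint of \<open>e\<close> is the open edge \<open>e\<close>. Its image
  contains no vertex, so it lies in one edge, which is at least as long.\<close>

lemma edge_image: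
  assumes e: "e \<in> arcs G"
  shows "\<exists>f\<in>arcs G'. l e \<le> l' f
    \<and> (\<exists>t. \<phi> (Interior e (1/2)) = Interior f t \<and> l e / 2 \<le> l' f * min t (1 - t))
    \<and> (\<forall>s. 0 < s \<and> s < 1 \<longrightarrow> (\<exists>t. 0 < t \<and> t < 1 \<and> \<phi> (Interior e s) = Interior f t))"
proof -
  obtain f t where ft: "\<phi> (Interior e (1/2)) = Interior f t" using interior_image[OF e, of "1/2"] by auto
  then have f: "f \<in> arcs G'" "0 < t" "t < 1" using \<phi>_gpoints[of "Interior e (1/2)"] e by auto
  have l: "0 < l e" and l': "0 < l' f" using M.pos M'.pos e f by auto
  have far: "l e / 2 \<le> path_dist G' l' (Interior f t) (Vertex w)" if w: "w \<in> verts G'" for w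
  proof -
    obtain x where x: "x \<in> gpoints G" "\<phi> x = Vertex w"
      using w bij unfolding bij_betw_def by (metis M'.Vertex_gpoints imageE)
    then obtain v where v: "x = Vertex v" using interior_image by (cases x) force+
    have "l e / 2 \<le> path_dist G l (Interior e (1/2)) (Vertex v)"
      using M.path_dist_interior_ge[OF e, of "1/2" "Vertex v"] x v by simp
    then show ?thesis using dist[of "Interior e (1/2)" x] x v ft e by simp
  qed
  have "path_dist G' l' (Interior f t) (Vertex (tail G' f)) \<le> l' f * t"
    using M'.path_dist_edge_le[OF f(1), of t 0] f by (simp add: edge_point_def)
  moreover have "path_dist G' l' (Interior f t) (Vertex (head G' f)) \<le> l' f * (1 - t)"
    using M'.path_dist_edge_le[OF f(1), of t 1] f by (simp add: edge_point_def)
  ultimately have t: "l e / 2 \<le> l' f * t" "l e / 2 \<le> l' f * (1 - t)"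
    using far[of "tail G' f"] far[of "head G' f"] M'.wf f(1) by auto
  then have half: "l e / 2 \<le> l' f * min t (1 - t)" by (simp add: min_def)
  moreover have "l' f * min t (1 - t) \<le> l' f * (1/2)"
    by (rule mult_left_mono) (use l' in \<open>auto simp: min_def\<close>)
  ultimately have "l e \<le> l' f" by linarith
  moreover have "\<exists>t. 0 < t \<and> t < 1 \<and> \<phi> (Interior e s) = Interior f t" if s: "0 < s" "s < 1" for s
  proof -
    have sl: "l e * \<bar>s - 1/2\<bar> < l e / 2" using l s by (intro mult_abs_half_less)
    then have "path_dist G l (Interior e (1/2)) (Interior e s) = l e * \<bar>s - 1/2\<bar>"
      using M.interior_ball[OF e, of "1/2" "Interior e s" "l e * \<bar>s - 1/2\<bar>"] e s by auto
    then have "path_dist G' l' (Interior f t) (\<phi> (Interior e s)) = l e * \<bar>s - 1/2\<bar>"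
      using dist[of "Interior e (1/2)" "Interior e s"] ft e s by simp
    then show ?thesis
      using M'.interior_ball[OF f(1-3) \<phi>_gpoints[of "Interior e s"], of "l e * \<bar>s - 1/2\<bar>"] e s sl
        half by auto
  qed
  ultimately show ?thesis using f(1) ft half by blast
qed

text \<open>The inverse isometry maps the image edge back into \<open>e\<close>, so the lengths agree. The distance
  from the midpoint then determines an interior point up to reflection.\<close>

lemma edge_correspondence:
  assumes e: "e \<in> arcs G"
  shows "\<exists>f\<in>arcs G'. l' f = l e \<and> \<phi> (Interior e (1/2)) = Interior f (1/2)
    \<and> (\<forall>s. 0 < s \<and> s < 1 \<longrightarrow> \<phi> (Interior e s) \<in> {Interior f s, Interior f (1 - s)})"
proof -
  interpret I: metric_graph_isometry G' l' G l "inv_into (gpoints G) \<phi>" by (rule inverse)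
  have inv: "inv_into (gpoints G) \<phi> (\<phi> x) = x" if "x \<in> gpoints G" for x
    using bij that unfolding bij_betw_def by simp
  obtain f t where f: "f \<in> arcs G'" "l e \<le> l' f"
    "\<And>s. 0 < s \<Longrightarrow> s < 1 \<Longrightarrow> \<exists>t. 0 < t \<and> t < 1 \<and> \<phi> (Interior e s) = Interior f t"
    and t3: "\<phi> (Interior e (1/2)) = Interior f t" "l e / 2 \<le> l' f * min t (1 - t)"
    using edge_image[OF e] by blast
  obtain e' where e': "e' \<in> arcs G" "l' f \<le> l e'"
    "\<And>s. 0 < s \<Longrightarrow> s < 1 \<Longrightarrow> \<exists>t. 0 < t \<and> t < 1 \<and> inv_into (gpoints G) \<phi> (Interior f s) = Interior e' t"
    using I.edge_image[OF f(1)] by blast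
  have t: "0 < t" "t < 1" "\<phi> (Interior e (1/2)) = Interior f t" using f(3)[of "1/2"] t3 by auto
  have "e' = e" using e'(3)[OF t(1,2)] inv[of "Interior e (1/2)"] t(3) e by auto
  then have l: "l' f = l e" using f(2) e'(2) by simp
  have pos: "0 < l e" using M.pos e by simp
  have half: "\<phi> (Interior e (1/2)) = Interior f (1/2)"
  proof -
    have "l e * (1/2) \<le> l e * min t (1 - t)" using t3(2) l by simp
    then have "1/2 \<le> min t (1 - t)" using pos by (simp only: mult_le_cancel_left_pos)
    then have "t = 1/2" by (simp add: min_def split: if_splits)
    then show ?thesis using t3 by simp
  qed
  show ?thesis
  proof (intro bexI[of _ f] conjI allI impI l half f(1))
    fix s :: real assume "0 < s \<and> s < 1"
    then have s: "0 < s" "s < 1" by auto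
    have sl: "l e * \<bar>s - 1/2\<bar> < l e / 2" using pos s by (intro mult_abs_half_less)
    have "path_dist G l (Interior e (1/2)) (Interior e s) = l e * \<bar>s - 1/2\<bar>"
      using M.interior_ball[OF e, of "1/2" "Interior e s" "l e * \<bar>s - 1/2\<bar>"] e s sl by auto
    then have "path_dist G' l' (Interior f (1/2)) (\<phi> (Interior e s)) = l e * \<bar>s - 1/2\<bar>"
      using dist[of "Interior e (1/2)" "Interior e s"] half e s by simp
    then obtain u where u: "\<phi> (Interior e s) = Interior f u" "l' f * \<bar>u - 1/2\<bar> = l e * \<bar>s - 1/2\<bar>"
      using M'.interior_ball[OF f(1), of "1/2" "\<phi> (Interior e s)" "l e * \<bar>s - 1/2\<bar>"]
        \<phi>_gpoints[of "Interior e s"] e s sl l by auto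
    then have "\<bar>u - 1/2\<bar> = \<bar>s - 1/2\<bar>" using l pos by simp
    then have "u = s \<or> u = 1 - s" by (auto simp: abs_if split: if_splits)
    then show "\<phi> (Interior e s) \<in> {Interior f s, Interior f (1 - s)}" using u by auto
  qed
qed

text \<open>Reflections at different points of an edge agree: on the first half the distance from the point at
  1/4 distinguishes \<open>s\<close> from \<open>1 - s\<close>, and injectivity settles the second half. Incidences
  are read off from small spheres around the vertices.\<close>

theorem induced_by_graph_iso:
  "\<exists>fv fe fl. graph_iso G G' fv fe fl \<and> (\<forall>e\<in>arcs G. l' (fe e) = l e)
    \<and> (\<forall>x\<in>gpoints G. \<phi> x = graph_map fv fe fl x)"
proof -
  interpret I: metric_graph_isometry G' l' G l "inv_into (gpoints G) \<phi>" by (rule inverse)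
  have inv: "inv_into (gpoints G) \<phi> (\<phi> x) = x" if "x \<in> gpoints G" for x
    using bij that unfolding bij_betw_def by simp
  have inv': "\<phi> (inv_into (gpoints G) \<phi> y) = y" if "y \<in> gpoints G'" for y
    using bij that by (simp add: bij_betw_inv_into_right)
  obtain fv where fv: "\<And>v. v \<in> verts G \<Longrightarrow> \<phi> (Vertex v) = Vertex (fv v)"
    using vertex_image by metis
  obtain fe where fe: "\<And>e. e \<in> arcs G \<Longrightarrow> fe e \<in> arcs G'" "\<And>e. e \<in> arcs G \<Longrightarrow> l' (fe e) = l e"
    "\<And>e. e \<in> arcs G \<Longrightarrow> \<phi> (Interior e (1/2)) = Interior (fe e) (1/2)"
    "\<And>e s. e \<in> arcs G \<Longrightarrow> 0 < s \<and> s < 1 \<Longrightarrow> \<phi> (Interior e s) \<in> {Interior (fe e) s, Interior (fe e) (1 - s)}"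
    using edge_correspondence by metis
  define fl where "fl e \<longleftrightarrow> \<phi> (Interior e (1/4)) = Interior (fe e) (3/4)" for e
  have inj: "x = y" if "\<phi> x = \<phi> y" "x \<in> gpoints G" "y \<in> gpoints G" for x y
    using bij that unfolding bij_betw_def by (meson inj_onD)
  have map: "\<phi> (Interior e s) = Interior (fe e) (if fl e then 1 - s else s)"
    if e: "e \<in> arcs G" and s: "0 < s" "s < 1" for e s
  proof -
    define q where "q = (if fl e then 3/4 else 1/4 :: real)"
    have q: "\<phi> (Interior e (1/4)) = Interior (fe e) q" "0 < q" "q < 1" "min q (1 - q) = 1/4"
    proof -
      have "(1/4 :: real) \<noteq> 3/4" "0 < (1/4::real) \<and> (1/4::real) < 1" by simp_all
      with fe(4)[OF e, of "1/4"] have "\<phi> (Interior e (1/4)) = Interior (fe e) (if fl e then 3/4 else 1/4)"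
        by (cases "fl e") (simp_all add: fl_def)
      then show "\<phi> (Interior e (1/4)) = Interior (fe e) q" by (simp only: q_def)
      show "0 < q" "q < 1" "min q (1 - q) = 1/4" by (simp_all add: q_def)
    qed
    have low: "\<phi> (Interior e s) = Interior (fe e) (if fl e then 1 - s else s)" if s: "0 < s" "s < 1/2" for s
    proof -
      have l: "0 < l e" using M.pos e .
      have "\<bar>s - 1/4\<bar> < 1/4" using s by linarith
      then have sl: "l e * \<bar>s - 1/4\<bar> < l e * (1/4)" using l by (rule mult_strict_left_mono)
      have "path_dist G l (Interior e (1/4)) (Interior e s) = l e * \<bar>s - 1/4\<bar>"
        using M.interior_ball[OF e, of "1/4" "Interior e s" "l e * \<bar>s - 1/4\<bar>"] e s sl by auto
      then have "path_dist G' l' (Interior (fe e) q) (\<phi> (Interior e s)) = l e * \<bar>s - 1/4\<bar>"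
        using dist[of "Interior e (1/4)" "Interior e s"] q e s by simp
      then obtain u where u: "\<phi> (Interior e s) = Interior (fe e) u" "l' (fe e) * \<bar>u - q\<bar> = l e * \<bar>s - 1/4\<bar>"
        using M'.interior_ball[OF fe(1)[OF e] q(2,3), of "\<phi> (Interior e s)" "l e * \<bar>s - 1/4\<bar>"]
          \<phi>_gpoints[of "Interior e s"] e s sl q(4) fe(2)[OF e] by auto
      then have "\<bar>u - q\<bar> = \<bar>s - 1/4\<bar>" using fe(2)[OF e] l by simp
      moreover have "u = s \<or> u = 1 - s" using fe(4)[OF e, of s] s u(1) by auto
      ultimately have "u = (if fl e then 1 - s else s)"
      proof (cases "fl e")
        case True
        then have "\<bar>u - 3/4\<bar> = \<bar>s - 1/4\<bar>" using \<open>\<bar>u - q\<bar> = \<bar>s - 1/4\<bar>\<close> by (simp only: q_def if_True)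
        moreover have "u \<noteq> s" using calculation s by linarith
        ultimately show ?thesis using True \<open>u = s \<or> u = 1 - s\<close> by simp
      next
        case False
        then have "\<bar>u - 1/4\<bar> = \<bar>s - 1/4\<bar>" using \<open>\<bar>u - q\<bar> = \<bar>s - 1/4\<bar>\<close> by (simp only: q_def if_False)
        moreover have "u \<noteq> 1 - s" using calculation s by linarith
        ultimately show ?thesis using False \<open>u = s \<or> u = 1 - s\<close> by simp
      qed
      then show ?thesis using u(1) by simp
    qed
    consider "s < 1/2" | "s = 1/2" | "s > 1/2" by linarith
    then show ?thesis
    proof cases
      case 2
      have "(if fl e then 1 - s else s) = 1/2" using 2 by simp
      then show ?thesis using 2 fe(3)[OF e] by (simp only:)
    next
      case 3
      have "\<phi> (Interior e (1 - s)) = Interior (fe e) (if fl e then s else 1 - s)"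
        using low[of "1 - s"] 3 s by simp
      moreover have "Interior e s \<noteq> Interior e (1 - s)" using 3 by simp
      ultimately have "\<phi> (Interior e s) \<noteq> Interior (fe e) (if fl e then s else 1 - s)"
        using inj[of "Interior e s" "Interior e (1 - s)"] e s by auto
      then show ?thesis using fe(4)[OF e, of s] s by (auto split: if_splits)
    qed (use low s in auto)
  qed
  have all: "\<phi> x = graph_map fv fe fl x" if "x \<in> gpoints G" for x
    using that fv map by (cases x) auto
  have bv: "bij_betw fv (verts G) (verts G')"
    unfolding bij_betw_def
  proof
    show "inj_on fv (verts G)" using inj fv by (intro inj_onI) (metis M.Vertex_gpoints gpoint.inject(1))
    show "fv ` verts G = verts G'"
    proof (intro equalityI subsetI)
      fix w assume "w \<in> fv ` verts G"
      then obtain v where "v \<in> verts G" "w = fv v" by blast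
      then show "w \<in> verts G'" using \<phi>_gpoints[of "Vertex v"] fv by simp
    next
      fix w assume w: "w \<in> verts G'"
      obtain v where v: "inv_into (gpoints G) \<phi> (Vertex w) = Vertex v" using I.vertex_image[OF w] by blast
      then have "\<phi> (Vertex v) = Vertex w" "v \<in> verts G"
        using inv'[of "Vertex w"] I.\<phi>_gpoints[of "Vertex w"] w by auto
      then show "w \<in> fv ` verts G" using fv[of v] by auto
    qed
  qed
  have be: "bij_betw fe (arcs G) (arcs G')"
    unfolding bij_betw_def
  proof
    show "inj_on fe (arcs G)"
    proof (rule inj_onI)
      fix d e assume "d \<in> arcs G" "e \<in> arcs G" "fe d = fe e"
      then show "d = e" using inj[of "Interior d (1/2)" "Interior e (1/2)"] fe(3) by auto
    qed
    show "fe ` arcs G = arcs G'"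
    proof (intro equalityI subsetI)
      fix f assume f: "f \<in> arcs G'"
      obtain e where e: "e \<in> arcs G" "inv_into (gpoints G) \<phi> (Interior f (1/2)) = Interior e (1/2)"
        using I.edge_correspondence[OF f] by blast
      then have "\<phi> (Interior e (1/2)) = Interior f (1/2)" using inv'[of "Interior f (1/2)"] f by simp
      then show "f \<in> fe ` arcs G" using fe(3)[OF e(1)] e by auto
    qed (use fe in auto)
  qed
  obtain \<epsilon> where \<epsilon>: "0 < \<epsilon>" "\<And>e. e \<in> arcs G \<Longrightarrow> 2 * \<epsilon> \<le> l e" using M.small_radius by blast
  obtain \<epsilon>' where \<epsilon>': "0 < \<epsilon>'" "\<And>e. e \<in> arcs G' \<Longrightarrow> 2 * \<epsilon>' \<le> l' e" using M'.small_radius by blast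
  obtain r where r: "0 < r" "r < \<epsilon>" "r < \<epsilon>'" using \<epsilon>(1) \<epsilon>'(1) by (metis dense min_less_iff_conj)
  have ends: "tail G' (fe e) = fv (if fl e then head G e else tail G e)
      \<and> head G' (fe e) = fv (if fl e then tail G e else head G e)" if e: "e \<in> arcs G" for e
  proof -
    have re: "0 < r / l e" "r / l e < 1/2" using r \<epsilon>(2)[OF e] M.pos[OF e] by (auto simp: field_simps)
    have wf: "tail G e \<in> verts G" "head G e \<in> verts G" using M.wf e by auto
    have tv: "fv (tail G e) \<in> verts G'" "fv (head G e) \<in> verts G'" using bv wf unfolding bij_betw_def by auto
    have fe_inj: "f = fe e" if "Interior f a = (Interior (fe e) b :: ('w, 'f) gpoint)" for f a b using that by simp
    have "path_dist G l (Vertex (tail G e)) (Interior e (r / l e)) = r"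
      using M.vertex_ball[OF wf(1) \<epsilon>(2) r(1,2), of "Interior e (r / l e)"] e re by auto
    then have t: "path_dist G' l' (Vertex (fv (tail G e))) (\<phi> (Interior e (r / l e))) = r"
      using dist[of "Vertex (tail G e)" "Interior e (r / l e)"] fv wf e re by simp
    have "path_dist G l (Vertex (head G e)) (Interior e (1 - r / l e)) = r"
      using M.vertex_ball[OF wf(2) \<epsilon>(2) r(1,2), of "Interior e (1 - r / l e)"] e re by auto
    then have h: "path_dist G' l' (Vertex (fv (head G e))) (\<phi> (Interior e (1 - r / l e))) = r"
      using dist[of "Vertex (head G e)" "Interior e (1 - r / l e)"] fv wf e re by simp
    have mt: "\<phi> (Interior e (r / l e)) = Interior (fe e) (if fl e then 1 - r / l e else r / l e)"
      and mh: "\<phi> (Interior e (1 - r / l e)) = Interior (fe e) (if fl e then r / l e else 1 - r / l e)"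
      using map[OF e, of "r / l e"] map[OF e, of "1 - r / l e"] re by auto
    have T: "\<exists>d\<in>arcs G'. tail G' d = fv (tail G e) \<and> \<phi> (Interior e (r / l e)) = Interior d (r / l' d) \<or>
        head G' d = fv (tail G e) \<and> \<phi> (Interior e (r / l e)) = Interior d (1 - r / l' d)"
      using M'.vertex_ball[OF tv(1) \<epsilon>'(2) r(1,3) \<phi>_gpoints[of "Interior e (r / l e)"]] t e re by simp
    have H: "\<exists>d\<in>arcs G'. tail G' d = fv (head G e) \<and> \<phi> (Interior e (1 - r / l e)) = Interior d (r / l' d) \<or>
        head G' d = fv (head G e) \<and> \<phi> (Interior e (1 - r / l e)) = Interior d (1 - r / l' d)"
      using M'.vertex_ball[OF tv(2) \<epsilon>'(2) r(1,3) \<phi>_gpoints[of "Interior e (1 - r / l e)"]] h e re by simp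
    define q where "q = r / l e"
    have q: "q \<noteq> 1 - q" using re(2) unfolding q_def by linarith
    have T': "tail G' (fe e) = fv (tail G e) \<and> (if fl e then 1 - q else q) = q \<or>
        head G' (fe e) = fv (tail G e) \<and> (if fl e then 1 - q else q) = 1 - q"
      using T fe(2)[OF e] unfolding mt q_def by (elim bexE) (simp only: gpoint.inject, metis)
    have H': "tail G' (fe e) = fv (head G e) \<and> (if fl e then q else 1 - q) = q \<or>
        head G' (fe e) = fv (head G e) \<and> (if fl e then q else 1 - q) = 1 - q"
      using H fe(2)[OF e] unfolding mh q_def by (elim bexE) (simp only: gpoint.inject, metis)
    show ?thesis using T' H' q by (cases "fl e") simp_all
  qed
  show ?thesis
    using bv be ends fe(2) all unfolding graph_iso_def
    by (intro exI[of _ fv] exI[of _ fe] exI[of _ fl]) blast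
qed

end

section \<open>Stable graphs of genus two\<close>

definition is_theta :: "('v, 'e) pre_digraph \<Rightarrow> bool" where
  "is_theta G \<longleftrightarrow> (\<exists>u v. u \<noteq> v \<and> verts G = {u, v} \<and> card (arcs G) = 3
     \<and> (\<forall>e\<in>arcs G. {tail G e, head G e} = {u, v}))"

definition is_rose :: "('v, 'e) pre_digraph \<Rightarrow> bool" where
  "is_rose G \<longleftrightarrow> (\<exists>u. verts G = {u} \<and> card (arcs G) = 2 \<and> (\<forall>e\<in>arcs G. tail G e = u \<and> head G e = u))"

lemma theta_finite: "is_theta G \<Longrightarrow> finite (arcs G)"
  unfolding is_theta_def using card.infinite by fastforce

lemma rose_finite: "is_rose G \<Longrightarrow> finite (arcs G)"
  unfolding is_rose_def using card.infinite by fastforce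

lemma valency_theta: assumes "is_theta G" "w \<in> verts G" shows "valency G w = 3"
proof -
  obtain u v where uv: "u \<noteq> v" "verts G = {u, v}" "card (arcs G) = 3"
    "\<And>e. e \<in> arcs G \<Longrightarrow> {tail G e, head G e} = {u, v}"
    using assms unfolding is_theta_def by blast
  have "(tail G e = w) = (head G e \<noteq> w)" if "e \<in> arcs G" for e
    using uv(4)[OF that] uv(1,2) assms(2) by (auto simp: doubleton_eq_iff)
  then have "{e \<in> arcs G. head G e = w} = arcs G - {e \<in> arcs G. tail G e = w}" by auto
  then show ?thesis
    using theta_finite[OF assms(1)] uv(3) unfolding valency_def
    by (simp add: card_Diff_subset) (metis (no_types, lifting) card_mono le_add_diff_inverse mem_Collect_eq subsetI)
qed

lemma valency_rose: assumes "is_rose G" "w \<in> verts G" shows "valency G w = 4"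
proof -
  obtain u where u: "verts G = {u}" "card (arcs G) = 2" "\<And>e. e \<in> arcs G \<Longrightarrow> tail G e = u \<and> head G e = u"
    using assms(1) unfolding is_rose_def by blast
  then have "{e \<in> arcs G. head G e = w} = arcs G" "{e \<in> arcs G. tail G e = w} = arcs G"
    using assms(2) by auto
  then show ?thesis using u unfolding valency_def by simp
qed

lemma theta_stable: assumes G: "is_theta G" shows "G \<in> stable_graphs 2"
proof -
  obtain u v where uv: "u \<noteq> v" "verts G = {u, v}" "card (arcs G) = 3"
    "\<And>e. e \<in> arcs G \<Longrightarrow> {tail G e, head G e} = {u, v}"
    using G unfolding is_theta_def by blast
  have fin: "finite (arcs G)" using theta_finite[OF G] .
  have conn: "Digraph_Component.connected (pre_digraph.del_arc G e)" for e
  proof -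
    have "card (arcs G - {e}) \<ge> 2" using uv(3) fin by (cases "e \<in> arcs G") auto
    then have "arcs G - {e} \<noteq> {}" by (metis card.empty not_numeral_le_zero)
    then obtain f where f: "f \<in> arcs G" "f \<noteq> e" by blast
    show ?thesis
    proof (rule connected_complete)
      fix x y assume "x \<in> verts (pre_digraph.del_arc G e)" "y \<in> verts (pre_digraph.del_arc G e)" "x \<noteq> y"
      then show "\<exists>a\<in>arcs (pre_digraph.del_arc G e).
          tail (pre_digraph.del_arc G e) a = x \<and> head (pre_digraph.del_arc G e) a = y \<or>
          tail (pre_digraph.del_arc G e) a = y \<and> head (pre_digraph.del_arc G e) a = x"
        using uv f by (intro bexI[of _ f]) (auto simp: pre_digraph.del_arc_simps doubleton_eq_iff)
    qed (use uv in \<open>simp add: pre_digraph.del_arc_simps\<close>)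
  qed
  have "arcs G \<noteq> {}" using uv(3) by auto
  then obtain f where f: "f \<in> arcs G" by blast
  have "Digraph_Component.connected G"
  proof (rule connected_complete)
    fix x y assume "x \<in> verts G" "y \<in> verts G" "x \<noteq> y"
    then show "\<exists>e\<in>arcs G. tail G e = x \<and> head G e = y \<or> tail G e = y \<and> head G e = x"
      using uv f by (intro bexI[of _ f]) (auto simp: doubleton_eq_iff)
  qed (use uv in simp)
  moreover have "fin_digraph G"
    using uv fin by unfold_locales (auto simp: doubleton_eq_iff)
  ultimately show ?thesis
    using valency_theta[OF G] uv(1-3) conn
    unfolding stable_graphs_def multigraph_def stable_def bridge_def genus_def by simp
qed

lemma rose_stable: assumes G: "is_rose G" shows "G \<in> stable_graphs 2"
proof -
  obtain u where u: "verts G = {u}" "card (arcs G) = 2" "\<And>e. e \<in> arcs G \<Longrightarrow> tail G e = u \<and> head G e = u"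
    using G unfolding is_rose_def by blast
  have fin: "finite (arcs G)" using rose_finite[OF G] .
  have "Digraph_Component.connected (pre_digraph.del_arc G e)" for e
    using u(1) by (intro connected_complete) (auto simp: pre_digraph.del_arc_simps)
  moreover have "Digraph_Component.connected G" using u(1) by (intro connected_complete) auto
  moreover have "fin_digraph G" using u fin by unfold_locales auto
  ultimately show ?thesis
    using valency_rose[OF G] u
    unfolding stable_graphs_def multigraph_def stable_def bridge_def genus_def by simp
qed

lemma bridge_cut:
  assumes "e \<in> arcs G" "x \<in> S" "x \<in> verts G" "y \<in> verts G" "y \<notin> S"
    and "\<And>f. f \<in> arcs G \<Longrightarrow> f \<noteq> e \<Longrightarrow> tail G f \<in> S \<longleftrightarrow> head G f \<in> S"
  shows "bridge G e"
  unfolding bridge_def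
  using assms connected_cut[of "pre_digraph.del_arc G e" x S y] by (auto simp: pre_digraph.del_arc_simps)

text \<open>A vertex of valency at most two produces a bridge or a graph of smaller genus. So all
  valencies are at least three; as they add up to \<open>2 * (card (verts G) + 1)\<close>, there are at most two
  vertices. With two vertices both valencies are three, and a loop would leave one more edge end at
  its vertex, which belongs to a bridge.\<close>

lemma stable_genus_two:
  assumes "G \<in> stable_graphs 2" shows "is_theta G \<or> is_rose G"
proof -
  have mg: "multigraph G" and st: "stable G" and gen: "card (arcs G) = card (verts G) + 1"
    using assms unfolding stable_graphs_def genus_def by auto
  interpret fin_digraph G using mg unfolding multigraph_def by simp
  have conn: "Digraph_Component.connected G" using mg unfolding multigraph_def by simp
  have nobridge: "\<not> bridge G e" if "e \<in> arcs G" for e using st that unfolding stable_def by blast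
  define T where "T w = {e \<in> arcs G. tail G e = w}" for w
  define H where "H w = {e \<in> arcs G. head G e = w}" for w
  have val: "valency G w = card (T w) + card (H w)" for w unfolding valency_def T_def H_def ..
  have finTH: "finite (T w)" "finite (H w)" for w unfolding T_def H_def by auto
  have isolated: "card (arcs G) = card (T w)" "verts G = {w}"
    if w: "w \<in> verts G" and TH: "T w = H w" for w
  proof -
    have "v = w" if "v \<in> verts G" for v
      using connected_cut[OF conn w, of "{w}" v] that TH unfolding T_def H_def by auto
    then show V: "verts G = {w}" using w by blast
    have "T w = arcs G" using V tail_in_verts unfolding T_def by auto
    then show "card (arcs G) = card (T w)" by simp
  qed
  have ge3: "3 \<le> valency G w" if w: "w \<in> verts G" for w
  proof (rule ccontr)
    assume "\<not> 3 \<le> valency G w"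
    then consider "valency G w = 0" | "valency G w = 1" | "valency G w = 2" by linarith
    then show False
    proof cases
      case 1
      then have "T w = {}" "H w = {}" using val finTH by auto
      then show False using isolated[OF w] gen by simp
    next
      case 2
      then consider "card (T w) = 1" "H w = {}" | "T w = {}" "card (H w) = 1"
        using val[of w] finTH[of w] by (auto simp: add_is_1)
      then obtain e y where e: "e \<in> arcs G" "y \<in> verts G" "y \<noteq> w"
        "\<And>f. f \<in> arcs G \<Longrightarrow> f \<noteq> e \<Longrightarrow> tail G f \<noteq> w \<and> head G f \<noteq> w"
      proof cases
        case 1
        then obtain e where "T w = {e}" by (auto simp: card_1_singleton_iff)
        then show ?thesis using that[of e "head G e"] 1 unfolding T_def H_def by auto
      next
        case 2
        then obtain e where "H w = {e}" by (auto simp: card_1_singleton_iff)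
        then show ?thesis using that[of e "tail G e"] 2 unfolding T_def H_def by auto
      qed
      then have "bridge G e" using w by (intro bridge_cut[of e G w "{w}" y]) auto
      then show False using nobridge e by blast
    next
      case 3
      then obtain e where e: "loop_at G w e" using st w unfolding stable_def by blast
      then have "e \<in> T w" "e \<in> H w" unfolding loop_at_def T_def H_def by auto
      moreover have "card (T w) \<noteq> 0" "card (H w) \<noteq> 0" using calculation finTH by auto
      then have c: "card (T w) = 1" "card (H w) = 1" using 3 val[of w] by linarith+
      ultimately have "T w = {e}" "H w = {e}" by (auto simp: card_1_singleton_iff)
      then show False using isolated[OF w] gen c by simp
    qed
  qed
  have total: "(\<Sum>w\<in>verts G. valency G w) = 2 * card (arcs G)"
  proof -
    have "tail G ` arcs G \<subseteq> verts G" "head G ` arcs G \<subseteq> verts G" by auto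
    note * = this
    have "(\<Sum>w\<in>verts G. card (T w)) = card (arcs G)"
      using sum.group[of "arcs G" "verts G" "tail G" "\<lambda>_. 1 :: nat"] * unfolding T_def by simp
    moreover have "(\<Sum>w\<in>verts G. card (H w)) = card (arcs G)"
      using sum.group[of "arcs G" "verts G" "head G" "\<lambda>_. 1 :: nat"] * unfolding H_def by simp
    ultimately show ?thesis unfolding val by (simp add: sum.distrib)
  qed
  have "3 * card (verts G) \<le> (\<Sum>w\<in>verts G. valency G w)"
    using sum_mono[of "verts G" "\<lambda>_. 3" "valency G"] ge3 by simp
  then have "card (verts G) \<le> 2" using total gen by simp
  moreover have "card (verts G) \<noteq> 0"
    using conn unfolding Digraph_Component.connected_def strongly_connected_def by auto
  ultimately consider "card (verts G) = 1" | "card (verts G) = 2" by linarith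
  then show ?thesis
  proof cases
    case 1
    then obtain u where u: "verts G = {u}" by (auto simp: card_1_singleton_iff)
    then have "tail G e = u \<and> head G e = u" if "e \<in> arcs G" for e
      using that tail_in_verts head_in_verts by auto
    then show ?thesis using u gen unfolding is_rose_def by auto
  next
    case 2
    then obtain u v where uv: "verts G = {u, v}" "u \<noteq> v" by (auto simp: card_2_iff)
    have "valency G u + valency G v = 6" using total gen 2 uv by simp
    then have v3: "valency G w = 3" if "w \<in> verts G" for w
      using ge3[of u] ge3[of v] uv that by auto
    have noloop: False if w: "w \<in> verts G" and e: "e \<in> arcs G" "tail G e = w" "head G e = w" for w e
    proof -
      have eTH: "e \<in> T w" "e \<in> H w" using e unfolding T_def H_def by auto
      then have "card (T w - {e}) + card (H w - {e}) = 1"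
        using v3[OF w] val[of w] finTH[of w] card_Suc_Diff1[of "T w" e] card_Suc_Diff1[of "H w" e] by linarith
      then consider "card (T w - {e}) = 1" "H w - {e} = {}" | "T w - {e} = {}" "card (H w - {e}) = 1"
        using finTH[of w] by (auto simp: add_is_1)
      then obtain f where f: "f \<in> arcs G" "\<And>g. g \<in> arcs G \<Longrightarrow> g \<noteq> f \<Longrightarrow> tail G g = w \<longleftrightarrow> head G g = w"
      proof cases
        case 1
        then obtain f where "T w - {e} = {f}" by (auto simp: card_1_singleton_iff)
        then show ?thesis using that[of f] 1 eTH unfolding T_def H_def by auto
      next
        case 2
        then obtain f where "H w - {e} = {f}" by (auto simp: card_1_singleton_iff)
        then show ?thesis using that[of f] 2 eTH unfolding T_def H_def by auto
      qed
      obtain y where "y \<in> verts G" "y \<noteq> w" using uv w by auto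
      then have "bridge G f" using f w by (intro bridge_cut[of f G w "{w}" y]) auto
      then show False using nobridge f by blast
    qed
    have "{tail G e, head G e} = {u, v}" if e: "e \<in> arcs G" for e
    proof -
      have "tail G e \<noteq> head G e" using noloop[OF tail_in_verts[OF e] e] by auto
      then show ?thesis using tail_in_verts[OF e] head_in_verts[OF e] uv by auto
    qed
    then have "is_theta G" using uv gen 2 unfolding is_theta_def by auto
    then show ?thesis ..
  qed
qed

lemma cycle_reorient:
  "pre_digraph.cycle (reorient R G) p \<longleftrightarrow> (\<exists>u. u \<in> verts G \<and> set p \<subseteq> arcs G
    \<and> pre_digraph.cas (reorient R G) u p u
    \<and> distinct (tl (pre_digraph.awalk_verts (reorient R G) u p)) \<and> p \<noteq> [])"
  unfolding pre_digraph.cycle_def pre_digraph.awalk_def by (simp add: reorient_def)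

lemmas walk_simps = pre_digraph.cas.simps pre_digraph.awalk_verts.simps

text \<open>Two edges of a theta graph form a cycle, whereas a single edge has distinct ends.\<close>

lemma is_forest_theta:
  assumes G: "is_theta G" and F: "F \<subseteq> arcs G"
  shows "is_forest G F \<longleftrightarrow> card F \<le> 1"
proof -
  obtain u v where uv: "u \<noteq> v" "verts G = {u, v}" "\<And>e. e \<in> arcs G \<Longrightarrow> {tail G e, head G e} = {u, v}"
    using G unfolding is_theta_def by blast
  have finF: "finite F" using finite_subset[OF F theta_finite[OF G]] .
  show ?thesis
  proof
    assume forest: "is_forest G F"
    show "card F \<le> 1"
    proof (rule ccontr)
      assume "\<not> card F \<le> 1"
      then obtain a b where ab: "a \<in> F" "b \<in> F" "a \<noteq> b"
        using card_le_Suc0_iff_eq[OF finF] by auto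
      then have abG: "a \<in> arcs G" "b \<in> arcs G" using F by auto
      define R where "R = {e. e = a \<and> tail G a \<noteq> u \<or> e = b \<and> tail G b \<noteq> v}"
      have ends: "tail (reorient R G) a = u" "head (reorient R G) a = v"
        "tail (reorient R G) b = v" "head (reorient R G) b = u"
        using uv(1) uv(3)[OF abG(1)] uv(3)[OF abG(2)] ab(3)
        by (auto simp: reorient_def R_def doubleton_eq_iff)
      have "pre_digraph.cycle (reorient R G) [a, b]"
        unfolding cycle_reorient using abG ends uv(1,2) by (intro exI[of _ u]) (simp add: walk_simps)
      then show False using forest ab unfolding is_forest_def by force
    qed
  next
    assume c: "card F \<le> 1"
    have "\<not> pre_digraph.cycle (reorient R G) p" if p: "set p \<subseteq> F" for R p
    proof
      assume "pre_digraph.cycle (reorient R G) p"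
      then obtain w where w: "pre_digraph.cas (reorient R G) w p w" "p \<noteq> []"
        unfolding cycle_reorient by blast
      then obtain a q where a: "p = a # q" by (cases p) auto
      then have F1: "\<And>b. b \<in> F \<Longrightarrow> b = a" using c p finF card_le_Suc0_iff_eq[OF finF] by auto
      have "a \<in> arcs G" using a p F by auto
      then have ne: "tail (reorient R G) a \<noteq> head (reorient R G) a"
        using uv(3)[of a] uv(1) by (auto simp: reorient_def)
      show False
      proof (cases q)
        case Nil
        then show ?thesis using w ne a by (simp add: walk_simps)
      next
        case (Cons b q')
        then have "b = a" using F1 p a by auto
        then show ?thesis using w ne a Cons by (simp add: walk_simps)
      qed
    qed
    then show "is_forest G F" using F unfolding is_forest_def by blast
  qed
qed

lemma is_forest_rose:
  assumes G: "is_rose G" and F: "F \<subseteq> arcs G"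
  shows "is_forest G F \<longleftrightarrow> F = {}"
proof -
  obtain u where u: "verts G = {u}" "\<And>e. e \<in> arcs G \<Longrightarrow> tail G e = u \<and> head G e = u"
    using G unfolding is_rose_def by blast
  have "\<not> is_forest G F" if a: "a \<in> F" for a
  proof -
    have "pre_digraph.cycle (reorient {} G) [a]"
      unfolding cycle_reorient using u a F by (intro exI[of _ u]) (auto simp: walk_simps reorient_def)
    then show ?thesis using a unfolding is_forest_def by force
  qed
  moreover have "is_forest G {}"
    unfolding is_forest_def cycle_reorient by auto
  ultimately show ?thesis by blast
qed

section \<open>Topology of realizations\<close>

lemma gpoints_cases:
  assumes "x \<in> gpoints G"
  obtains v where "x = Vertex v" "v \<in> verts G" | e s where "x = Interior e s" "e \<in> arcs G" "0 < s" "s < 1"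
  using assms unfolding gpoints_def by auto

lemma edge_point_image:
  assumes "wf_digraph G"
  shows "(\<lambda>(e, s). edge_point G e s) ` topspace (sum_topology (\<lambda>_. top_of_set {0..1}) (arcs G)) \<subseteq> gpoints G"
  using wf_digraph.tail_in_verts[OF assms] wf_digraph.head_in_verts[OF assms]
  by (auto simp: edge_point_def gpoints_def)

lemma edge_point_gpoints:
  "wf_digraph G \<Longrightarrow> e \<in> arcs G \<Longrightarrow> s \<in> {0..1} \<Longrightarrow> edge_point G e s \<in> gpoints G"
  using wf_digraph.tail_in_verts[of G e] wf_digraph.head_in_verts[of G e]
  by (auto simp: edge_point_def gpoints_def)

lemma topspace_realization:
  assumes "wf_digraph G"
  shows "topspace (realization G) = gpoints G"
  unfolding realization_def by (rule topspace_quotient_topology[OF edge_point_image[OF assms]])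

lemma openin_realization:
  assumes wf: "wf_digraph G"
  shows "openin (realization G) U \<longleftrightarrow> U \<subseteq> gpoints G
    \<and> (\<forall>e\<in>arcs G. openin (top_of_set {0..1}) {s \<in> {0..1}. edge_point G e s \<in> U})"
proof -
  have "{x. (e, x) \<in> {x \<in> topspace (sum_topology (\<lambda>_. top_of_set {0..1}) (arcs G)). (case x of (e, s) \<Rightarrow> edge_point G e s) \<in> U}}
     = {s \<in> {0..1}. edge_point G e s \<in> U}" if "e \<in> arcs G" for e
    using that by auto
  then show ?thesis
    unfolding realization_def openin_quotient_topology openin_sum_topology by auto
qed

lemma continuous_map_edge_point:
  assumes wf: "wf_digraph G" and e: "e \<in> arcs G"
  shows "continuous_map (top_of_set {0..1}) (realization G) (edge_point G e)"
  unfolding continuous_map_def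
proof (intro conjI allI impI)
  show "edge_point G e \<in> topspace (top_of_set {0..1}) \<rightarrow> topspace (realization G)"
    unfolding topspace_realization[OF wf] using edge_point_gpoints[OF wf e] by auto
  fix U assume "openin (realization G) U"
  then show "openin (top_of_set {0..1}) {x \<in> topspace (top_of_set {0..1}). edge_point G e x \<in> U}"
    using e unfolding openin_realization[OF wf] by simp
qed

lemma continuous_map_from_realization:
  assumes wf: "wf_digraph G"
    and f: "f \<in> gpoints G \<rightarrow> topspace Y"
    and cont: "\<And>e. e \<in> arcs G \<Longrightarrow> continuous_map (top_of_set {0..1}) Y (\<lambda>s. f (edge_point G e s))"
  shows "continuous_map (realization G) Y f"
  unfolding continuous_map_def topspace_realization[OF wf]
proof (intro conjI allI impI f)
  fix U assume U: "openin Y U"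
  have "openin (top_of_set {0..1}) {s \<in> {0..1}. edge_point G e s \<in> {x \<in> gpoints G. f x \<in> U}}"
    if e: "e \<in> arcs G" for e
  proof -
    have "openin (top_of_set {0..1}) {s \<in> topspace (top_of_set {0..1}). f (edge_point G e s) \<in> U}"
      using cont[OF e] U unfolding continuous_map_def by blast
    moreover have "edge_point G e s \<in> gpoints G" if "s \<in> {0..1}" for s
      using that edge_point_gpoints[OF wf e] by blast
    ultimately show ?thesis by (simp add: conj_commute cong: conj_cong)
  qed
  then show "openin (realization G) {x \<in> gpoints G. f x \<in> U}"
    unfolding openin_realization[OF wf] by blast
qed

text \<open>The last assumption excludes isolated vertices: then the realization is the image of finitely many
  intervals.\<close>

lemma compact_realization:
  assumes wf: "wf_digraph G" and fin: "finite (arcs G)"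
    and ends: "\<And>v. v \<in> verts G \<Longrightarrow> \<exists>e\<in>arcs G. tail G e = v \<or> head G e = v"
  shows "compact_space (realization G)"
proof -
  have "compactin (realization G) (edge_point G e ` {0..1})" if "e \<in> arcs G" for e
    by (rule image_compactin[OF _ continuous_map_edge_point[OF wf that]])
     (auto simp: compactin_subtopology compactin_euclidean_iff)
  then have "compactin (realization G) (\<Union>e\<in>arcs G. edge_point G e ` {0..1})"
    using fin by (intro compactin_Union) auto
  moreover have "(\<Union>e\<in>arcs G. edge_point G e ` {0..1}) = gpoints G"
  proof (intro equalityI subsetI)
    fix x assume "x \<in> gpoints G"
    then show "x \<in> (\<Union>e\<in>arcs G. edge_point G e ` {0..1})"
    proof (cases rule: gpoints_cases)
      case (1 v)
      then obtain e where "e \<in> arcs G" "tail G e = v \<or> head G e = v" using ends by blast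
      then have "x = edge_point G e 0 \<or> x = edge_point G e 1" using 1 by (auto simp: edge_point_def)
      then have "x \<in> edge_point G e ` {0..1}" by auto
      then show ?thesis using \<open>e \<in> arcs G\<close> by blast
    next
      case (2 e s)
      then have "x \<in> edge_point G e ` {0..1}" by (intro image_eqI[of _ _ s]) (auto simp: edge_point_def)
      then show ?thesis using 2 by blast
    qed
  qed (use edge_point_gpoints[OF wf] in auto)
  ultimately show ?thesis unfolding compact_space_def topspace_realization[OF wf] by simp
qed

lemma Hausdorff_space_separating_functions:
  assumes "\<And>x y. x \<in> topspace X \<Longrightarrow> y \<in> topspace X \<Longrightarrow> x \<noteq> y \<Longrightarrow>
    \<exists>f. continuous_map X euclideanreal f \<and> f x \<noteq> f y"
  shows "Hausdorff_space X"
  unfolding Hausdorff_space_def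
proof (intro allI impI)
  fix x y assume xy: "x \<in> topspace X \<and> y \<in> topspace X \<and> x \<noteq> y"
  then obtain f where f: "continuous_map X euclideanreal f" "f x \<noteq> f y" using assms by blast
  obtain U V where UV: "open U" "open V" "f x \<in> U" "f y \<in> V" "U \<inter> V = {}"
    using hausdorff[OF f(2)] by blast
  have "openin X {z \<in> topspace X. f z \<in> U}" "openin X {z \<in> topspace X. f z \<in> V}"
    using f(1) UV(1,2) by (auto intro: openin_continuous_map_preimage)
  then show "\<exists>U V. openin X U \<and> openin X V \<and> x \<in> U \<and> y \<in> V \<and> disjnt U V"
    using xy UV(3-5) by (intro exI[of _ "{z \<in> topspace X. f z \<in> U}"] exI[of _ "{z \<in> topspace X. f z \<in> V}"])
      (auto simp: disjnt_def)
qed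

text \<open>Vertices are separated by barycentric coordinates. On an edge, \<open>s * (1 - s)\<close> and
  \<open>s\<^sup>2 * (1 - s)\<close> vanish at both ends, so they extend by zero; their quotient recovers
  \<open>s\<close>.\<close>

lemma Hausdorff_realization:
  assumes wf: "wf_digraph G"
  shows "Hausdorff_space (realization G)"
proof (rule Hausdorff_space_separating_functions)
  fix x y assume "x \<in> topspace (realization G)" "y \<in> topspace (realization G)" and ne: "x \<noteq> y"
  then have xy: "x \<in> gpoints G" "y \<in> gpoints G" unfolding topspace_realization[OF wf] by auto
  define bump where "bump k e z = (case z of Vertex v \<Rightarrow> 0 | Interior e' s \<Rightarrow> if e' = e then s ^ k * (s * (1 - s)) else 0)"
    for k :: nat and e and z :: "('a, 'b) gpoint"
  define vert where "vert v z = (case z of Vertex w \<Rightarrow> if w = v then 1 else 0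
      | Interior e s \<Rightarrow> (if tail G e = v then 1 - s else 0) + (if head G e = v then s else 0))"
    for v and z :: "('a, 'b) gpoint"
  have bump: "continuous_map (realization G) euclideanreal (bump k e)" for k e
  proof (rule continuous_map_from_realization[OF wf])
    fix e' assume "e' \<in> arcs G"
    have "(\<lambda>s. bump k e (edge_point G e' s)) = (\<lambda>s. if e' = e then s ^ k * (s * (1 - s)) else 0)"
      by (auto simp: bump_def edge_point_def)
    then show "continuous_map (top_of_set {0..1}) euclideanreal (\<lambda>s. bump k e (edge_point G e' s))"
      by (auto intro!: continuous_intros)
  qed auto
  have vert: "continuous_map (realization G) euclideanreal (vert v)" for v
  proof (rule continuous_map_from_realization[OF wf])
    fix e assume "e \<in> arcs G"
    have "(\<lambda>s. vert v (edge_point G e s)) = (\<lambda>s. (if tail G e = v then 1 - s else 0) + (if head G e = v then s else 0))"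
      by (auto simp: vert_def edge_point_def)
    then show "continuous_map (top_of_set {0..1}) euclideanreal (\<lambda>s. vert v (edge_point G e s))"
      by (cases "tail G e = v"; cases "head G e = v") (auto intro!: continuous_intros)
  qed auto
  have mixed: "bump 0 e (Vertex v) \<noteq> bump 0 e (Interior e s)" if "0 < s" "s < 1" for e v s
    using that by (simp add: bump_def)
  show "\<exists>f. continuous_map (realization G) euclideanreal f \<and> f x \<noteq> f y"
    using xy(1)
  proof (cases rule: gpoints_cases)
    case (1 v)
    show ?thesis using xy(2)
    proof (cases rule: gpoints_cases)
      case (1 w)
      then have "vert v x \<noteq> vert v y" using \<open>x = Vertex v\<close> ne by (auto simp: vert_def)
      then show ?thesis using vert by blast
    next
      case (2 e s)
      then show ?thesis using 1 mixed bump by metis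
    qed
  next
    case (2 e s)
    show ?thesis using xy(2)
    proof (cases rule: gpoints_cases)
      case (1 w)
      then show ?thesis using 2 mixed bump by metis
    next
      case (2 e' t)
      have s: "x = Interior e s" "0 < s" "s < 1" by fact+
      have "bump 0 e x \<noteq> bump 0 e y \<or> bump 1 e x \<noteq> bump 1 e y"
        using ne 2 s by (cases "e' = e") (auto simp: bump_def)
      then show ?thesis using bump by blast
    qed
  qed
qed

section \<open>The two models and their isometry classes\<close>

definition theta0 :: "(nat, nat) pre_digraph" where
  "theta0 = \<lparr>verts = {0, 1}, arcs = {0, 1, 2}, tail = (\<lambda>_. 0), head = (\<lambda>_. 1)\<rparr>"

definition rose0 :: "(nat, nat) pre_digraph" where
  "rose0 = \<lparr>verts = {0}, arcs = {0, 1}, tail = (\<lambda>_. 0), head = (\<lambda>_. 0)\<rparr>"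

lemma theta0_simps [simp]: "verts theta0 = {0, 1}" "arcs theta0 = {0, 1, 2}" "tail theta0 e = 0" "head theta0 e = 1"
  by (simp_all add: theta0_def)

lemma rose0_simps [simp]: "verts rose0 = {0}" "arcs rose0 = {0, 1}" "tail rose0 e = 0" "head rose0 e = 0"
  by (simp_all add: rose0_def)

lemma is_theta_theta0: "is_theta theta0"
  unfolding is_theta_def by (intro exI[of _ 0] exI[of _ 1]) auto

lemma is_rose_rose0: "is_rose rose0"
  unfolding is_rose_def by (intro exI[of _ 0]) auto

text \<open>The contraction of the edge 2 of the theta graph to the vertex of the rose.\<close>

fun collapse :: "(nat, nat) gpoint \<Rightarrow> (nat, nat) gpoint" where
  "collapse (Vertex v) = Vertex 0"
| "collapse (Interior e s) = (if e = 2 then Vertex 0 else Interior e s)"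

definition edge_lengths :: "real \<Rightarrow> nat \<Rightarrow> real" where
  "edge_lengths a = (\<lambda>e\<in>{0, 1, 2}. if e = 2 then a else 1)"

text \<open>Length 0 is not a length of an edge, so at the parameter 0 the model is the contracted graph.\<close>

definition model :: "nat \<Rightarrow> real \<Rightarrow> (nat \<Rightarrow> (nat, nat) gpoint) \<Rightarrow> (nat, nat) marked_graph" where
  "model n a P = (if a = 0 then (rose0, \<lambda>e\<in>{0, 1}. 1, \<lambda>i\<in>{1..n}. collapse (P i))
    else (theta0, edge_lengths a, P))"

lemma genus_two_wf:
  assumes "G \<in> stable_graphs 2"
  shows "wf_digraph G" "multigraph G" "finite (arcs G)"
    "\<And>v. v \<in> verts G \<Longrightarrow> \<exists>e\<in>arcs G. tail G e = v \<or> head G e = v"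
    "\<And>v. v \<in> verts G \<Longrightarrow> 3 \<le> valency G v"
proof -
  show mg: "multigraph G" using assms unfolding stable_graphs_def by auto
  interpret fin_digraph G using mg unfolding multigraph_def by simp
  show "wf_digraph G" "finite (arcs G)" by (simp_all add: wf_digraph)
  show val: "3 \<le> valency G v" if "v \<in> verts G" for v
    using stable_genus_two[OF assms] valency_theta[of G v] valency_rose[of G v] that by auto
  show "\<exists>e\<in>arcs G. tail G e = v \<or> head G e = v" if v: "v \<in> verts G" for v
  proof (rule ccontr)
    assume "\<not> ?thesis"
    then have "{e \<in> arcs G. tail G e = v} = {}" "{e \<in> arcs G. head G e = v} = {}" by auto
    then have "valency G v = 0" unfolding valency_def by (simp only: card.empty)
    then show False using val[OF v] by simp
  qed
qed

lemma stable_theta0: "theta0 \<in> stable_graphs 2" by (rule theta_stable[OF is_theta_theta0])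
lemma stable_rose0: "rose0 \<in> stable_graphs 2" by (rule rose_stable[OF is_rose_rose0])

lemma isometry_class_eqI:
  assumes "isometric n (G, l, p) (G', l', p')" "\<And>i. i \<in> {1..n} \<Longrightarrow> p i \<in> gpoints G"
  shows "isometry_class g n (G, l, p) = isometry_class g n (G', l', p')"
  unfolding isometry_class_def
  using isometric_trans[OF assms(1)] isometric_trans[OF isometric_sym[OF assms]] by blast

lemma graph_iso_restrict_isometric:
  assumes iso: "graph_iso G G' fv fe fl" and wf: "wf_digraph G"
    and "\<And>e. e \<in> arcs G \<Longrightarrow> l' (fe e) = l e" "\<And>i. i \<in> {1..n} \<Longrightarrow> graph_map fv fe fl (p i) = p' i"
    and "\<And>i. i \<in> {1..n} \<Longrightarrow> p i \<in> gpoints G"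
  shows "isometry_class g n (G, l, p) = isometry_class g n (G', l', p')"
  using assms wf_digraph.tail_in_verts[OF wf] wf_digraph.head_in_verts[OF wf]
  by (intro isometry_class_eqI graph_iso_isometric[OF iso]) auto

text \<open>Any of the three edges can be the short one, so the label 2 must be available for each of them.\<close>

lemma theta_labelling:
  assumes "is_theta G" "z \<in> arcs G"
  shows "\<exists>fv fe fl. graph_iso theta0 G fv fe fl \<and> fe 2 = z"
proof -
  obtain u v where uv: "u \<noteq> v" "verts G = {u, v}" "card (arcs G) = 3"
    "\<And>e. e \<in> arcs G \<Longrightarrow> {tail G e, head G e} = {u, v}"
    using assms unfolding is_theta_def by blast
  have "card (arcs G - {z}) = 2" using uv(3) assms(2) theta_finite[OF assms(1)] by simp
  then obtain x y where xy: "arcs G - {z} = {x, y}" "x \<noteq> y" by (auto simp: card_2_iff)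
  then have arcs: "arcs G = {x, y, z}" "x \<noteq> z" "y \<noteq> z" using assms(2) by auto
  define fv where "fv w = (if w = 0 then u else v)" for w :: nat
  define fe where "fe e = (if e = 0 then x else if e = 1 then y else z)" for e :: nat
  have "bij_betw fv (verts theta0) (verts G)" "bij_betw fe (arcs theta0) (arcs G)"
    using uv xy arcs by (auto simp: bij_betw_def inj_on_def fv_def fe_def)
  moreover have "fe e \<in> arcs G" for e using arcs unfolding fe_def by auto
  moreover have "tail G (fe e) = u \<and> head G (fe e) = v \<or> tail G (fe e) = v \<and> head G (fe e) = u" for e
    using uv(4)[OF calculation(3)[of e]] by (auto simp: doubleton_eq_iff)
  ultimately have "graph_iso theta0 G fv fe (\<lambda>e. tail G (fe e) \<noteq> u)"
    unfolding graph_iso_def using uv(1) by (intro conjI ballI) (auto simp: fv_def split: if_splits; metis)+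
  then show ?thesis by (intro exI[of _ fv] exI[of _ fe] exI) (auto simp: fe_def)
qed

lemma rose_labelling:
  assumes "is_rose G"
  shows "\<exists>fv fe fl. graph_iso rose0 G fv fe fl"
proof -
  obtain u where u: "verts G = {u}" "card (arcs G) = 2" "\<And>e. e \<in> arcs G \<Longrightarrow> tail G e = u \<and> head G e = u"
    using assms unfolding is_rose_def by blast
  obtain x y where xy: "arcs G = {x, y}" "x \<noteq> y" using u(2) by (auto simp: card_2_iff)
  define fe where "fe e = (if e = 0 then x else y)" for e :: nat
  have "bij_betw (\<lambda>_. u) (verts rose0) (verts G)" "bij_betw fe (arcs rose0) (arcs G)"
    using u xy by (auto simp: bij_betw_def inj_on_def fe_def)
  moreover have "fe e \<in> arcs G" for e using xy unfolding fe_def by auto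
  ultimately have "graph_iso rose0 G (\<lambda>_. u) fe (\<lambda>_. False)"
    unfolding graph_iso_def using u(3) by auto
  then show ?thesis by blast
qed

lemma component_of_empty: "v \<in> verts G \<Longrightarrow> component_of G {} v = {v}"
  unfolding component_of_def reachable_def
  by (auto simp: parcs_mk_symmetric elim: rtrancl_on.cases)

lemma component_of_theta_edge:
  assumes "is_theta G" "z \<in> arcs G" "w \<in> verts G"
  shows "component_of G {z} w = verts G"
proof -
  obtain u v where uv: "verts G = {u, v}" "{tail G z, head G z} = {u, v}"
    using assms unfolding is_theta_def by blast
  have "w \<rightarrow>\<^sup>*\<^bsub>mk_symmetric (G\<lparr>arcs := {z}\<rparr>)\<^esub> x \<longleftrightarrow> x \<in> verts G" for x
  proof
    assume "w \<rightarrow>\<^sup>*\<^bsub>mk_symmetric (G\<lparr>arcs := {z}\<rparr>)\<^esub> x"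
    then show "x \<in> verts G"
      unfolding reachable_def by (auto dest: in_rtrancl_on_in_F)
  next
    assume x: "x \<in> verts G"
    have "Digraph_Component.connected (G\<lparr>arcs := {z}\<rparr>)"
      using uv by (intro connected_complete) (auto simp: doubleton_eq_iff)
    then show "w \<rightarrow>\<^sup>*\<^bsub>mk_symmetric (G\<lparr>arcs := {z}\<rparr>)\<^esub> x"
      using x assms(3) unfolding Digraph_Component.connected_def strongly_connected_def by auto
  qed
  then show ?thesis unfolding component_of_def by blast
qed

lemma contract_no_zero:
  assumes wf: "wf_digraph G" and z: "zero_edges G l = {}" and p: "\<And>i. i \<in> {1..n} \<Longrightarrow> p i \<in> gpoints G"
  shows "isometry_class g n (contract n (G, l, p)) = isometry_class g n (G, l, p)"
proof -
  have "graph_iso G (contract_graph G {}) (component_of G {}) (\<lambda>e. e) (\<lambda>_. False)"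
    unfolding graph_iso_def contract_graph_def
    by (auto simp: bij_betw_def inj_on_def component_of_empty)
  moreover have "graph_map (component_of G {}) (\<lambda>e. e) (\<lambda>_. False) x = contract_point G {} x" for x
    by (cases x) auto
  ultimately show ?thesis
    using wf p z
    by (simp add: contract_def Let_def)
      (rule graph_iso_restrict_isometric[symmetric], auto)
qed

text \<open>An edge of a theta graph joins its two vertices, so its contraction leaves one vertex with the
  other two edges as loops.\<close>

lemma contract_theta_edge:
  assumes G: "is_theta G" and iso: "graph_iso theta0 G fv fe fl" and z: "zero_edges G l = {fe 2}"
    and P: "\<And>i. i \<in> {1..n} \<Longrightarrow> P i \<in> gpoints theta0"
    and p: "\<And>i. i \<in> {1..n} \<Longrightarrow> p i = graph_map fv fe fl (P i)"
  shows "isometry_class g n (contract n (G, l, p))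
    = isometry_class g n (rose0, \<lambda>e\<in>{0, 1}. l (fe e), \<lambda>i\<in>{1..n}. collapse (P i))"
proof -
  have fe: "bij_betw fe {0, 1, 2} (arcs G)" and fv: "bij_betw fv {0, 1} (verts G)"
    using iso unfolding graph_iso_def by auto
  have fe': "fe 0 \<noteq> fe 2" "fe 1 \<noteq> fe 2" "fe 0 \<noteq> fe 1" "arcs G = {fe 0, fe 1, fe 2}"
    using fe unfolding bij_betw_def inj_on_def by auto
  have fv': "verts G = {fv 0, fv 1}" using fv unfolding bij_betw_def by auto
  have wf: "wf_digraph G" using genus_two_wf(1)[OF theta_stable[OF G]] .
  have comp: "component_of G {fe 2} w = verts G" if "w \<in> verts G" for w
    using component_of_theta_edge[OF G _ that, of "fe 2"] fe' by auto
  have ends: "tail G e \<in> verts G" "head G e \<in> verts G" if "e \<in> arcs G" for e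
    using that wf_digraph.tail_in_verts[OF wf] wf_digraph.head_in_verts[OF wf] by auto
  have iso': "graph_iso rose0 (contract_graph G {fe 2}) (\<lambda>_. verts G) fe fl"
    unfolding graph_iso_def
  proof (intro conjI ballI)
    show "bij_betw (\<lambda>_. verts G) (verts rose0) (verts (contract_graph G {fe 2}))"
      using fv' comp by (auto simp: contract_graph_def bij_betw_def)
    show "bij_betw fe (arcs rose0) (arcs (contract_graph G {fe 2}))"
      using fe' by (auto simp: contract_graph_def bij_betw_def inj_on_def)
    fix e assume "e \<in> arcs rose0"
    then have "fe e \<in> arcs G" using fe' by auto
    then show "tail (contract_graph G {fe 2}) (fe e) = verts G" "head (contract_graph G {fe 2}) (fe e) = verts G"
      using comp ends by (auto simp: contract_graph_def)
  qed
  have map: "graph_map (\<lambda>_. verts G) fe fl (collapse x) = contract_point G {fe 2} (graph_map fv fe fl x)"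
    if x: "x \<in> gpoints theta0" for x
    using x
  proof (cases rule: gpoints_cases)
    case (1 v)
    then show ?thesis using comp fv' by auto
  next
    case (2 e s)
    then show ?thesis using fe' comp[OF ends(1), of "fe 2"] by auto
  qed
  have wfr: "wf_digraph rose0" using genus_two_wf(1)[OF stable_rose0] .
  have col: "collapse x \<in> gpoints rose0" if "x \<in> gpoints theta0" for x
    using that by (cases rule: gpoints_cases) (auto simp: gpoints_def)
  have "isometry_class g n (rose0, \<lambda>e\<in>{0, 1}. l (fe e), \<lambda>i\<in>{1..n}. collapse (P i))
    = isometry_class g n (contract_graph G {fe 2}, restrict l (arcs G - {fe 2}),
      \<lambda>i\<in>{1..n}. contract_point G {fe 2} (p i))"
    using map p P col fe' by (intro graph_iso_restrict_isometric[OF iso' wfr]) auto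
  then show ?thesis by (simp add: contract_def Let_def z)
qed

section \<open>The space \<open>X_space 2 n\<close> as a quotient of a cylinder\<close>

definition point_class :: "nat \<Rightarrow> real \<Rightarrow> (nat \<Rightarrow> (nat, nat) gpoint) \<Rightarrow> (nat, nat) marked_graph set" where
  "point_class n a P = isometry_class 2 n (model n a P)"

abbreviation markings :: "nat \<Rightarrow> ('v, 'e) pre_digraph \<Rightarrow> (nat \<Rightarrow> ('v, 'e) gpoint) set" where
  "markings n G \<equiv> {1..n} \<rightarrow>\<^sub>E gpoints G"

definition cylinder :: "nat \<Rightarrow> (real \<times> (nat \<Rightarrow> (nat, nat) gpoint)) topology" where
  "cylinder n = prod_topology (top_of_set {0..1}) (marking_space n theta0)"

lemma wf_theta0: "wf_digraph theta0" and wf_rose0: "wf_digraph rose0"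
  using genus_two_wf(1)[OF stable_theta0] genus_two_wf(1)[OF stable_rose0] by auto

lemma topspace_marking_space: "wf_digraph G \<Longrightarrow> topspace (marking_space n G) = markings n G"
  unfolding marking_space_def by (simp add: topspace_realization)

lemma topspace_cylinder: "topspace (cylinder n) = {0..1} \<times> markings n theta0"
  unfolding cylinder_def by (simp add: topspace_marking_space[OF wf_theta0])

lemma Hausdorff_marking_space: "wf_digraph G \<Longrightarrow> Hausdorff_space (marking_space n G)"
  unfolding marking_space_def by (simp add: Hausdorff_space_product_topology Hausdorff_realization)

lemma compact_marking_space:
  assumes "G \<in> stable_graphs 2" shows "compact_space (marking_space n G)"
  unfolding marking_space_def compact_space_product_topology
  using compact_realization[OF genus_two_wf(1,3,4)[OF assms]] by simp

lemma compact_cylinder: "compact_space (cylinder n)"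
  unfolding cylinder_def compact_space_prod_topology
  using compact_marking_space[OF stable_theta0]
  by (simp add: compact_space_subtopology compactin_euclidean_iff)

lemma Hausdorff_cylinder: "Hausdorff_space (cylinder n)"
  unfolding cylinder_def Hausdorff_space_prod_topology
  using Hausdorff_marking_space[OF wf_theta0] by (simp add: Hausdorff_space_subtopology)

lemma collapse_gpoints: "x \<in> gpoints theta0 \<Longrightarrow> collapse x \<in> gpoints rose0"
  by (erule gpoints_cases) (auto simp: gpoints_def)

lemma model_marked:
  assumes "a \<in> {0..1}" "P \<in> markings n theta0"
  shows "model n a P \<in> marked_graphs 2 n"
  using assms stable_theta0 stable_rose0 collapse_gpoints
  unfolding model_def marked_graphs_def edge_lengths_def by (auto simp: PiE_iff)

lemma isometric_graph_iso:
  assumes G: "G \<in> stable_graphs 2" and G': "G' \<in> stable_graphs 2"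
    and l: "\<And>e. e \<in> arcs G \<Longrightarrow> 0 < l e" and l': "\<And>e. e \<in> arcs G' \<Longrightarrow> 0 < l' e"
    and p: "\<And>i. i \<in> {1..n} \<Longrightarrow> p i \<in> gpoints G"
    and iso: "isometric n (G, l, p) (G', l', p')"
  shows "\<exists>fv fe fl. graph_iso G G' fv fe fl \<and> (\<forall>e\<in>arcs G. l' (fe e) = l e)
    \<and> (\<forall>i\<in>{1..n}. p' i = graph_map fv fe fl (p i))"
proof -
  obtain \<phi> where \<phi>: "bij_betw \<phi> (gpoints G) (gpoints G')"
    "\<forall>x\<in>gpoints G. \<forall>y\<in>gpoints G. path_dist G' l' (\<phi> x) (\<phi> y) = path_dist G l x y"
    "\<forall>i\<in>{1..n}. \<phi> (p i) = p' i"
    using iso unfolding isometric_def by auto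
  interpret metric_graph_isometry G l G' l' \<phi>
    using genus_two_wf[OF G] genus_two_wf[OF G'] l l' \<phi> by unfold_locales auto
  show ?thesis using induced_by_graph_iso \<phi>(3) p by metis
qed

text \<open>The length condition of \<open>X_space\<close> in a form that is visibly invariant under isomorphism: one
  of the three edges of a theta graph, and no edge of a rose, may be shorter than 1.\<close>

definition good_lengths :: "('v, 'e) pre_digraph \<Rightarrow> ('e \<Rightarrow> real) \<Rightarrow> bool" where
  "good_lengths G l \<longleftrightarrow> Max (l ` arcs G) = 1 \<and> card {e \<in> arcs G. l e < 1} + 2 \<le> card (arcs G)"

lemma good_lengths_iff:
  assumes "G \<in> stable_graphs 2"
  shows "Max (l ` arcs G) = 1 \<and> is_forest G {e \<in> arcs G. l e < 1} \<longleftrightarrow> good_lengths G l"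
  using stable_genus_two[OF assms]
proof
  assume t: "is_theta G"
  then have "card (arcs G) = 3" unfolding is_theta_def by auto
  then show ?thesis using is_forest_theta[OF t, of "{e \<in> arcs G. l e < 1}"] unfolding good_lengths_def by auto
next
  assume r: "is_rose G"
  then have "card (arcs G) = 2" unfolding is_rose_def by auto
  then show ?thesis using is_forest_rose[OF r, of "{e \<in> arcs G. l e < 1}"] rose_finite[OF r]
    unfolding good_lengths_def by auto
qed

lemma good_lengths_graph_iso:
  assumes "graph_iso G G' fv fe fl" "\<And>e. e \<in> arcs G \<Longrightarrow> l' (fe e) = l e"
  shows "good_lengths G' l' \<longleftrightarrow> good_lengths G l"
proof -
  have fe: "bij_betw fe (arcs G) (arcs G')" using assms(1) unfolding graph_iso_def by auto
  then have arcs': "arcs G' = fe ` arcs G" and inj: "inj_on fe (arcs G)" unfolding bij_betw_def by auto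
  have "l' ` arcs G' = l ` arcs G" unfolding arcs' image_image using assms(2) by (intro image_cong) auto
  moreover have "{e \<in> arcs G'. l' e < 1} = fe ` {e \<in> arcs G. l e < 1}"
    unfolding arcs' using assms(2) by auto
  moreover have "inj_on fe {e \<in> arcs G. l e < 1}" using inj by (rule inj_on_subset) auto
  ultimately show ?thesis
    unfolding good_lengths_def using bij_betw_same_card[OF fe] by (simp add: card_image)
qed

lemma length_space_topspace:
  "topspace (length_space G) = {l \<in> arcs G \<rightarrow>\<^sub>E {0..}. is_forest G (zero_edges G l)}"
  unfolding length_space_def by auto

lemma graph_map_marking:
  assumes iso: "graph_iso G G' fv fe fl" and p: "p \<in> markings n G'"
  shows "\<exists>P\<in>markings n G. p = (\<lambda>i\<in>{1..n}. graph_map fv fe fl (P i))"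
proof -
  have im: "graph_map fv fe fl ` gpoints G = gpoints G'" using graph_map_bij[OF iso] unfolding bij_betw_def by simp
  have "\<exists>x. x \<in> gpoints G \<and> p i = graph_map fv fe fl x" if "i \<in> {1..n}" for i
  proof -
    have "p i \<in> graph_map fv fe fl ` gpoints G" unfolding im using p that by (rule PiE_mem)
    then show ?thesis by blast
  qed
  then obtain P where P: "\<forall>i\<in>{1..n}. P i \<in> gpoints G \<and> p i = graph_map fv fe fl (P i)" by metis
  then show ?thesis
    using p by (intro bexI[of _ "restrict P {1..n}"]) (auto simp: PiE_iff extensional_def)
qed

text \<open>The edges of length 0 form a forest; so at most one edge is contracted, and only in a
  theta graph.\<close>

lemma contract_class:
  assumes G: "G \<in> stable_graphs 2" and l: "l \<in> topspace (length_space G)" and p: "p \<in> markings n G"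
  obtains (positive) "\<And>e. e \<in> arcs G \<Longrightarrow> 0 < l e" "(G, l, p) \<in> marked_graphs 2 n"
      "isometry_class 2 n (contract n (G, l, p)) = isometry_class 2 n (G, l, p)"
    | (contracted) z fv fe fl P where "is_theta G" "z \<in> arcs G" "l z = 0" "\<And>e. e \<in> arcs G \<Longrightarrow> e \<noteq> z \<Longrightarrow> 0 < l e"
      "graph_iso theta0 G fv fe fl" "fe 2 = z" "P \<in> markings n theta0"
      "(rose0, \<lambda>e\<in>{0, 1}. l (fe e), \<lambda>i\<in>{1..n}. collapse (P i)) \<in> marked_graphs 2 n"
      "isometry_class 2 n (contract n (G, l, p)) =
        isometry_class 2 n (rose0, \<lambda>e\<in>{0, 1}. l (fe e), \<lambda>i\<in>{1..n}. collapse (P i))"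
proof (cases "zero_edges G l = {}")
  case True
  have nn: "l \<in> arcs G \<rightarrow>\<^sub>E {0..}" using l unfolding length_space_topspace by simp
  have pos: "0 < l e" if "e \<in> arcs G" for e
  proof -
    have "0 \<le> l e" "l e \<noteq> 0" using nn True that unfolding zero_edges_def by (auto simp: PiE_iff)
    then show ?thesis by simp
  qed
  moreover have "(G, l, p) \<in> marked_graphs 2 n"
    using G pos nn p unfolding marked_graphs_def by (auto simp: PiE_iff)
  moreover have "isometry_class 2 n (contract n (G, l, p)) = isometry_class 2 n (G, l, p)"
    using p by (intro contract_no_zero True genus_two_wf(1)[OF G]) (auto simp: PiE_iff)
  ultimately show ?thesis by (rule positive)
next
  case False
  have nn: "l \<in> arcs G \<rightarrow>\<^sub>E {0..}" and forest: "is_forest G (zero_edges G l)"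
    using l unfolding length_space_topspace by auto
  have sub: "zero_edges G l \<subseteq> arcs G" unfolding zero_edges_def by auto
  then have t: "is_theta G" using stable_genus_two[OF G] is_forest_rose[OF _ sub] forest False by blast
  have "finite (zero_edges G l)" using finite_subset[OF sub theta_finite[OF t]] .
  then obtain z where z: "zero_edges G l = {z}"
    using is_forest_theta[OF t sub] forest False card_1_singletonE
    by (metis One_nat_def card_0_eq le_Suc_eq le_zero_eq)
  then have z': "z \<in> arcs G" "l z = 0" unfolding zero_edges_def by auto
  have pos: "0 < l e" if "e \<in> arcs G" "e \<noteq> z" for e
  proof -
    have "0 \<le> l e" using nn that by (auto simp: PiE_iff)
    moreover have "e \<notin> zero_edges G l" using z that by simp
    then have "l e \<noteq> 0" using that unfolding zero_edges_def by simp
    ultimately show ?thesis by simp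
  qed
  obtain fv fe fl where iso: "graph_iso theta0 G fv fe fl" and fe: "fe 2 = z"
    using theta_labelling[OF t z'(1)] by blast
  obtain P where P: "P \<in> markings n theta0" "p = (\<lambda>i\<in>{1..n}. graph_map fv fe fl (P i))"
    using graph_map_marking[OF iso p] by blast
  have feb: "bij_betw fe {0, 1, 2} (arcs G)" using iso unfolding graph_iso_def by simp
  then have "fe e \<in> arcs G \<and> fe e \<noteq> z" if "e \<in> {0, 1}" for e
    using that fe unfolding bij_betw_def inj_on_def by auto
  then have "(rose0, \<lambda>e\<in>{0, 1}. l (fe e), \<lambda>i\<in>{1..n}. collapse (P i)) \<in> marked_graphs 2 n"
    using stable_rose0 pos P(1) collapse_gpoints unfolding marked_graphs_def by (auto simp: PiE_iff)
  moreover have "isometry_class 2 n (contract n (G, l, p)) =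
        isometry_class 2 n (rose0, \<lambda>e\<in>{0, 1}. l (fe e), \<lambda>i\<in>{1..n}. collapse (P i))"
    using P fe z by (intro contract_theta_edge[OF t iso]) (auto simp: PiE_iff)
  ultimately show ?thesis using contracted[of z fv fe fl P] t z' pos iso fe P(1) by blast
qed

abbreviation chart :: "nat \<Rightarrow> (nat, nat) pre_digraph \<Rightarrow> ((nat \<Rightarrow> real) \<times> (nat \<Rightarrow> (nat, nat) gpoint)) topology" where
  "chart n G \<equiv> prod_topology (length_space G) (marking_space n G)"

definition contraction_class ::
  "nat \<Rightarrow> (nat, nat) pre_digraph \<Rightarrow> (nat \<Rightarrow> real) \<times> (nat \<Rightarrow> (nat, nat) gpoint) \<Rightarrow> (nat, nat) marked_graph set" where
  "contraction_class n G x = isometry_class 2 n (contract n (G, x))"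

lemma topspace_chart:
  "G \<in> stable_graphs 2 \<Longrightarrow> topspace (chart n G) = topspace (length_space G) \<times> markings n G"
  by (simp add: topspace_marking_space[OF genus_two_wf(1)])

lemma contraction_class_in:
  assumes "G \<in> stable_graphs 2" "x \<in> topspace (chart n G)"
  shows "contraction_class n G x \<in> isometry_class 2 n ` (marked_graphs 2 n :: (nat, nat) marked_graph set)"
proof -
  obtain l p where x: "x = (l, p)" "l \<in> topspace (length_space G)" "p \<in> markings n G"
    using assms unfolding topspace_chart[OF assms(1)] by auto
  show ?thesis
  proof (cases rule: contract_class[OF assms(1) x(2,3)])
    case 1
    show ?thesis unfolding x(1) contraction_class_def 1(3) by (rule imageI) (rule 1(2))
  next
    case (2 z fv fe fl P)
    show ?thesis unfolding x(1) contraction_class_def 2(9) by (rule imageI) (rule 2(8))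
  qed
qed

lemma topspace_TMb: "topspace (TMb 2 n) = isometry_class 2 n ` (marked_graphs 2 n :: (nat, nat) marked_graph set)"
  unfolding TMb_def
proof (rule topspace_quotient_topology, intro image_subsetI)
  fix M assume "M \<in> topspace (sum_topology (\<lambda>G. chart n G) (stable_graphs 2))"
  then obtain G x where "M = (G, x)" "G \<in> stable_graphs 2" "x \<in> topspace (chart n G)" by auto
  then show "isometry_class 2 n (contract n M) \<in> isometry_class 2 n ` (marked_graphs 2 n :: (nat, nat) marked_graph set)"
    using contraction_class_in unfolding contraction_class_def by simp
qed

lemma openin_TMb:
  "openin (TMb 2 n) U \<longleftrightarrow> U \<subseteq> topspace (TMb 2 n)
    \<and> (\<forall>G\<in>stable_graphs 2. openin (chart n G) {x \<in> topspace (chart n G). contraction_class n G x \<in> U})"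
proof -
  have "{x. (G, x) \<in> {x \<in> topspace (sum_topology (\<lambda>G. chart n G) (stable_graphs 2)). isometry_class 2 n (contract n x) \<in> U}}
      = {x \<in> topspace (chart n G). contraction_class n G x \<in> U}" if "G \<in> stable_graphs 2" for G
    using that by (auto simp: contraction_class_def)
  then show ?thesis
    unfolding topspace_TMb unfolding TMb_def openin_quotient_topology openin_sum_topology by auto
qed

lemma closedin_TMb:
  assumes C: "C \<subseteq> topspace (TMb 2 n)"
    and cl: "\<And>G. G \<in> stable_graphs 2 \<Longrightarrow> closedin (chart n G) {x \<in> topspace (chart n G). contraction_class n G x \<in> C}"
  shows "closedin (TMb 2 n) C"
  unfolding closedin_def
proof
  show "openin (TMb 2 n) (topspace (TMb 2 n) - C)"
    unfolding openin_TMb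
  proof (intro conjI ballI)
    fix G :: "(nat, nat) pre_digraph" assume G: "G \<in> stable_graphs 2"
    have "{x \<in> topspace (chart n G). contraction_class n G x \<in> topspace (TMb 2 n) - C}
       = topspace (chart n G) - {x \<in> topspace (chart n G). contraction_class n G x \<in> C}"
      using contraction_class_in[OF G] unfolding topspace_TMb by blast
    then show "openin (chart n G) {x \<in> topspace (chart n G). contraction_class n G x \<in> topspace (TMb 2 n) - C}"
      using cl[OF G] by (simp only: openin_diff openin_topspace)
  qed blast
qed (rule C)

lemma X_space_topspace: "topspace (X_space 2 n) \<subseteq> topspace (TMb 2 n)"
  unfolding X_space_def by simp

lemma class_in_X_space:
  fixes G :: "(nat, nat) pre_digraph"
  assumes M: "(G, l, p) \<in> marked_graphs 2 n"
  shows "isometry_class 2 n (G, l, p) \<in> topspace (X_space 2 n) \<longleftrightarrow> good_lengths G l"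
proof -
  have memb: "(G, l, p) \<in> isometry_class 2 n (G, l, p)"
    using M isometric_refl unfolding isometry_class_def by auto
  have "isometry_class 2 n (G, l, p) \<in> topspace (X_space 2 n) \<longleftrightarrow>
      (\<forall>(G', l', p') \<in> isometry_class 2 n (G, l, p). Max (l' ` arcs G') = 1 \<and> is_forest G' {e \<in> arcs G'. l' e < 1})"
    using M unfolding X_space_def topspace_subtopology topspace_TMb by auto
  also have "\<dots> \<longleftrightarrow> good_lengths G l"
  proof
    assume "\<forall>(G', l', p') \<in> isometry_class 2 n (G, l, p). Max (l' ` arcs G') = 1 \<and> is_forest G' {e \<in> arcs G'. l' e < 1}"
    then have "Max (l ` arcs G) = 1 \<and> is_forest G {e \<in> arcs G. l e < 1}" using memb by fastforce
    then show "good_lengths G l" using good_lengths_iff[of G l] M unfolding marked_graphs_def by auto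
  next
    assume good: "good_lengths G l"
    show "\<forall>(G', l', p') \<in> isometry_class 2 n (G, l, p). Max (l' ` arcs G') = 1 \<and> is_forest G' {e \<in> arcs G'. l' e < 1}"
    proof (intro ballI, clarify)
      fix G' :: "(nat, nat) pre_digraph" and l' p' assume "(G', l', p') \<in> isometry_class 2 n (G, l, p)"
      then have M': "(G', l', p') \<in> marked_graphs 2 n" and iso: "isometric n (G, l, p) (G', l', p')"
        unfolding isometry_class_def by auto
      have st: "G \<in> stable_graphs 2" "G' \<in> stable_graphs 2" "\<And>e. e \<in> arcs G \<Longrightarrow> 0 < l e"
        "\<And>e. e \<in> arcs G' \<Longrightarrow> 0 < l' e" "\<And>i. i \<in> {1..n} \<Longrightarrow> p i \<in> gpoints G"
        using M M' unfolding marked_graphs_def by (auto simp: PiE_iff)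
      obtain fv fe fl where "graph_iso G G' fv fe fl" "\<forall>e\<in>arcs G. l' (fe e) = l e"
        using isometric_graph_iso[OF st iso] by blast
      then have "good_lengths G' l'" using good good_lengths_graph_iso[of G G' fv fe fl l' l] by blast
      then show "Max (l' ` arcs G') = 1 \<and> is_forest G' {e \<in> arcs G'. l' e < 1}"
        using good_lengths_iff[OF st(2)] by simp
    qed
  qed
  finally show ?thesis .
qed

text \<open>The cylinder parameter becomes the length of the edge \<open>z\<close>. For a rose the map is used
  with the parameter 1 only.\<close>

definition theta_chart ::
  "nat \<Rightarrow> (nat, nat) pre_digraph \<Rightarrow> nat \<Rightarrow> ((nat, nat) gpoint \<Rightarrow> (nat, nat) gpoint) \<Rightarrow>
    real \<times> (nat \<Rightarrow> (nat, nat) gpoint) \<Rightarrow> (nat \<Rightarrow> real) \<times> (nat \<Rightarrow> (nat, nat) gpoint)" where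
  "theta_chart n G z h x = ((\<lambda>e\<in>arcs G. if e = z then fst x else 1), (\<lambda>i\<in>{1..n}. h (snd x i)))"

lemma restrict_marking:
  "P \<in> markings n G \<Longrightarrow> f ` gpoints G \<subseteq> gpoints G' \<Longrightarrow> (\<lambda>i\<in>{1..n}. f (P i)) \<in> markings n G'"
  by (auto simp: PiE_iff image_subset_iff)

lemma graph_map_gpoints: "graph_iso G G' fv fe fl \<Longrightarrow> graph_map fv fe fl ` gpoints G \<subseteq> gpoints G'"
  using graph_map_bij unfolding bij_betw_def by blast

lemma collapse_image: "collapse ` gpoints theta0 \<subseteq> gpoints rose0"
  using collapse_gpoints by blast

lemma contraction_class_theta_chart:
  assumes G: "is_theta G" and iso: "graph_iso theta0 G fv fe fl" and z: "fe 2 = z"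
    and a: "a \<in> {0..1}" and P: "P \<in> markings n theta0"
  shows "contraction_class n G (theta_chart n G z (graph_map fv fe fl) (a, P)) = point_class n a P"
proof -
  have fe: "bij_betw fe {0, 1, 2} (arcs G)" using iso unfolding graph_iso_def by simp
  have feG: "fe 0 \<in> arcs G" "fe 1 \<in> arcs G" "z \<in> arcs G" "fe 0 \<noteq> z" "fe 1 \<noteq> z"
    using fe z unfolding bij_betw_def inj_on_def by auto
  let ?l = "\<lambda>e\<in>arcs G. if e = z then a else 1"
  let ?p = "\<lambda>i\<in>{1..n}. graph_map fv fe fl (P i)"
  have tc: "theta_chart n G z (graph_map fv fe fl) (a, P) = (?l, ?p)"
    by (simp only: theta_chart_def fst_conv snd_conv)
  have Pi: "P i \<in> gpoints theta0" if "i \<in> {1..n}" for i using P that by (rule PiE_mem)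
  have pi: "?p i \<in> gpoints G" if "i \<in> {1..n}" for i
    using graph_map_gpoints[OF iso] Pi[OF that] that by auto
  show ?thesis
  proof (cases "a = 0")
    case True
    then have ze: "zero_edges G ?l = {fe 2}" unfolding zero_edges_def using feG z by auto
    have "(\<lambda>e\<in>{0, 1}. ?l (fe e)) = (\<lambda>e\<in>{0, 1}. 1)" using feG by (intro restrict_ext) auto
    moreover have "isometry_class 2 n (contract n (G, ?l, ?p))
        = isometry_class 2 n (rose0, \<lambda>e\<in>{0, 1}. ?l (fe e), \<lambda>i\<in>{1..n}. collapse (P i))"
      using Pi by (intro contract_theta_edge[OF G iso ze]) auto
    ultimately show ?thesis
      using True unfolding contraction_class_def tc point_class_def model_def by simp
  next
    case False
    then have ze: "zero_edges G ?l = {}" unfolding zero_edges_def by auto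
    have "isometry_class 2 n (contract n (G, ?l, ?p)) = isometry_class 2 n (G, ?l, ?p)"
      using pi by (intro contract_no_zero genus_two_wf(1)[OF theta_stable[OF G]] ze)
    also have "\<dots> = isometry_class 2 n (theta0, edge_lengths a, P)"
      using feG z Pi by (intro graph_iso_restrict_isometric[OF iso wf_theta0, symmetric]) (auto simp: edge_lengths_def)
    finally show ?thesis
      using False unfolding contraction_class_def tc point_class_def model_def by simp
  qed
qed

lemma contraction_class_rose_chart:
  assumes G: "is_rose G" and iso: "graph_iso rose0 G fv fe fl" and P: "P \<in> markings n theta0"
  shows "contraction_class n G (theta_chart n G z (graph_map fv fe fl \<circ> collapse) (1, P)) = point_class n 0 P"
proof -
  have fe: "bij_betw fe {0, 1} (arcs G)" using iso unfolding graph_iso_def by simp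
  then have feG: "fe 0 \<in> arcs G" "fe 1 \<in> arcs G" unfolding bij_betw_def by auto
  let ?l = "\<lambda>e\<in>arcs G. 1 :: real"
  let ?p = "\<lambda>i\<in>{1..n}. graph_map fv fe fl (collapse (P i))"
  have Pi: "collapse (P i) \<in> gpoints rose0" if "i \<in> {1..n}" for i
    using PiE_mem[OF P that] by (rule collapse_gpoints)
  have pi: "?p i \<in> gpoints G" if "i \<in> {1..n}" for i
    using graph_map_gpoints[OF iso] Pi[OF that] that by auto
  have ze: "zero_edges G ?l = {}" unfolding zero_edges_def by auto
  have "isometry_class 2 n (contract n (G, ?l, ?p)) = isometry_class 2 n (G, ?l, ?p)"
    using pi by (intro contract_no_zero genus_two_wf(1)[OF rose_stable[OF G]] ze)
  also have "\<dots> = isometry_class 2 n (rose0, \<lambda>e\<in>{0, 1}. 1, \<lambda>i\<in>{1..n}. collapse (P i))"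
    using feG Pi by (intro graph_iso_restrict_isometric[OF iso wf_rose0, symmetric]) auto
  finally have *: "isometry_class 2 n (contract n (G, ?l, ?p))
      = isometry_class 2 n (rose0, \<lambda>e\<in>{0, 1}. 1, \<lambda>i\<in>{1..n}. collapse (P i))" .
  have "theta_chart n G z (graph_map fv fe fl \<circ> collapse) (1, P) = (?l, ?p)"
    by (simp only: theta_chart_def fst_conv snd_conv o_def if_cancel)
  then show ?thesis
    using * unfolding contraction_class_def point_class_def model_def by simp
qed

lemma continuous_map_marking:
  assumes f: "continuous_map (realization G) (realization G') f"
  shows "continuous_map (marking_space n G) (marking_space n G') (\<lambda>P. \<lambda>i\<in>{1..n}. f (P i))"
  unfolding marking_space_def continuous_map_componentwise
proof (intro conjI ballI)
  fix i assume i: "i \<in> {1..n}"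
  have "continuous_map (product_topology (\<lambda>_. realization G) {1..n}) (realization G') (\<lambda>P. f (P i))"
    using continuous_map_compose[OF continuous_map_product_projection[OF i, of "\<lambda>_. realization G"] f]
    by (simp add: o_def)
  then show "continuous_map (product_topology (\<lambda>_. realization G) {1..n}) (realization G')
      (\<lambda>P. (\<lambda>i\<in>{1..n}. f (P i)) i)"
    using i by simp
qed auto

lemma continuous_map_graph_map:
  assumes iso: "graph_iso G G' fv fe fl" and wf: "wf_digraph G" "wf_digraph G'"
  shows "continuous_map (realization G) (realization G') (graph_map fv fe fl)"
proof (rule continuous_map_from_realization[OF wf(1)])
  show "graph_map fv fe fl \<in> gpoints G \<rightarrow> topspace (realization G')"
    unfolding topspace_realization[OF wf(2)] using graph_map_gpoints[OF iso] by auto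
  fix e assume e: "e \<in> arcs G"
  then have e': "fe e \<in> arcs G'" using iso unfolding graph_iso_def bij_betw_def by auto
  have "continuous_map (top_of_set {0..1::real}) (top_of_set {0..1}) (\<lambda>s. if fl e then 1 - s else s)"
    by (cases "fl e") (auto simp: continuous_map_in_subtopology intro!: continuous_intros)
  from continuous_map_compose[OF this continuous_map_edge_point[OF wf(2) e']]
  show "continuous_map (top_of_set {0..1}) (realization G') (\<lambda>s. graph_map fv fe fl (edge_point G e s))"
    unfolding graph_map_edge_point[OF iso e] by (simp add: o_def)
qed

lemma continuous_map_collapse: "continuous_map (realization theta0) (realization rose0) collapse"
proof (rule continuous_map_from_realization[OF wf_theta0])
  show "collapse \<in> gpoints theta0 \<rightarrow> topspace (realization rose0)"
    unfolding topspace_realization[OF wf_rose0] using collapse_gpoints by auto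
  fix e assume e: "e \<in> arcs theta0"
  show "continuous_map (top_of_set {0..1}) (realization rose0) (\<lambda>s. collapse (edge_point theta0 e s))"
  proof (cases "e = 2")
    case True
    then have "(\<lambda>s. collapse (edge_point theta0 e s)) = (\<lambda>_. Vertex 0)" by (auto simp: edge_point_def)
    then show ?thesis by (simp add: topspace_realization[OF wf_rose0] gpoints_def)
  next
    case False
    then have "(\<lambda>s. collapse (edge_point theta0 e s)) = edge_point rose0 e" by (auto simp: edge_point_def)
    then show ?thesis using continuous_map_edge_point[OF wf_rose0, of e] e False by auto
  qed
qed

lemma good_length_space:
  assumes G: "G \<in> stable_graphs 2" and z: "a \<in> {0..1}" "is_theta G \<or> a = 1"
  shows "(\<lambda>e\<in>arcs G. if e = z then a else 1) \<in> topspace (length_space G)"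
proof -
  let ?l = "\<lambda>e\<in>arcs G. if e = z then a else 1"
  have sub: "zero_edges G ?l \<subseteq> arcs G" unfolding zero_edges_def by auto
  have "is_forest G (zero_edges G ?l)"
    using stable_genus_two[OF G]
  proof
    assume t: "is_theta G"
    have "zero_edges G ?l \<subseteq> {z}" unfolding zero_edges_def by auto
    then have "card (zero_edges G ?l) \<le> card {z}" by (intro card_mono) auto
    then show ?thesis using is_forest_theta[OF t sub] by simp
  next
    assume r: "is_rose G"
    then have "a = 1" using z(2) unfolding is_theta_def is_rose_def by auto
    then have "zero_edges G ?l = {}" unfolding zero_edges_def by auto
    then show ?thesis using is_forest_rose[OF r sub] by simp
  qed
  then show ?thesis unfolding length_space_topspace using z(1) by (auto simp: PiE_iff)
qed

lemma continuous_map_theta_chart: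
  assumes G: "G \<in> stable_graphs 2" and S: "S \<subseteq> topspace (cylinder n)" "is_theta G \<or> fst ` S \<subseteq> {1}"
    and f: "continuous_map (realization theta0) (realization G) f"
  shows "continuous_map (subtopology (cylinder n) S) (chart n G) (theta_chart n G z f)"
  unfolding continuous_map_pairwise
proof
  have fst: "continuous_map (subtopology (cylinder n) S) euclideanreal fst"
    unfolding cylinder_def
    by (intro continuous_map_from_subtopology) (meson continuous_map_fst continuous_map_into_fulltopology)
  have snd: "continuous_map (subtopology (cylinder n) S) (marking_space n theta0) snd"
    unfolding cylinder_def by (intro continuous_map_from_subtopology continuous_map_snd)
  have "fst \<circ> theta_chart n G z f = (\<lambda>x. \<lambda>e\<in>arcs G. if e = z then fst x else 1)"
    by (auto simp: theta_chart_def)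
  moreover have "continuous_map (subtopology (cylinder n) S) (length_space G) (\<lambda>x. \<lambda>e\<in>arcs G. if e = z then fst x else 1)"
    unfolding length_space_def continuous_map_in_subtopology continuous_map_componentwise
  proof (intro conjI ballI)
    show "(\<lambda>x. \<lambda>e\<in>arcs G. if e = z then fst x else 1) \<in> topspace (subtopology (cylinder n) S)
        \<rightarrow> {l \<in> arcs G \<rightarrow>\<^sub>E {0..}. is_forest G (zero_edges G l)}"
    proof
      fix x assume x: "x \<in> topspace (subtopology (cylinder n) S)"
      then have "x \<in> S" "fst x \<in> {0..1}" unfolding topspace_subtopology topspace_cylinder by auto
      then show "(\<lambda>e\<in>arcs G. if e = z then fst x else 1) \<in> {l \<in> arcs G \<rightarrow>\<^sub>E {0..}. is_forest G (zero_edges G l)}"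
        using good_length_space[OF G, of "fst x" z] S(2) unfolding length_space_topspace by auto
    qed
    fix e assume "e \<in> arcs G"
    then show "continuous_map (subtopology (cylinder n) S) euclideanreal (\<lambda>x. (\<lambda>e\<in>arcs G. if e = z then fst x else 1) e)"
      using fst by (cases "e = z") auto
  qed auto
  ultimately show "continuous_map (subtopology (cylinder n) S) (length_space G) (fst \<circ> theta_chart n G z f)"
    by simp
  have "snd \<circ> theta_chart n G z f = (\<lambda>P. \<lambda>i\<in>{1..n}. f (P i)) \<circ> snd"
    by (auto simp: theta_chart_def)
  then show "continuous_map (subtopology (cylinder n) S) (marking_space n G) (snd \<circ> theta_chart n G z f)"
    using continuous_map_compose[OF snd continuous_map_marking[OF f]] by simp
qed

lemma Hausdorff_chart:
  assumes "G \<in> stable_graphs 2" shows "Hausdorff_space (chart n G)"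
  unfolding Hausdorff_space_prod_topology length_space_def
  using Hausdorff_marking_space[OF genus_two_wf(1)[OF assms]]
  by (simp add: Hausdorff_space_subtopology Hausdorff_space_product_topology)

lemma closedin_image_cylinder:
  assumes E: "closedin (cylinder n) E" and Y: "Hausdorff_space Y"
    and f: "continuous_map (subtopology (cylinder n) E) Y f"
  shows "closedin Y (f ` E)"
proof -
  have "compactin (cylinder n) E" using E compact_cylinder closedin_compact_space by blast
  then have "compactin (subtopology (cylinder n) E) E" by (simp add: compactin_subtopology)
  then show ?thesis using image_compactin[OF _ f] compactin_imp_closedin[OF Y] by blast
qed

lemma point_class_in_X_space:
  assumes "a \<in> {0..1}" "P \<in> markings n theta0"
  shows "point_class n a P \<in> topspace (X_space 2 n)"
proof -
  obtain G l p where M: "model n a P = (G, l, p)" by (cases "model n a P")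
  have "good_lengths G l"
  proof (cases "a = 0")
    case True
    then have "G = rose0" "l = (\<lambda>e\<in>{0, 1}. 1)" using M unfolding model_def by auto
    then show ?thesis unfolding good_lengths_def by simp
  next
    case False
    then have Gl: "G = theta0" "l = edge_lengths a" using M unfolding model_def by auto
    have "card {e \<in> arcs theta0. edge_lengths a e < 1} \<le> card {2::nat}"
      by (intro card_mono) (auto simp: edge_lengths_def split: if_splits)
    moreover have "edge_lengths a ` {0, 1, 2} = {1, a}" by (auto simp: edge_lengths_def)
    ultimately show ?thesis using assms(1) unfolding good_lengths_def Gl by simp
  qed
  then show ?thesis
    using class_in_X_space[of G l p n] model_marked[OF assms] unfolding M point_class_def by simp
qed

lemma chart_over_X_space_theta:
  assumes G: "is_theta G" and x: "x \<in> topspace (chart n G)" "contraction_class n G x \<in> topspace (X_space 2 n)"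
  shows "\<exists>z\<in>arcs G. fst x z \<in> {0..1} \<and> (\<forall>e\<in>arcs G. e \<noteq> z \<longrightarrow> fst x e = 1)"
proof -
  have st: "G \<in> stable_graphs 2" by (rule theta_stable[OF G])
  obtain l p where lp: "x = (l, p)" "l \<in> topspace (length_space G)" "p \<in> markings n G"
    using x unfolding topspace_chart[OF st] by auto
  show ?thesis
  proof (cases rule: contract_class[OF st lp(2,3)])
    case 1
    have "good_lengths G l"
      using x(2) class_in_X_space[OF 1(2)] 1(3) unfolding lp(1) contraction_class_def by simp
    then have max: "Max (l ` arcs G) = 1" and c: "card {e \<in> arcs G. l e < 1} \<le> 1"
      using G unfolding good_lengths_def is_theta_def by auto
    have fin: "finite (arcs G)" by (rule theta_finite[OF G])
    then have le: "l e \<le> 1" if "e \<in> arcs G" for e using max that by (metis Max_ge finite_imageI imageI)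
    have ne: "arcs G \<noteq> {}" using G unfolding is_theta_def by auto
    obtain z where z: "z \<in> arcs G" "{e \<in> arcs G. l e < 1} \<subseteq> {z}"
    proof (cases "{e \<in> arcs G. l e < 1} = {}")
      case True
      then show ?thesis using that ne by blast
    next
      case False
      then obtain z where "z \<in> {e \<in> arcs G. l e < 1}" by blast
      moreover have "e = z" if "e \<in> {e \<in> arcs G. l e < 1}" for e
        using c that calculation fin card_le_Suc0_iff_eq[of "{e \<in> arcs G. l e < 1}"] by auto
      ultimately show ?thesis using that by blast
    qed
    have "l e = 1" if "e \<in> arcs G" "e \<noteq> z" for e
    proof -
      have "\<not> l e < 1" using z(2) that by blast
      then show ?thesis using le[OF that(1)] by simp
    qed
    then show ?thesis using z(1) le[OF z(1)] 1(1)[OF z(1)] unfolding lp(1) by (intro bexI[of _ z]) auto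
  next
    case (2 z fv fe fl P)
    have "good_lengths rose0 (\<lambda>e\<in>{0, 1}. l (fe e))"
      using x(2) class_in_X_space[OF 2(8)] 2(9) unfolding lp(1) contraction_class_def by simp
    then have max: "Max ((\<lambda>e\<in>{0, 1}. l (fe e)) ` {0, 1}) = 1"
      and c: "card {e \<in> {0, 1}. (\<lambda>e\<in>{0, 1}. l (fe e)) e < 1} = 0"
      unfolding good_lengths_def by auto
    have one: "l (fe e) = 1" if e: "e \<in> {0, 1}" for e
    proof -
      have "(\<lambda>e\<in>{0, 1}. l (fe e)) e \<le> 1" unfolding max[symmetric] using e by (intro Max_ge) auto
      moreover have "{e \<in> {0, 1}. (\<lambda>e\<in>{0, 1}. l (fe e)) e < 1} = {}"
        using c by (subst (asm) card_0_eq) auto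
      then have "\<not> (\<lambda>e\<in>{0, 1}. l (fe e)) e < 1" using e by blast
      ultimately show ?thesis using e by simp
    qed
    have "bij_betw fe {0, 1, 2} (arcs G)" using 2(5) unfolding graph_iso_def by simp
    then have "e = fe 0 \<or> e = fe 1" if "e \<in> arcs G" "e \<noteq> z" for e
      using that 2(6) unfolding bij_betw_def by auto
    then have "l e = 1" if "e \<in> arcs G" "e \<noteq> z" for e using that one by blast
    then show ?thesis using 2(2,3) unfolding lp(1) by (intro bexI[of _ z]) auto
  qed
qed

lemma chart_over_X_space_rose:
  assumes G: "is_rose G" and x: "x \<in> topspace (chart n G)" "contraction_class n G x \<in> topspace (X_space 2 n)"
    and e: "e \<in> arcs G"
  shows "fst x e = 1"
proof -
  have st: "G \<in> stable_graphs 2" by (rule rose_stable[OF G])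
  obtain l p where lp: "x = (l, p)" "l \<in> topspace (length_space G)" "p \<in> markings n G"
    using x unfolding topspace_chart[OF st] by auto
  show ?thesis
  proof (cases rule: contract_class[OF st lp(2,3)])
    case 1
    have "good_lengths G l"
      using x(2) class_in_X_space[OF 1(2)] 1(3) unfolding lp(1) contraction_class_def by simp
    then have max: "Max (l ` arcs G) = 1" and c: "card {e \<in> arcs G. l e < 1} = 0"
      using G unfolding good_lengths_def is_rose_def by auto
    have fin: "finite (arcs G)" by (rule rose_finite[OF G])
    then have "l e \<le> 1" using max e by (metis Max_ge finite_imageI imageI)
    moreover have "\<not> l e < 1" using c fin e by auto
    ultimately show ?thesis unfolding lp(1) by simp
  next
    case (2 z fv fe fl P)
    then show ?thesis using G unfolding is_theta_def is_rose_def by auto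
  qed
qed

definition cylinder_class :: "nat \<Rightarrow> real \<times> (nat \<Rightarrow> (nat, nat) gpoint) \<Rightarrow> (nat, nat) marked_graph set" where
  "cylinder_class n x = point_class n (fst x) (snd x)"

lemma cylinder_class_continuous: "continuous_map (cylinder n) (X_space 2 n) (cylinder_class n)"
proof -
  have iso: "graph_iso theta0 theta0 (\<lambda>v. v) (\<lambda>e. e) (\<lambda>_. False)"
    unfolding graph_iso_def by (auto simp: bij_betw_def)
  let ?h = "theta_chart n theta0 2 (graph_map (\<lambda>v. v) (\<lambda>e. e) (\<lambda>_. False))"
  have "continuous_map (subtopology (cylinder n) (topspace (cylinder n))) (chart n theta0) ?h"
    using is_theta_theta0 by (intro continuous_map_theta_chart stable_theta0 continuous_map_graph_map[OF iso] wf_theta0) auto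
  then have h: "continuous_map (cylinder n) (chart n theta0) ?h" by simp
  have q: "contraction_class n theta0 (?h x) = cylinder_class n x" if "x \<in> topspace (cylinder n)" for x
    using contraction_class_theta_chart[OF is_theta_theta0 iso refl, of "fst x" "snd x" n] that
    unfolding topspace_cylinder cylinder_class_def by auto
  have im: "cylinder_class n x \<in> topspace (X_space 2 n)" if "x \<in> topspace (cylinder n)" for x
    using that point_class_in_X_space unfolding topspace_cylinder cylinder_class_def by auto
  have hin: "?h x \<in> topspace (chart n theta0)" if "x \<in> topspace (cylinder n)" for x
    using continuous_map_image_subset_topspace[OF h] imageI[OF that] by (rule subsetD)
  have "continuous_map (cylinder n) (TMb 2 n) (cylinder_class n)"
    unfolding continuous_map_def
  proof (intro conjI allI impI)
    show "cylinder_class n \<in> topspace (cylinder n) \<rightarrow> topspace (TMb 2 n)"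
      using im X_space_topspace by auto
    fix U assume "openin (TMb 2 n) U"
    then have "openin (chart n theta0) {x \<in> topspace (chart n theta0). contraction_class n theta0 x \<in> U}"
      using stable_theta0 unfolding openin_TMb by blast
    from openin_continuous_map_preimage[OF h this]
    have "openin (cylinder n) {x \<in> topspace (cylinder n).
        ?h x \<in> {x \<in> topspace (chart n theta0). contraction_class n theta0 x \<in> U}}" .
    moreover have "{x \<in> topspace (cylinder n). ?h x \<in> {x \<in> topspace (chart n theta0). contraction_class n theta0 x \<in> U}}
        = {x \<in> topspace (cylinder n). cylinder_class n x \<in> U}"
      by (rule Collect_cong, rule conj_cong[OF refl]) (simp only: mem_Collect_eq q hin simp_thms)
    ultimately show "openin (cylinder n) {x \<in> topspace (cylinder n). cylinder_class n x \<in> U}" by simp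
  qed
  then show ?thesis
    using im unfolding X_space_def by (auto simp: continuous_map_in_subtopology)
qed

lemma continuous_map_cylinder_marking:
  assumes "continuous_map (realization theta0) (realization G) f"
  shows "continuous_map (cylinder n) (marking_space n G) (\<lambda>x. \<lambda>i\<in>{1..n}. f (snd x i))"
  using continuous_map_compose[OF continuous_map_snd continuous_map_marking[OF assms, of n], of "top_of_set {0..1}"]
  unfolding cylinder_def by (simp add: o_def)

lemma continuous_map_cylinder_fst: "continuous_map (cylinder n) euclideanreal fst"
  unfolding cylinder_def by (meson continuous_map_fst continuous_map_into_fulltopology)

lemma closedin_cylinder_level: "closedin (cylinder n) {x \<in> topspace (cylinder n). fst x = a}"
  using closedin_continuous_map_preimage[OF continuous_map_cylinder_fst, of "{a}"] by simp

text \<open>Closedness in the quotient topology is tested in the charts, where the preimage of a set of classes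
  consists of finitely many images of parts of the cylinder: one for every choice of the short edge of
  a theta graph, and one for a rose.\<close>

lemma chart_preimage_theta:
  assumes G: "is_theta G" and C: "C \<subseteq> topspace (X_space 2 n)"
    and D: "D = {x \<in> topspace (cylinder n). cylinder_class n x \<in> C}"
    and lab: "\<And>z. z \<in> arcs G \<Longrightarrow> graph_iso theta0 G (fv z) (fe z) (fl z) \<and> fe z 2 = z"
  shows "{x \<in> topspace (chart n G). contraction_class n G x \<in> C}
    = (\<Union>z\<in>arcs G. theta_chart n G z (graph_map (fv z) (fe z) (fl z)) ` D)"
proof (intro equalityI subsetI)
  have st: "G \<in> stable_graphs 2" by (rule theta_stable[OF G])
  fix x assume "x \<in> {x \<in> topspace (chart n G). contraction_class n G x \<in> C}"
  then have x: "x \<in> topspace (chart n G)" "contraction_class n G x \<in> C" by auto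
  then obtain z where z: "z \<in> arcs G" "fst x z \<in> {0..1}" "\<forall>e\<in>arcs G. e \<noteq> z \<longrightarrow> fst x e = 1"
    using chart_over_X_space_theta[OF G x(1)] C by blast
  have iso: "graph_iso theta0 G (fv z) (fe z) (fl z)" "fe z 2 = z" using lab[OF z(1)] by auto
  have l: "fst x \<in> topspace (length_space G)" and p: "snd x \<in> markings n G"
    using x(1) unfolding topspace_chart[OF st] by auto
  obtain P where P: "P \<in> markings n theta0" "snd x = (\<lambda>i\<in>{1..n}. graph_map (fv z) (fe z) (fl z) (P i))"
    using graph_map_marking[OF iso(1) p] by blast
  have "fst x = (\<lambda>e\<in>arcs G. if e = z then fst x z else 1)"
    using l z(3) unfolding length_space_topspace by (auto simp: PiE_iff extensional_def)
  then have xe: "x = theta_chart n G z (graph_map (fv z) (fe z) (fl z)) (fst x z, P)"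
    using P(2) by (intro prod_eqI) (simp_all only: theta_chart_def fst_conv snd_conv)
  then have "point_class n (fst x z) P \<in> C"
    using contraction_class_theta_chart[OF G iso z(2) P(1)] x(2) by simp
  then have "(fst x z, P) \<in> D"
    using z(2) P(1) unfolding D topspace_cylinder cylinder_class_def by auto
  then show "x \<in> (\<Union>z\<in>arcs G. theta_chart n G z (graph_map (fv z) (fe z) (fl z)) ` D)"
    using xe z(1) by blast
next
  have st: "G \<in> stable_graphs 2" by (rule theta_stable[OF G])
  fix x assume "x \<in> (\<Union>z\<in>arcs G. theta_chart n G z (graph_map (fv z) (fe z) (fl z)) ` D)"
  then obtain z y where z: "z \<in> arcs G" and y: "y \<in> D" and x: "x = theta_chart n G z (graph_map (fv z) (fe z) (fl z)) y"
    by blast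
  have iso: "graph_iso theta0 G (fv z) (fe z) (fl z)" "fe z 2 = z" using lab[OF z] by auto
  have yy: "fst y \<in> {0..1}" "snd y \<in> markings n theta0" "cylinder_class n y \<in> C" "y \<in> topspace (cylinder n)"
    using y unfolding D topspace_cylinder by auto
  have "continuous_map (subtopology (cylinder n) (topspace (cylinder n))) (chart n G) (theta_chart n G z (graph_map (fv z) (fe z) (fl z)))"
    using G genus_two_wf(1)[OF st] by (intro continuous_map_theta_chart st continuous_map_graph_map[OF iso(1)] wf_theta0) auto
  then have "x \<in> topspace (chart n G)"
    unfolding x using yy(4) continuous_map_image_subset_topspace by fastforce
  moreover have "contraction_class n G x = cylinder_class n y"
    using contraction_class_theta_chart[OF G iso yy(1,2)] unfolding x cylinder_class_def by simp
  ultimately show "x \<in> {x \<in> topspace (chart n G). contraction_class n G x \<in> C}" using yy(3) by simp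
qed

lemma chart_preimage_rose:
  assumes G: "is_rose G" and C: "C \<subseteq> topspace (X_space 2 n)"
    and D: "D = {x \<in> topspace (cylinder n). fst x = 0 \<and> cylinder_class n x \<in> C}"
    and iso: "graph_iso rose0 G fv fe fl"
  shows "{x \<in> topspace (chart n G). contraction_class n G x \<in> C}
    = (\<lambda>y. (\<lambda>e\<in>arcs G. 1, \<lambda>i\<in>{1..n}. graph_map fv fe fl (collapse (snd y i)))) ` D"
proof -
  have st: "G \<in> stable_graphs 2" by (rule rose_stable[OF G])
  define h where "h = (\<lambda>y :: real \<times> (nat \<Rightarrow> (nat, nat) gpoint). (\<lambda>e\<in>arcs G. 1 :: real, \<lambda>i\<in>{1..n}. graph_map fv fe fl (collapse (snd y i))))"
  have hc: "h y = theta_chart n G z (graph_map fv fe fl \<circ> collapse) (1, snd y)" for y z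
    by (simp only: h_def theta_chart_def fst_conv snd_conv o_def if_cancel)
  have one: "(\<lambda>e\<in>arcs G. 1) \<in> topspace (length_space G)"
    using good_length_space[OF st, of 1] by (auto simp: restrict_def)
  have cls: "contraction_class n G (h y) = point_class n 0 (snd y)" if "snd y \<in> markings n theta0" for y
    unfolding hc[of y 0] by (rule contraction_class_rose_chart[OF G iso that])
  have "{x \<in> topspace (chart n G). contraction_class n G x \<in> C} = h ` D"
  proof (intro equalityI subsetI)
    fix x assume "x \<in> {x \<in> topspace (chart n G). contraction_class n G x \<in> C}"
    then have x: "x \<in> topspace (chart n G)" "contraction_class n G x \<in> C" by auto
    have l: "fst x \<in> topspace (length_space G)" and p: "snd x \<in> markings n G"
      using x(1) unfolding topspace_chart[OF st] by auto
    have "fst x e = 1" if "e \<in> arcs G" for e using chart_over_X_space_rose[OF G x(1) _ that] x(2) C by blast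
    then have fx: "fst x = (\<lambda>e\<in>arcs G. 1)"
      using l unfolding length_space_topspace by (auto simp: PiE_iff extensional_def)
    obtain P where P: "P \<in> markings n rose0" "snd x = (\<lambda>i\<in>{1..n}. graph_map fv fe fl (P i))"
      using graph_map_marking[OF iso p] by blast
    have "\<exists>y. y \<in> gpoints theta0 \<and> P i = collapse y" if "i \<in> {1..n}" for i
      using PiE_mem[OF P(1) that]
    proof (cases rule: gpoints_cases)
      case (1 v)
      then show ?thesis by (intro exI[of _ "Vertex 0"]) (auto simp: gpoints_def)
    next
      case (2 e s)
      then show ?thesis by (intro exI[of _ "Interior e s"]) (auto simp: gpoints_def)
    qed
    then obtain y where y: "\<And>i. i \<in> {1..n} \<Longrightarrow> y i \<in> gpoints theta0 \<and> P i = collapse (y i)" by metis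
    let ?y = "(0 :: real, restrict y {1..n})"
    have ym: "snd ?y \<in> markings n theta0" using y by auto
    have hx: "x = h ?y"
      unfolding h_def using fx P(2) y by (cases x) (auto simp: restrict_def)
    then have "cylinder_class n ?y \<in> C" using cls[OF ym] x(2) unfolding cylinder_class_def by simp
    then have "?y \<in> D" using ym unfolding D topspace_cylinder by auto
    then show "x \<in> h ` D" using hx by blast
  next
    fix x assume "x \<in> h ` D"
    then obtain y where y: "y \<in> D" "x = h y" by blast
    then have yy: "fst y = 0" "snd y \<in> markings n theta0" "cylinder_class n y \<in> C"
      unfolding D topspace_cylinder by auto
    have "(\<lambda>i\<in>{1..n}. graph_map fv fe fl (collapse (snd y i))) \<in> markings n G"
      using collapse_image graph_map_gpoints[OF iso]
      by (intro restrict_marking[where f="\<lambda>x. graph_map fv fe fl (collapse x)", OF yy(2)]) auto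
    then have "x \<in> topspace (chart n G)" using one unfolding y(2) h_def topspace_chart[OF st] by simp
    then show "x \<in> {x \<in> topspace (chart n G). contraction_class n G x \<in> C}"
      using cls[OF yy(2)] yy unfolding y(2) cylinder_class_def by simp
  qed
  then show ?thesis unfolding h_def .
qed

text \<open>The images in a chart are closed because closed parts of the cylinder are compact and the chart is
  Hausdorff.\<close>

lemma closedin_X_space:
  assumes C: "C \<subseteq> topspace (X_space 2 n)"
    and D: "closedin (cylinder n) {x \<in> topspace (cylinder n). cylinder_class n x \<in> C}"
  shows "closedin (X_space 2 n) C"
proof -
  let ?D = "{x \<in> topspace (cylinder n). cylinder_class n x \<in> C}"
  have "closedin (TMb 2 n) C"
  proof (rule closedin_TMb)
    show "C \<subseteq> topspace (TMb 2 n)" using C X_space_topspace by blast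
    fix G :: "(nat, nat) pre_digraph" assume G: "G \<in> stable_graphs 2"
    have wf: "wf_digraph G" using genus_two_wf(1)[OF G] .
    from stable_genus_two[OF G]
    show "closedin (chart n G) {x \<in> topspace (chart n G). contraction_class n G x \<in> C}"
    proof
      assume t: "is_theta G"
      have "\<forall>z\<in>arcs G. \<exists>fv fe fl. graph_iso theta0 G fv fe fl \<and> fe 2 = z" using theta_labelling[OF t] by blast
      then obtain fv fe fl where lab: "\<And>z. z \<in> arcs G \<Longrightarrow> graph_iso theta0 G (fv z) (fe z) (fl z) \<and> fe z 2 = z" by metis
      have "closedin (chart n G) (theta_chart n G z (graph_map (fv z) (fe z) (fl z)) ` ?D)" if z: "z \<in> arcs G" for z
        using t lab[OF z] by (intro closedin_image_cylinder[OF D Hausdorff_chart[OF G]] continuous_map_theta_chart[OF G]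
            continuous_map_graph_map wf wf_theta0) auto
      then have "closedin (chart n G) (\<Union>z\<in>arcs G. theta_chart n G z (graph_map (fv z) (fe z) (fl z)) ` ?D)"
        using theta_finite[OF t] by (intro closedin_Union) auto
      then show ?thesis using chart_preimage_theta[OF t C refl lab] by simp
    next
      assume r: "is_rose G"
      obtain fv fe fl where iso: "graph_iso rose0 G fv fe fl" using rose_labelling[OF r] by blast
      let ?E = "{x \<in> topspace (cylinder n). fst x = 0 \<and> cylinder_class n x \<in> C}"
      have "?E = ?D \<inter> {x \<in> topspace (cylinder n). fst x = 0}" by auto
      then have E: "closedin (cylinder n) ?E"
        using closedin_Int[OF D closedin_cylinder_level[of n 0]] by simp
      have f: "continuous_map (realization theta0) (realization G) (graph_map fv fe fl \<circ> collapse)"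
        by (rule continuous_map_compose[OF continuous_map_collapse continuous_map_graph_map[OF iso wf_rose0 wf]])
      have one: "(\<lambda>e\<in>arcs G. 1) \<in> topspace (length_space G)"
        using good_length_space[OF G, of 1] by (auto simp: restrict_def)
      have "continuous_map (cylinder n) (chart n G)
          (\<lambda>y. (\<lambda>e\<in>arcs G. 1, \<lambda>i\<in>{1..n}. graph_map fv fe fl (collapse (snd y i))))"
        using one continuous_map_cylinder_marking[OF f, of n] by (simp add: continuous_map_pairwise o_def)
      then have "closedin (chart n G) ((\<lambda>y. (\<lambda>e\<in>arcs G. 1, \<lambda>i\<in>{1..n}. graph_map fv fe fl (collapse (snd y i)))) ` ?E)"
        by (intro closedin_image_cylinder[OF E Hausdorff_chart[OF G]] continuous_map_from_subtopology)
      then show ?thesis using chart_preimage_rose[OF r C refl iso] by simp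
    qed
  qed
  then show ?thesis
    using C unfolding X_space_def by (intro closedin_subset_topspace) auto
qed

lemma cylinder_class_surj: "cylinder_class n ` topspace (cylinder n) = topspace (X_space 2 n)"
proof (intro equalityI subsetI)
  fix c assume "c \<in> cylinder_class n ` topspace (cylinder n)"
  then show "c \<in> topspace (X_space 2 n)"
    using continuous_map_image_subset_topspace[OF cylinder_class_continuous] by blast
next
  fix c assume c: "c \<in> topspace (X_space 2 n)"
  then have "c \<in> isometry_class 2 n ` (marked_graphs 2 n :: (nat, nat) marked_graph set)"
    using X_space_topspace[of n] unfolding topspace_TMb by blast
  then obtain M :: "(nat, nat) marked_graph" where M: "M \<in> marked_graphs 2 n" "c = isometry_class 2 n M"
    by blast
  obtain G l p where Glp: "M = (G, l, p)" by (cases M)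
  have G: "G \<in> stable_graphs 2" and l: "l \<in> arcs G \<rightarrow>\<^sub>E {0<..}" and p: "p \<in> markings n G"
    using M unfolding Glp marked_graphs_def by auto
  have ze: "zero_edges G l = {}" using l unfolding zero_edges_def by (auto simp: PiE_iff)
  have "is_forest G {}"
    using stable_genus_two[OF G] is_forest_theta[of G "{}"] is_forest_rose[of G "{}"] by auto
  then have ls: "l \<in> topspace (length_space G)"
    using l ze unfolding length_space_topspace by (auto simp: PiE_iff less_imp_le)
  have cc: "contraction_class n G (l, p) = c"
    unfolding contraction_class_def M(2) Glp
    using p by (intro contract_no_zero genus_two_wf(1)[OF G] ze) auto
  have x: "(l, p) \<in> {x \<in> topspace (chart n G). contraction_class n G x \<in> {c}}"
    using ls p cc unfolding topspace_chart[OF G] by simp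
  have C: "{c} \<subseteq> topspace (X_space 2 n)" using c by simp
  from stable_genus_two[OF G] have "\<exists>x\<in>topspace (cylinder n). cylinder_class n x \<in> {c}"
  proof
    assume t: "is_theta G"
    have "\<forall>z\<in>arcs G. \<exists>fv fe fl. graph_iso theta0 G fv fe fl \<and> fe 2 = z" using theta_labelling[OF t] by blast
    then obtain fv fe fl where lab: "\<And>z. z \<in> arcs G \<Longrightarrow> graph_iso theta0 G (fv z) (fe z) (fl z) \<and> fe z 2 = z" by metis
    from subsetD[OF equalityD1[OF chart_preimage_theta[OF t C refl lab]] x] show ?thesis by blast
  next
    assume r: "is_rose G"
    obtain fv fe fl where iso: "graph_iso rose0 G fv fe fl" using rose_labelling[OF r] by blast
    from subsetD[OF equalityD1[OF chart_preimage_rose[OF r C refl iso]] x] show ?thesis by blast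
  qed
  then show "c \<in> cylinder_class n ` topspace (cylinder n)" by blast
qed

section \<open>The fibres of the quotient map\<close>

text \<open>The automorphisms of the two models: permutations of the edges, combined with exchanging the
  vertices of the theta graph, or reversing some of the loops of the rose.\<close>

definition theta_aut :: "(nat \<Rightarrow> nat) \<Rightarrow> bool \<Rightarrow> (nat, nat) gpoint \<Rightarrow> (nat, nat) gpoint" where
  "theta_aut \<sigma> \<tau> = graph_map (\<lambda>v. if \<tau> then 1 - v else v) \<sigma> (\<lambda>_. \<tau>)"

definition rose_aut :: "(nat \<Rightarrow> nat) \<Rightarrow> nat set \<Rightarrow> (nat, nat) gpoint \<Rightarrow> (nat, nat) gpoint" where
  "rose_aut \<sigma> F = graph_map (\<lambda>v. v) \<sigma> (\<lambda>e. e \<in> F)"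

lemma theta_aut_iso:
  assumes "\<sigma> permutes {0, 1, 2}"
  shows "graph_iso theta0 theta0 (\<lambda>v. if \<tau> then 1 - v else v) \<sigma> (\<lambda>_. \<tau>)"
  using permutes_imp_bij[OF assms] unfolding graph_iso_def by (auto simp: bij_betw_def inj_on_def)

lemma rose_aut_iso:
  assumes "\<sigma> permutes {0, 1}"
  shows "graph_iso rose0 rose0 (\<lambda>v. v) \<sigma> (\<lambda>e. e \<in> F)"
  using permutes_imp_bij[OF assms] unfolding graph_iso_def by (auto simp: bij_betw_def inj_on_def)

lemma permutes_fun_eq:
  assumes "bij_betw f S S"
  shows "(\<lambda>x. if x \<in> S then f x else x) permutes S"
  by (rule bij_imp_permutes) (use assms in \<open>auto simp: bij_betw_def inj_on_def image_def\<close>)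

lemma theta_iso_aut:
  assumes iso: "graph_iso theta0 theta0 fv fe fl"
  shows "\<exists>\<sigma> \<tau>. \<sigma> permutes {0, 1, 2} \<and> (\<forall>e\<in>{0, 1, 2}. \<sigma> e = fe e)
    \<and> (\<forall>x\<in>gpoints theta0. graph_map fv fe fl x = theta_aut \<sigma> \<tau> x)"
proof -
  have fe: "bij_betw fe {0, 1, 2} {0, 1, 2}" and fv: "bij_betw fv {0, 1} {0, 1}"
    using iso unfolding graph_iso_def theta0_simps by blast+
  have ends: "fv (if fl e then 1 else 0) = 0 \<and> fv (if fl e then 0 else 1) = 1" if "e \<in> {0, 1, 2}" for e
    using iso that unfolding graph_iso_def theta0_simps by metis
  define \<sigma> where "\<sigma> x = (if x \<in> {0, 1, 2} then fe x else x)" for x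
  define \<tau> where "\<tau> \<longleftrightarrow> fv 0 = 1"
  have perm: "\<sigma> permutes {0, 1, 2}" unfolding \<sigma>_def by (rule permutes_fun_eq[OF fe])
  have s: "\<sigma> e = fe e" if "e \<in> {0, 1, 2}" for e using that unfolding \<sigma>_def by simp
  have fl: "fl e = \<tau>" if "e \<in> {0, 1, 2}" for e
    using ends[OF that] unfolding \<tau>_def by (cases "fl e") simp_all
  have v: "fv v = (if \<tau> then 1 - v else v)" if "v \<in> {0, 1}" for v
    using ends[of 0] that unfolding \<tau>_def by (cases "fl 0") (elim insertE emptyE; simp)+
  have map: "graph_map fv fe fl x = theta_aut \<sigma> \<tau> x" if x: "x \<in> gpoints theta0" for x
  proof (rule gpoints_cases[OF x])
    fix w assume "x = Vertex w" "w \<in> verts theta0"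
    then show ?thesis using v[of w] by (simp only: theta_aut_def graph_map.simps theta0_simps)
  next
    fix e t assume "x = Interior e t" "e \<in> arcs theta0"
    then show ?thesis using fl[of e] s[of e] by (simp only: theta_aut_def graph_map.simps theta0_simps)
  qed
  show ?thesis
    by (intro exI[of _ \<sigma>] exI[of _ \<tau>] conjI perm ballI s map)
qed

lemma rose_iso_aut:
  assumes iso: "graph_iso rose0 rose0 fv fe fl"
  shows "\<exists>\<sigma> F. \<sigma> permutes {0, 1} \<and> F \<subseteq> {0, 1}
    \<and> (\<forall>x\<in>gpoints rose0. graph_map fv fe fl x = rose_aut \<sigma> F x)"
proof -
  have fe: "bij_betw fe {0, 1} {0, 1}" and fv: "bij_betw fv {0} {0}"
    using iso unfolding graph_iso_def rose0_simps by blast+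
  define \<sigma> where "\<sigma> x = (if x \<in> {0, 1} then fe x else x)" for x
  have perm: "\<sigma> permutes {0, 1}" unfolding \<sigma>_def by (rule permutes_fun_eq[OF fe])
  have f0: "fv 0 = 0" using fv unfolding bij_betw_def by auto
  have map: "graph_map fv fe fl x = rose_aut \<sigma> {e \<in> {0, 1}. fl e} x" if x: "x \<in> gpoints rose0" for x
  proof (rule gpoints_cases[OF x])
    fix w assume "x = Vertex w" "w \<in> verts rose0"
    then show ?thesis using f0 by (simp add: rose_aut_def)
  next
    fix e t assume x: "x = Interior e t" and "e \<in> arcs rose0"
    then have "e \<in> {0, 1}" by simp
    then show ?thesis unfolding x rose_aut_def graph_map.simps \<sigma>_def mem_Collect_eq by (simp only: if_True simp_thms)
  qed
  show ?thesis
    by (intro exI[of _ \<sigma>] exI[of _ "{e \<in> {0, 1}. fl e}"] conjI perm ballI map) blast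
qed

text \<open>An isometry is a graph isomorphism that preserves edge lengths. The total length \<open>2 + a\<close>
  determines the parameter, and the edge 2 must be fixed if it is the only short one.\<close>

theorem point_class_eq_iff:
  assumes a: "a \<in> {0..1}" "a' \<in> {0..1}" and P: "P \<in> markings n theta0" "P' \<in> markings n theta0"
  shows "point_class n a P = point_class n a' P' \<longleftrightarrow> a = a' \<and>
    (if a = 0 then \<exists>\<sigma> F. \<sigma> permutes {0, 1} \<and> F \<subseteq> {0, 1} \<and> (\<forall>i\<in>{1..n}. collapse (P' i) = rose_aut \<sigma> F (collapse (P i)))
     else \<exists>\<sigma> \<tau>. \<sigma> permutes {0, 1, 2} \<and> (a < 1 \<longrightarrow> \<sigma> 2 = 2) \<and> (\<forall>i\<in>{1..n}. P' i = theta_aut \<sigma> \<tau> (P i)))"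
    (is "?L \<longleftrightarrow> a = a' \<and> ?R")
proof -
  obtain G l p where M: "model n a P = (G, l, p)" by (cases "model n a P")
  obtain G' l' p' where M': "model n a' P' = (G', l', p')" by (cases "model n a' P'")
  have mk: "(G, l, p) \<in> marked_graphs 2 n" "(G', l', p') \<in> marked_graphs 2 n"
    using model_marked[OF a(1) P(1)] model_marked[OF a(2) P(2)] unfolding M M' by auto
  have st: "G \<in> stable_graphs 2" "G' \<in> stable_graphs 2" "\<And>e. e \<in> arcs G \<Longrightarrow> 0 < l e"
    "\<And>e. e \<in> arcs G' \<Longrightarrow> 0 < l' e" and pG: "\<And>i. i \<in> {1..n} \<Longrightarrow> p i \<in> gpoints G"
    using mk unfolding marked_graphs_def by (auto simp: PiE_iff)
  have Pi: "P i \<in> gpoints theta0" "collapse (P i) \<in> gpoints rose0" if "i \<in> {1..n}" for i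
    using PiE_mem[OF P(1) that] collapse_gpoints by auto
  have wfG: "wf_digraph G" using genus_two_wf(1)[OF st(1)] .
  have "?L \<longleftrightarrow> isometric n (G, l, p) (G', l', p')"
  proof
    assume ?L
    moreover have "(G', l', p') \<in> isometry_class 2 n (G', l', p')"
      using mk isometric_refl unfolding isometry_class_def by auto
    ultimately show "isometric n (G, l, p) (G', l', p')"
      unfolding point_class_def M M' isometry_class_def by auto
  next
    assume "isometric n (G, l, p) (G', l', p')"
    then show ?L unfolding point_class_def M M' using pG by (rule isometry_class_eqI)
  qed
  also have "\<dots> \<longleftrightarrow> (\<exists>fv fe fl. graph_iso G G' fv fe fl \<and> (\<forall>e\<in>arcs G. l' (fe e) = l e)
      \<and> (\<forall>i\<in>{1..n}. p' i = graph_map fv fe fl (p i)))"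
  proof
    assume iso: "isometric n (G, l, p) (G', l', p')"
    show "\<exists>fv fe fl. graph_iso G G' fv fe fl \<and> (\<forall>e\<in>arcs G. l' (fe e) = l e)
      \<and> (\<forall>i\<in>{1..n}. p' i = graph_map fv fe fl (p i))"
      by (rule isometric_graph_iso[OF _ _ _ _ _ iso]) (use st pG in auto)
  next
    assume "\<exists>fv fe fl. graph_iso G G' fv fe fl \<and> (\<forall>e\<in>arcs G. l' (fe e) = l e)
      \<and> (\<forall>i\<in>{1..n}. p' i = graph_map fv fe fl (p i))"
    then obtain fv fe fl where iso: "graph_iso G G' fv fe fl" "\<forall>e\<in>arcs G. l' (fe e) = l e"
      "\<forall>i\<in>{1..n}. p' i = graph_map fv fe fl (p i)" by blast
    show "isometric n (G, l, p) (G', l', p')"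
      using iso wf_digraph.tail_in_verts[OF wfG] wf_digraph.head_in_verts[OF wfG]
      by (intro graph_iso_isometric[OF iso(1)]) auto
  qed
  also have "\<dots> \<longleftrightarrow> a = a' \<and> ?R"
  proof (cases "a = 0"; cases "a' = 0")
    assume a0: "a = 0" "a' = 0"
    have eqs: "G = rose0" "G' = rose0" "l = (\<lambda>e\<in>{0, 1}. 1)" "l' = (\<lambda>e\<in>{0, 1}. 1)"
      "p = (\<lambda>i\<in>{1..n}. collapse (P i))" "p' = (\<lambda>i\<in>{1..n}. collapse (P' i))"
      using M M' a0 unfolding model_def by auto
    show ?thesis
    proof
      assume "\<exists>fv fe fl. graph_iso G G' fv fe fl \<and> (\<forall>e\<in>arcs G. l' (fe e) = l e)
        \<and> (\<forall>i\<in>{1..n}. p' i = graph_map fv fe fl (p i))"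
      then obtain fv fe fl where iso: "graph_iso rose0 rose0 fv fe fl"
        "\<forall>i\<in>{1..n}. p' i = graph_map fv fe fl (p i)" unfolding eqs(1,2) by blast
      obtain \<sigma> F where "\<sigma> permutes {0, 1}" "F \<subseteq> {0, 1}" "\<forall>x\<in>gpoints rose0. graph_map fv fe fl x = rose_aut \<sigma> F x"
        using rose_iso_aut[OF iso(1)] by blast
      moreover from this iso(2) have "collapse (P' i) = rose_aut \<sigma> F (collapse (P i))" if "i \<in> {1..n}" for i
        using Pi(2)[OF that] that unfolding eqs(5,6) by simp
      ultimately show "a = a' \<and> ?R" unfolding if_P[OF a0(1)] using a0 by blast
    next
      assume R: "a = a' \<and> ?R"
      from conjunct2[OF R, unfolded if_P[OF a0(1)]] obtain \<sigma> F where s: "\<sigma> permutes {0, 1}"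
        "\<forall>i\<in>{1..n}. collapse (P' i) = rose_aut \<sigma> F (collapse (P i))"
        by (elim exE conjE)
      have "\<sigma> e \<in> {0, 1}" if "e \<in> {0, 1}" for e using permutes_in_image[OF s(1), of e] that by simp
      then have "l' (\<sigma> e) = l e" if "e \<in> {0, 1}" for e using that unfolding eqs restrict_apply by (simp only: if_True)
      then have "\<forall>e\<in>arcs G. l' (\<sigma> e) = l e" unfolding eqs(1) rose0_simps by blast
      then show "\<exists>fv fe fl. graph_iso G G' fv fe fl \<and> (\<forall>e\<in>arcs G. l' (fe e) = l e)
        \<and> (\<forall>i\<in>{1..n}. p' i = graph_map fv fe fl (p i))"
        using rose_aut_iso[OF s(1), of F] s(2) unfolding eqs(1,2,5,6) rose_aut_def
        by (intro exI[of _ "\<lambda>v. v"] exI[of _ \<sigma>] exI[of _ "\<lambda>e. e \<in> F"]) auto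
    qed
  next
    assume a0: "a \<noteq> 0" "a' \<noteq> 0"
    have eqs: "G = theta0" "G' = theta0" "l = edge_lengths a" "l' = edge_lengths a'" "p = P" "p' = P'"
      using M M' a0 unfolding model_def by auto
    show ?thesis
    proof
      assume "\<exists>fv fe fl. graph_iso G G' fv fe fl \<and> (\<forall>e\<in>arcs G. l' (fe e) = l e)
        \<and> (\<forall>i\<in>{1..n}. p' i = graph_map fv fe fl (p i))"
      then obtain fv fe fl where iso: "graph_iso theta0 theta0 fv fe fl"
        and len: "\<forall>e\<in>{0, 1, 2}. edge_lengths a' (fe e) = edge_lengths a e"
        and p: "\<forall>i\<in>{1..n}. P' i = graph_map fv fe fl (P i)" unfolding eqs theta0_simps by blast
      obtain \<sigma> \<tau> where s: "\<sigma> permutes {0, 1, 2}" "\<forall>e\<in>{0, 1, 2}. \<sigma> e = fe e"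
        "\<forall>x\<in>gpoints theta0. graph_map fv fe fl x = theta_aut \<sigma> \<tau> x"
        using theta_iso_aut[OF iso] by blast
      have len': "edge_lengths a' (\<sigma> e) = edge_lengths a e" if "e \<in> {0, 1, 2}" for e
        using bspec[OF len that] bspec[OF s(2) that] by (simp only:)
      have bij: "bij_betw \<sigma> {0, 1, 2} {0, 1, 2}" using permutes_imp_bij[OF s(1)] .
      have "(\<Sum>e\<in>{0, 1, 2}. edge_lengths a' e) = (\<Sum>e\<in>{0, 1, 2}. edge_lengths a' (\<sigma> e))"
        by (rule sum.reindex_bij_betw[OF bij, symmetric])
      also have "\<dots> = (\<Sum>e\<in>{0, 1, 2}. edge_lengths a e)" using len' by (intro sum.cong) auto
      finally have aa: "a = a'" by (simp add: edge_lengths_def)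
      have "\<sigma> 2 = 2" if "a < 1"
      proof (rule ccontr)
        assume "\<sigma> 2 \<noteq> 2"
        moreover have "\<sigma> 2 \<in> {0, 1, 2}" using permutes_in_image[OF s(1), of 2] by simp
        ultimately have "edge_lengths a' (\<sigma> 2) = 1" by (auto simp: edge_lengths_def)
        then show False using len'[of 2] that by (simp add: edge_lengths_def)
      qed
      moreover have "P' i = theta_aut \<sigma> \<tau> (P i)" if "i \<in> {1..n}" for i
        using p s(3) Pi(1)[OF that] that by simp
      ultimately show "a = a' \<and> ?R" unfolding if_not_P[OF a0(1)] using aa s(1) by blast
    next
      assume R: "a = a' \<and> ?R"
      from conjunct2[OF R, unfolded if_not_P[OF a0(1)]] obtain \<sigma> \<tau> where s: "\<sigma> permutes {0, 1, 2}"
        "a < 1 \<longrightarrow> \<sigma> 2 = 2" "\<forall>i\<in>{1..n}. P' i = theta_aut \<sigma> \<tau> (P i)"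
        by (elim exE conjE)
      have "edge_lengths a' (\<sigma> e) = edge_lengths a e" if e: "e \<in> {0, 1, 2}" for e
      proof (cases "a = 1")
        case True
        have "\<sigma> e \<in> {0, 1, 2}" using permutes_in_image[OF s(1), of e] e by simp
        then show ?thesis using e True R by (auto simp: edge_lengths_def)
      next
        case False
        then have s2: "\<sigma> 2 = 2" using s(2) a(1) by simp
        have "\<sigma> e \<in> {0, 1, 2}" using permutes_in_image[OF s(1), of e] e by simp
        moreover have "\<sigma> e = 2 \<longleftrightarrow> e = 2" using s2 permutes_inj[OF s(1)] by (metis injD)
        ultimately show ?thesis using e R by (auto simp: edge_lengths_def)
      qed
      then have len: "\<forall>e\<in>arcs G. l' (\<sigma> e) = l e" unfolding eqs theta0_simps by (intro ballI)
      have mark: "\<forall>i\<in>{1..n}. p' i = graph_map (\<lambda>v. if \<tau> then 1 - v else v) \<sigma> (\<lambda>_. \<tau>) (p i)"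
        using s(3) unfolding eqs theta_aut_def .
      have "graph_iso G G' (\<lambda>v. if \<tau> then 1 - v else v) \<sigma> (\<lambda>_. \<tau>)" unfolding eqs by (rule theta_aut_iso[OF s(1)])
      from conjI[OF this conjI[OF len mark]] show "\<exists>fv fe fl. graph_iso G G' fv fe fl \<and> (\<forall>e\<in>arcs G. l' (fe e) = l e)
        \<and> (\<forall>i\<in>{1..n}. p' i = graph_map fv fe fl (p i))"
        by - (rule exI[of _ "\<lambda>v. if \<tau> then 1 - v else v"], rule exI[of _ \<sigma>], rule exI[of _ "\<lambda>_. \<tau>"], assumption)
    qed
  next
    assume a0: "a = 0" "a' \<noteq> 0"
    then have "G = rose0" "G' = theta0" using M M' unfolding model_def by auto
    moreover have "\<not> bij_betw (fv :: nat \<Rightarrow> nat) {0 :: nat} {0, 1 :: nat}" for fv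
      using bij_betw_same_card[of fv "{0 :: nat}" "{0, 1 :: nat}"] by auto
    ultimately show ?thesis using a0 unfolding graph_iso_def by auto
  next
    assume a0: "a \<noteq> 0" "a' = 0"
    then have "G = theta0" "G' = rose0" using M M' unfolding model_def by auto
    moreover have "\<not> bij_betw (fv :: nat \<Rightarrow> nat) {0, 1 :: nat} {0 :: nat}" for fv
      using bij_betw_same_card[of fv "{0, 1 :: nat}" "{0 :: nat}"] by auto
    ultimately show ?thesis using a0 unfolding graph_iso_def by auto
  qed
  finally show ?thesis .
qed

text \<open>At the parameter 0 the automorphism acts on the contracted graph. The chart of the theta graph, where the
  edge 2 still exists, treats all parameters alike: applying the automorphism amounts to another labelling.\<close>

lemma point_class_theta_aut:
  assumes s: "\<sigma> permutes {0, 1, 2}" "\<sigma> 2 = 2" and a: "a \<in> {0..1}" and P: "P \<in> markings n theta0"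
  shows "point_class n a (\<lambda>i\<in>{1..n}. theta_aut \<sigma> \<tau> (P i)) = point_class n a P"
proof -
  have id: "graph_iso theta0 theta0 (\<lambda>v. v) (\<lambda>e. e) (\<lambda>_. False)"
    unfolding graph_iso_def by (auto simp: bij_betw_def)
  have idm: "graph_map (\<lambda>v. v) (\<lambda>e. e) (\<lambda>_. False) x = x" for x :: "(nat, nat) gpoint" by (cases x) auto
  note iso = theta_aut_iso[OF s(1), of \<tau>]
  let ?Q = "\<lambda>i\<in>{1..n}. theta_aut \<sigma> \<tau> (P i)"
  have Q: "?Q \<in> markings n theta0"
    using graph_map_gpoints[OF iso] unfolding theta_aut_def by (intro restrict_marking[OF P]) auto
  have "point_class n a ?Q = contraction_class n theta0 (theta_chart n theta0 2 (graph_map (\<lambda>v. v) (\<lambda>e. e) (\<lambda>_. False)) (a, ?Q))"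
    by (rule contraction_class_theta_chart[OF is_theta_theta0 id refl a Q, symmetric])
  also have "theta_chart n theta0 2 (graph_map (\<lambda>v. v) (\<lambda>e. e) (\<lambda>_. False)) (a, ?Q)
     = theta_chart n theta0 2 (graph_map (\<lambda>v. if \<tau> then 1 - v else v) \<sigma> (\<lambda>_. \<tau>)) (a, P)"
    unfolding theta_chart_def fst_conv snd_conv idm theta_aut_def by (auto intro!: restrict_ext)
  also have "contraction_class n theta0 \<dots> = point_class n a P"
    by (rule contraction_class_theta_chart[OF is_theta_theta0 iso s(2) a P])
  finally show ?thesis .
qed

definition cylinder_aut ::
  "nat \<Rightarrow> (nat \<Rightarrow> nat) \<Rightarrow> bool \<Rightarrow> real \<times> (nat \<Rightarrow> (nat, nat) gpoint) \<Rightarrow> real \<times> (nat \<Rightarrow> (nat, nat) gpoint)" where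
  "cylinder_aut n \<sigma> \<tau> x = (fst x, \<lambda>i\<in>{1..n}. theta_aut \<sigma> \<tau> (snd x i))"

definition collapse_marking :: "nat \<Rightarrow> real \<times> (nat \<Rightarrow> (nat, nat) gpoint) \<Rightarrow> nat \<Rightarrow> (nat, nat) gpoint" where
  "collapse_marking n x = (\<lambda>i\<in>{1..n}. collapse (snd x i))"

definition collapse_aut ::
  "nat \<Rightarrow> (nat \<Rightarrow> nat) \<Rightarrow> nat set \<Rightarrow> real \<times> (nat \<Rightarrow> (nat, nat) gpoint) \<Rightarrow> nat \<Rightarrow> (nat, nat) gpoint" where
  "collapse_aut n \<sigma> F x = (\<lambda>i\<in>{1..n}. rose_aut \<sigma> F (collapse (snd x i)))"

text \<open>The saturation of a closed subset of the cylinder is a finite union of closed sets, one for every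
  automorphism of the theta graph or of the rose.\<close>

lemma saturation:
  assumes E: "E \<subseteq> topspace (cylinder n)"
  shows "{x \<in> topspace (cylinder n). cylinder_class n x \<in> cylinder_class n ` E}
    = (\<Union>\<sigma>\<in>{\<sigma>. \<sigma> permutes {0, 1, 2} \<and> \<sigma> 2 = 2}. \<Union>\<tau>\<in>UNIV. cylinder_aut n \<sigma> \<tau> ` E)
    \<union> (\<Union>\<sigma>\<in>{\<sigma>. \<sigma> permutes {0, 1, 2}}. \<Union>\<tau>\<in>UNIV.
        cylinder_aut n \<sigma> \<tau> ` {x \<in> E. fst x = 1})
    \<union> (\<Union>\<sigma>\<in>{\<sigma>. \<sigma> permutes {0, 1}}. \<Union>F\<in>Pow {0, 1}. {x \<in> topspace (cylinder n). fst x = 0 \<and>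
        collapse_marking n x \<in> (collapse_aut n \<sigma> F) ` {x \<in> E. fst x = 0}})"
    (is "?S = ?A \<union> ?B \<union> ?C")
proof (intro equalityI subsetI)
  fix y assume "y \<in> ?S"
  then have yK: "y \<in> topspace (cylinder n)" and "cylinder_class n y \<in> cylinder_class n ` E" by simp_all
  then obtain x where x: "x \<in> E" "cylinder_class n y = cylinder_class n x" by (elim imageE)
  have xa: "fst x \<in> {0..1}" "snd x \<in> markings n theta0" and ya: "fst y \<in> {0..1}" "snd y \<in> markings n theta0"
    using subsetD[OF E x(1)] yK unfolding topspace_cylinder mem_Times_iff by blast+
  have "point_class n (fst x) (snd x) = point_class n (fst y) (snd y)"
    using x(2) unfolding cylinder_class_def by simp
  note eq = this[unfolded point_class_eq_iff[OF xa(1) ya(1) xa(2) ya(2)]]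
  note f = conjunct1[OF eq] and eq2 = conjunct2[OF eq]
  show "y \<in> ?A \<union> ?B \<union> ?C"
  proof (cases "fst x = 0")
    case True
    then obtain \<sigma> F where s: "\<sigma> permutes {0, 1}" "F \<subseteq> {0, 1}"
      "\<forall>i\<in>{1..n}. collapse (snd y i) = rose_aut \<sigma> F (collapse (snd x i))"
      using eq2 unfolding if_P[OF True] by blast
    have r: "collapse_marking n y = collapse_aut n \<sigma> F x"
      unfolding collapse_marking_def collapse_aut_def using s(3) by (intro restrict_ext) blast
    have xy: "x \<in> {x \<in> E. fst x = 0}" "fst y = 0" using x(1) True f by simp_all
    have "y \<in> ?C" using s(1,2) yK xy r by blast
    then show ?thesis by blast
  next
    case False
    then obtain \<sigma> \<tau> where s: "\<sigma> permutes {0, 1, 2}" "fst x < 1 \<longrightarrow> \<sigma> 2 = 2"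
      "\<forall>i\<in>{1..n}. snd y i = theta_aut \<sigma> \<tau> (snd x i)"
      using eq2 unfolding if_not_P[OF False] by blast
    have sy: "snd y = (\<lambda>i\<in>{1..n}. theta_aut \<sigma> \<tau> (snd x i))"
    proof
      fix i show "snd y i = (\<lambda>i\<in>{1..n}. theta_aut \<sigma> \<tau> (snd x i)) i"
      proof (cases "i \<in> {1..n}")
        case True
        show ?thesis unfolding restrict_apply if_P[OF True] by (rule bspec[OF s(3) True])
      next
        case False
        show ?thesis unfolding restrict_apply if_not_P[OF False] by (rule PiE_arb[OF ya(2) False])
      qed
    qed
    have yx: "y = cylinder_aut n \<sigma> \<tau> x"
      unfolding cylinder_aut_def sy[symmetric] f by (rule prod.collapse[symmetric])
    show ?thesis
    proof (cases "fst x < 1")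
      case True
      then have "y \<in> ?A" using s(1,2) yx x(1) by blast
      then show ?thesis by blast
    next
      case False
      then have "x \<in> {x \<in> E. fst x = 1}" using xa(1) x(1) by simp
      then have "y \<in> ?B" using s(1) yx by blast
      then show ?thesis by blast
    qed
  qed
next
  have aut: "(\<lambda>i\<in>{1..n}. theta_aut \<sigma> \<tau> (P i)) \<in> markings n theta0"
    if "\<sigma> permutes {0, 1, 2}" "P \<in> markings n theta0" for \<sigma> \<tau> P
    using graph_map_gpoints[OF theta_aut_iso[OF that(1), of \<tau>]] unfolding theta_aut_def
    by (intro restrict_marking[OF that(2)]) auto
  fix y assume "y \<in> ?A \<union> ?B \<union> ?C"
  then consider (A) "y \<in> ?A" | (B) "y \<in> ?B" | (C) "y \<in> ?C" by (elim UnE)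
  then show "y \<in> ?S"
  proof cases
    case A
    then obtain \<sigma> \<tau> x where s: "\<sigma> permutes {0, 1, 2}" "\<sigma> 2 = 2" and x: "x \<in> E"
      and y: "y = cylinder_aut n \<sigma> \<tau> x" by blast
    have xa: "fst x \<in> {0..1}" "snd x \<in> markings n theta0"
      using subsetD[OF E x] unfolding topspace_cylinder mem_Times_iff by blast+
    have "cylinder_class n y = cylinder_class n x"
      using point_class_theta_aut[OF s xa] unfolding y cylinder_class_def cylinder_aut_def by simp
    moreover have "y \<in> topspace (cylinder n)" using aut[OF s(1) xa(2)] xa(1) unfolding y topspace_cylinder cylinder_aut_def by simp
    ultimately show ?thesis using x by blast
  next
    case B
    then obtain \<sigma> \<tau> x where s: "\<sigma> permutes {0, 1, 2}" and x: "x \<in> E" "fst x = 1"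
      and y: "y = cylinder_aut n \<sigma> \<tau> x" by blast
    have xa: "fst x \<in> {0..1}" "snd x \<in> markings n theta0"
      using subsetD[OF E x(1)] unfolding topspace_cylinder mem_Times_iff by blast+
    have "point_class n (fst x) (snd x) = point_class n (fst x) (\<lambda>i\<in>{1..n}. theta_aut \<sigma> \<tau> (snd x i))"
      unfolding point_class_eq_iff[OF xa(1,1) xa(2) aut[OF s xa(2)]] using x(2) s by auto
    then have "cylinder_class n y = cylinder_class n x" unfolding y cylinder_class_def cylinder_aut_def by simp
    moreover have "y \<in> topspace (cylinder n)" using aut[OF s xa(2)] xa(1) unfolding y topspace_cylinder cylinder_aut_def by simp
    ultimately show ?thesis using x by blast
  next
    case C
    then obtain \<sigma> F x where s: "\<sigma> permutes {0, 1}" "F \<in> Pow {0, 1}" and x: "x \<in> E" "fst x = 0"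
      and y: "y \<in> topspace (cylinder n)" "fst y = 0"
      "collapse_marking n y = collapse_aut n \<sigma> F x" by blast
    have xa: "fst x \<in> {0..1}" "snd x \<in> markings n theta0" and ya: "fst y \<in> {0..1}" "snd y \<in> markings n theta0"
      using subsetD[OF E x(1)] y(1) unfolding topspace_cylinder mem_Times_iff by blast+
    have "collapse (snd y i) = rose_aut \<sigma> F (collapse (snd x i))" if "i \<in> {1..n}" for i
      using fun_cong[OF y(3), of i] that unfolding collapse_marking_def collapse_aut_def by simp
    then have "point_class n (fst x) (snd x) = point_class n (fst y) (snd y)"
      unfolding point_class_eq_iff[OF xa(1) ya(1) xa(2) ya(2)] using x(2) y(2) s by auto
    then have "cylinder_class n y = cylinder_class n x" unfolding cylinder_class_def by simp
    then show ?thesis using x y(1) by blast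
  qed
qed

lemma continuous_map_cylinder_theta_aut:
  assumes "\<sigma> permutes {0, 1, 2}"
  shows "continuous_map (cylinder n) (cylinder n) (cylinder_aut n \<sigma> \<tau>)"
proof -
  have 1: "continuous_map (cylinder n) (top_of_set {0..1}) fst"
    unfolding cylinder_def by (rule continuous_map_fst)
  have 2: "continuous_map (cylinder n) (marking_space n theta0) (\<lambda>x. \<lambda>i\<in>{1..n}. theta_aut \<sigma> \<tau> (snd x i))"
    unfolding theta_aut_def
    by (intro continuous_map_cylinder_marking continuous_map_graph_map[OF theta_aut_iso[OF assms]] wf_theta0)
  have "continuous_map (cylinder n) (prod_topology (top_of_set {0..1}) (marking_space n theta0)) (cylinder_aut n \<sigma> \<tau>)"
    unfolding cylinder_aut_def continuous_map_paired using 1 2 by (rule conjI)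
  then show ?thesis by (subst (2) cylinder_def)
qed

lemma closedin_UN_finite:
  "finite I \<Longrightarrow> (\<And>i. i \<in> I \<Longrightarrow> closedin T (f i)) \<Longrightarrow> closedin T (\<Union>i\<in>I. f i)"
  by (rule closedin_Union) auto

text \<open>The saturation of a closed set is a finite union of images under automorphisms and, over the parameter
  0, of preimages of compact sets of markings of the rose.\<close>

theorem cylinder_class_closed: "closed_map (cylinder n) (X_space 2 n) (cylinder_class n)"
  unfolding closed_map_def
proof (intro allI impI)
  fix E assume E: "closedin (cylinder n) E"
  have EK: "E \<subseteq> topspace (cylinder n)" using E closedin_subset by blast
  have level: "closedin (cylinder n) {x \<in> E. fst x = c}" for c
  proof -
    have "{x \<in> E. fst x = c} = E \<inter> {x \<in> topspace (cylinder n). fst x = c}" using EK by auto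
    then show ?thesis using closedin_Int[OF E closedin_cylinder_level[of n c]] by simp
  qed
  have fin: "finite {\<sigma>. \<sigma> permutes {0, 1, 2 :: nat}}" "finite {\<sigma>. \<sigma> permutes {0, 1 :: nat}}"
    by (intro finite_permutations; simp)+
  have fin': "finite {\<sigma>. \<sigma> permutes {0, 1, 2 :: nat} \<and> \<sigma> 2 = 2}" by (rule rev_finite_subset[OF fin(1)]) blast
  have img: "closedin (cylinder n) (cylinder_aut n \<sigma> \<tau> ` D)"
    if "\<sigma> permutes {0, 1, 2}" "closedin (cylinder n) D" for \<sigma> \<tau> D
    by (intro closedin_image_cylinder[OF that(2) Hausdorff_cylinder] continuous_map_from_subtopology
        continuous_map_cylinder_theta_aut that(1))
  have rose: "closedin (cylinder n) {x \<in> topspace (cylinder n). fst x = 0 \<and>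
        collapse_marking n x \<in> (collapse_aut n \<sigma> F) ` {x \<in> E. fst x = 0}}"
    (is "closedin _ ?Z") if s: "\<sigma> permutes {0, 1}" for \<sigma> F
  proof -
    let ?W = "(collapse_aut n \<sigma> F) ` {x \<in> E. fst x = 0}"
    have "continuous_map (realization theta0) (realization rose0) (rose_aut \<sigma> F \<circ> collapse)"
      unfolding rose_aut_def
      by (rule continuous_map_compose[OF continuous_map_collapse
            continuous_map_graph_map[OF rose_aut_iso[OF s] wf_rose0 wf_rose0]])
    then have "continuous_map (cylinder n) (marking_space n rose0) (collapse_aut n \<sigma> F)"
      using continuous_map_cylinder_marking[of rose0 "rose_aut \<sigma> F \<circ> collapse" n]
      unfolding collapse_aut_def by (simp add: o_def)
    then have "closedin (marking_space n rose0) ?W"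
      by (intro closedin_image_cylinder[OF level Hausdorff_marking_space[OF wf_rose0]] continuous_map_from_subtopology)
    then have "closedin (cylinder n) {x \<in> topspace (cylinder n). collapse_marking n x \<in> ?W}"
      by (rule closedin_continuous_map_preimage[OF
            continuous_map_cylinder_marking[OF continuous_map_collapse, folded collapse_marking_def]])
    then have "closedin (cylinder n) ({x \<in> topspace (cylinder n). fst x = 0} \<inter>
        {x \<in> topspace (cylinder n). collapse_marking n x \<in> ?W})"
      by (rule closedin_Int[OF closedin_cylinder_level])
    moreover have "{x \<in> topspace (cylinder n). fst x = 0} \<inter>
        {x \<in> topspace (cylinder n). collapse_marking n x \<in> ?W} = ?Z" by blast
    ultimately show ?thesis by simp
  qed
  show "closedin (X_space 2 n) (cylinder_class n ` E)"
  proof (rule closedin_X_space)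
    show "cylinder_class n ` E \<subseteq> topspace (X_space 2 n)"
      using EK cylinder_class_surj by blast
    show "closedin (cylinder n) {x \<in> topspace (cylinder n). cylinder_class n x \<in> cylinder_class n ` E}"
      unfolding saturation[OF EK]
    proof (intro closedin_Un)
      show "closedin (cylinder n) (\<Union>\<sigma>\<in>{\<sigma>. \<sigma> permutes {0, 1, 2} \<and> \<sigma> 2 = 2}. \<Union>\<tau>\<in>UNIV. cylinder_aut n \<sigma> \<tau> ` E)"
        by (intro closedin_UN_finite fin' finite) (simp add: img E)
      show "closedin (cylinder n) (\<Union>\<sigma>\<in>{\<sigma>. \<sigma> permutes {0, 1, 2}}. \<Union>\<tau>\<in>UNIV.
          cylinder_aut n \<sigma> \<tau> ` {x \<in> E. fst x = 1})"
        by (intro closedin_UN_finite fin finite) (simp add: img level)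
      show "closedin (cylinder n) (\<Union>\<sigma>\<in>{\<sigma>. \<sigma> permutes {0, 1}}. \<Union>F\<in>Pow {0, 1}. {x \<in> topspace (cylinder n).
          fst x = 0 \<and> collapse_marking n x \<in> (collapse_aut n \<sigma> F) ` {x \<in> E. fst x = 0}})"
        by (intro closedin_UN_finite fin) (simp_all add: rose)
    qed
  qed
qed

section \<open>Weighted orbit counts\<close>

text \<open>Burnside's lemma with an invariant weight. The group is given by its acting maps: the identity is
  one of them, and composition with any of them permutes them.\<close>

lemma weighted_burnside:
  fixes act :: "'g \<Rightarrow> 'x \<Rightarrow> 'x" and w :: "'x \<Rightarrow> int"
  assumes G: "finite G" and A: "finite A"
    and closed: "\<And>g x. g \<in> G \<Longrightarrow> x \<in> A \<Longrightarrow> act g x \<in> A"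
    and e: "e \<in> G" "\<And>x. x \<in> A \<Longrightarrow> act e x = x"
    and comp: "\<And>r. r \<in> G \<Longrightarrow> \<exists>b. bij_betw b G G \<and> (\<forall>s\<in>G. \<forall>x\<in>A. act (b s) x = act s (act r x))"
    and w: "\<And>g x. g \<in> G \<Longrightarrow> x \<in> A \<Longrightarrow> w (act g x) = w x"
  defines "orb \<equiv> \<lambda>x. (\<lambda>g. act g x) ` G"
  shows "int (card G) * (\<Sum>Z\<in>orb ` A. w (SOME x. x \<in> Z)) = (\<Sum>g\<in>G. \<Sum>x\<in>{x \<in> A. act g x = x}. w x)"
    and "\<And>x y. x \<in> A \<Longrightarrow> y \<in> orb x \<Longrightarrow> orb y = orb x"
proof -
  have self: "x \<in> orb x" if "x \<in> A" for x
    using e that unfolding orb_def by (intro image_eqI[where x=e]) auto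
  have orbA: "orb x \<subseteq> A" if "x \<in> A" for x using closed that unfolding orb_def by blast
  have stab: "card {s \<in> G. act s y = y} = card {s \<in> G. act s x = y}" if x: "x \<in> A" and y: "y \<in> orb x" for x y
  proof -
    obtain r where r: "r \<in> G" "y = act r x" using y unfolding orb_def by blast
    obtain b where b: "bij_betw b G G" "\<forall>s\<in>G. \<forall>x\<in>A. act (b s) x = act s (act r x)" using comp[OF r(1)] by blast
    have inj: "inj_on b G" and im: "b ` G = G" using b(1) unfolding bij_betw_def by auto
    have bs: "act (b s) x = act s y" if "s \<in> G" for s using b(2) that x r(2) by simp
    have "b ` {s \<in> G. act s y = y} = {s \<in> G. act s x = y}"
    proof (intro equalityI subsetI)
      fix t assume t: "t \<in> {s \<in> G. act s x = y}"
      then have "t \<in> b ` G" unfolding im by simp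
      then obtain s where s: "s \<in> G" "t = b s" by blast
      then show "t \<in> b ` {s \<in> G. act s y = y}" using t bs[OF s(1)] by auto
    next
      fix t assume "t \<in> b ` {s \<in> G. act s y = y}"
      then obtain s where s: "s \<in> G" "act s y = y" "t = b s" by blast
      moreover have "b s \<in> G" using im s(1) by blast
      ultimately show "t \<in> {s \<in> G. act s x = y}" using bs[OF s(1)] by simp
    qed
    moreover have "inj_on b {s \<in> G. act s y = y}" using inj by (rule inj_on_subset) auto
    ultimately show ?thesis using card_image by fastforce
  qed
  have trans: "orb y \<subseteq> orb x" if x: "x \<in> A" and y: "y \<in> orb x" for x y
  proof
    obtain r where r: "r \<in> G" "y = act r x" using y unfolding orb_def by blast
    obtain b where b: "bij_betw b G G" "\<forall>s\<in>G. \<forall>x\<in>A. act (b s) x = act s (act r x)" using comp[OF r(1)] by blast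
    fix z assume "z \<in> orb y"
    then obtain s where s: "s \<in> G" "z = act s y" unfolding orb_def by blast
    then have "z = act (b s) x" "b s \<in> G" using b x r(2) unfolding bij_betw_def by auto
    then show "z \<in> orb x" unfolding orb_def by blast
  qed
  have sym: "x \<in> orb y" if x: "x \<in> A" and y: "y \<in> orb x" for x y
  proof -
    obtain r where r: "r \<in> G" "y = act r x" using y unfolding orb_def by blast
    obtain b where b: "bij_betw b G G" "\<forall>s\<in>G. \<forall>x\<in>A. act (b s) x = act s (act r x)" using comp[OF r(1)] by blast
    then obtain s where s: "s \<in> G" "b s = e" using e(1) unfolding bij_betw_def by (metis imageE)
    then have "act s y = x" using b(2) x r(2) e(2) by metis
    then show ?thesis using s(1) unfolding orb_def by blast
  qed
  show eq: "orb y = orb x" if "x \<in> A" "y \<in> orb x" for x y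
    using trans[OF that] trans[OF _ sym[OF that]] orbA[OF that(1)] that by blast
  have part: "(\<Sum>x\<in>A. f x) = (\<Sum>Z\<in>orb ` A. \<Sum>x\<in>Z. f x)" for f :: "'x \<Rightarrow> int"
  proof -
    have "{x \<in> A. orb x = Z} = Z" if "Z \<in> orb ` A" for Z
      using that eq self orbA by blast
    then have "(\<Sum>Z\<in>orb ` A. \<Sum>x\<in>Z. f x) = (\<Sum>Z\<in>orb ` A. \<Sum>x\<in>{x \<in> A. orb x = Z}. f x)"
      by (intro sum.cong) auto
    also have "\<dots> = (\<Sum>x\<in>A. f x)" using A by (intro sum.group) auto
    finally show ?thesis by simp
  qed
  have "(\<Sum>g\<in>G. \<Sum>x\<in>{x \<in> A. act g x = x}. w x) = (\<Sum>g\<in>G. \<Sum>x\<in>A. if act g x = x then w x else 0)"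
    using A by (intro sum.cong refl sum.mono_neutral_cong_left) auto
  also have "\<dots> = (\<Sum>x\<in>A. \<Sum>g\<in>G. if act g x = x then w x else 0)" by (rule sum.swap)
  also have "\<dots> = (\<Sum>x\<in>A. int (card {g \<in> G. act g x = x}) * w x)"
  proof (intro sum.cong refl)
    fix x
    have "(\<Sum>g\<in>G. if act g x = x then w x else 0) = (\<Sum>g\<in>{g \<in> G. act g x = x}. w x)"
      using G by (intro sum.mono_neutral_cong_right) auto
    then show "(\<Sum>g\<in>G. if act g x = x then w x else 0) = int (card {g \<in> G. act g x = x}) * w x" by simp
  qed
  also have "\<dots> = (\<Sum>Z\<in>orb ` A. \<Sum>x\<in>Z. int (card {g \<in> G. act g x = x}) * w x)" by (rule part)
  also have "\<dots> = (\<Sum>Z\<in>orb ` A. int (card G) * w (SOME x. x \<in> Z))"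
  proof (intro sum.cong refl)
    fix Z assume "Z \<in> orb ` A"
    then obtain x0 where x0: "x0 \<in> A" "Z = orb x0" by blast
    have wZ: "w x = w x0" if "x \<in> Z" for x using that w x0 unfolding orb_def by auto
    have "(SOME x. x \<in> Z) \<in> Z" using self[OF x0(1)] x0(2) by (intro someI) auto
    then have some: "w (SOME x. x \<in> Z) = w x0" by (rule wZ)
    have finZ: "finite Z" using G unfolding x0(2) orb_def by simp
    have "(\<Sum>x\<in>Z. int (card {g \<in> G. act g x = x}) * w x) = (\<Sum>x\<in>Z. int (card {g \<in> G. act g x0 = x})) * w x0"
      unfolding sum_distrib_right using stab[OF x0(1)] wZ x0(2) by (intro sum.cong refl) simp
    also have "(\<Sum>x\<in>Z. int (card {g \<in> G. act g x0 = x})) = int (card G)"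
    proof -
      have "(\<Sum>x\<in>Z. \<Sum>g\<in>{g \<in> G. act g x0 = x}. 1 :: int) = (\<Sum>g\<in>G. 1)"
        using G finZ by (intro sum.group) (auto simp: x0(2) orb_def)
      then show ?thesis by simp
    qed
    finally show "(\<Sum>x\<in>Z. int (card {g \<in> G. act g x = x}) * w x) = int (card G) * w (SOME x. x \<in> Z)"
      unfolding some .
  qed
  also have "\<dots> = int (card G) * (\<Sum>Z\<in>orb ` A. w (SOME x. x \<in> Z))" by (simp add: sum_distrib_left)
  finally show "int (card G) * (\<Sum>Z\<in>orb ` A. w (SOME x. x \<in> Z)) = (\<Sum>g\<in>G. \<Sum>x\<in>{x \<in> A. act g x = x}. w x)" by simp
qed

text \<open>\<open>V j\<close> is the tail (\<open>j = False\<close>) or the head of the edges, \<open>M i\<close> the midpoint of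
  the edge \<open>i\<close>, and \<open>H i j\<close> its open half at \<open>V j\<close>. The vertex of the rose is
  \<open>V False\<close>; its loops still have two halves.\<close>

datatype cell = V bool | M nat | H nat bool

fun is_half :: "cell \<Rightarrow> bool" where
  "is_half (H i j) = True"
| "is_half _ = False"

definition theta_cells :: "cell set" where
  "theta_cells = {V False, V True, M 0, M 1, M 2, H 0 False, H 0 True, H 1 False, H 1 True, H 2 False, H 2 True}"

definition rose_cells :: "cell set" where
  "rose_cells = {V False, M 0, M 1, H 0 False, H 0 True, H 1 False, H 1 True}"

fun theta_perm :: "(nat \<Rightarrow> nat) \<Rightarrow> bool \<Rightarrow> cell \<Rightarrow> cell" where
  "theta_perm \<sigma> \<tau> (V j) = V (j \<noteq> \<tau>)"
| "theta_perm \<sigma> \<tau> (M i) = M (\<sigma> i)"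
| "theta_perm \<sigma> \<tau> (H i j) = H (\<sigma> i) (j \<noteq> \<tau>)"

fun rose_perm :: "(nat \<Rightarrow> nat) \<Rightarrow> nat set \<Rightarrow> cell \<Rightarrow> cell" where
  "rose_perm \<sigma> F (V j) = V j"
| "rose_perm \<sigma> F (M i) = M (\<sigma> i)"
| "rose_perm \<sigma> F (H i j) = H (\<sigma> i) (j \<noteq> (i \<in> F))"

text \<open>The parameter is 0 at the bottom, 1 at the top and strictly between in the middle.\<close>

datatype level = Bottom | Middle | Top

fun level_cells :: "level \<Rightarrow> cell set" where
  "level_cells Bottom = rose_cells"
| "level_cells Middle = theta_cells"
| "level_cells Top = theta_cells"

fun level_group :: "level \<Rightarrow> (cell \<Rightarrow> cell) set" where
  "level_group Bottom = {rose_perm \<sigma> F | \<sigma> F. \<sigma> permutes {0, 1} \<and> F \<subseteq> {0, 1}}"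
| "level_group Middle = {theta_perm \<sigma> \<tau> | \<sigma> \<tau>. \<sigma> permutes {0, 1}}"
| "level_group Top = {theta_perm \<sigma> \<tau> | \<sigma> \<tau>. \<sigma> permutes {0, 1, 2}}"

lemma theta_perm_comp: "theta_perm \<sigma> \<tau> \<circ> theta_perm \<sigma>' \<tau>' = theta_perm (\<sigma> \<circ> \<sigma>') (\<tau> \<noteq> \<tau>')"
proof
  fix c show "(theta_perm \<sigma> \<tau> \<circ> theta_perm \<sigma>' \<tau>') c = theta_perm (\<sigma> \<circ> \<sigma>') (\<tau> \<noteq> \<tau>') c"
    by (cases c) auto
qed

lemma rose_perm_comp: "rose_perm \<sigma> F \<circ> rose_perm \<sigma>' F' = rose_perm (\<sigma> \<circ> \<sigma>') {i. (i \<in> F') \<noteq> (\<sigma>' i \<in> F)}"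
proof
  fix c show "(rose_perm \<sigma> F \<circ> rose_perm \<sigma>' F') c = rose_perm (\<sigma> \<circ> \<sigma>') {i. (i \<in> F') \<noteq> (\<sigma>' i \<in> F)} c"
    by (cases c) auto
qed

lemma theta_perm_id: "theta_perm id False = id"
proof
  fix c show "theta_perm id False c = id c" by (cases c) auto
qed

lemma rose_perm_id: "rose_perm id {} = id"
proof
  fix c show "rose_perm id {} c = id c" by (cases c) auto
qed

lemma theta_perm_eq_iff: "theta_perm \<sigma> \<tau> = theta_perm \<sigma>' \<tau>' \<longleftrightarrow> \<sigma> = \<sigma>' \<and> \<tau> = \<tau>'"
proof
  assume eq: "theta_perm \<sigma> \<tau> = theta_perm \<sigma>' \<tau>'"
  have "\<sigma> i = \<sigma>' i" for i using fun_cong[OF eq, of "M i"] by simp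
  moreover have "\<tau> = \<tau>'" using fun_cong[OF eq, of "V False"] by simp
  ultimately show "\<sigma> = \<sigma>' \<and> \<tau> = \<tau>'" by auto
qed simp

lemma rose_perm_eq_iff: "rose_perm \<sigma> F = rose_perm \<sigma>' F' \<longleftrightarrow> \<sigma> = \<sigma>' \<and> F = F'"
proof
  assume eq: "rose_perm \<sigma> F = rose_perm \<sigma>' F'"
  have "\<sigma> i = \<sigma>' i" for i using fun_cong[OF eq, of "M i"] by simp
  moreover have "i \<in> F \<longleftrightarrow> i \<in> F'" for i using fun_cong[OF eq, of "H i False"] by simp
  ultimately show "\<sigma> = \<sigma>' \<and> F = F'" by auto
qed simp

lemma level_group_id: "id \<in> level_group k"
proof (cases k)
  case Bottom
  have "id \<in> {rose_perm \<sigma> F | \<sigma> F. \<sigma> permutes {0, 1} \<and> F \<subseteq> {0, 1}}"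
    using permutes_id[of "{0, 1 :: nat}"] by (intro CollectI exI[of _ id] exI[of _ "{}"]) (simp add: rose_perm_id)
  then show ?thesis using Bottom by simp
next
  case Middle
  have "id \<in> {theta_perm \<sigma> \<tau> | \<sigma> \<tau>. \<sigma> permutes {0, 1}}"
    using permutes_id[of "{0, 1 :: nat}"] by (intro CollectI exI[of _ id] exI[of _ False]) (simp add: theta_perm_id)
  then show ?thesis using Middle by simp
next
  case Top
  have "id \<in> {theta_perm \<sigma> \<tau> | \<sigma> \<tau>. \<sigma> permutes {0, 1, 2}}"
    using permutes_id[of "{0, 1, 2 :: nat}"] by (intro CollectI exI[of _ id] exI[of _ False]) (simp add: theta_perm_id)
  then show ?thesis using Top by simp
qed

lemma level_group_comp:
  assumes g: "g \<in> level_group k" and h: "h \<in> level_group k"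
  shows "g \<circ> h \<in> level_group k"
proof -
  have theta: "g \<circ> h \<in> {theta_perm \<sigma> \<tau> | \<sigma> \<tau>. \<sigma> permutes S}"
    if gh: "g \<in> {theta_perm \<sigma> \<tau> | \<sigma> \<tau>. \<sigma> permutes S}" "h \<in> {theta_perm \<sigma> \<tau> | \<sigma> \<tau>. \<sigma> permutes S}" for S
  proof -
    obtain \<sigma> \<tau> \<sigma>' \<tau>' where "\<sigma> permutes S" "\<sigma>' permutes S" "g = theta_perm \<sigma> \<tau>" "h = theta_perm \<sigma>' \<tau>'"
      using gh by blast
    then show ?thesis
      using permutes_compose[of \<sigma>' S \<sigma>] by (intro CollectI exI[of _ "\<sigma> \<circ> \<sigma>'"] exI[of _ "\<tau> \<noteq> \<tau>'"]) (simp add: theta_perm_comp)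
  qed
  show ?thesis
  proof (cases k)
    case Bottom
    then obtain \<sigma> F \<sigma>' F' where s: "\<sigma> permutes {0, 1}" "\<sigma>' permutes {0, 1}" "F \<subseteq> {0, 1}" "F' \<subseteq> {0, 1}"
      "g = rose_perm \<sigma> F" "h = rose_perm \<sigma>' F'" using g h by auto
    have "{i. (i \<in> F') \<noteq> (\<sigma>' i \<in> F)} \<subseteq> {0, 1}"
    proof
      fix i assume "i \<in> {i. (i \<in> F') \<noteq> (\<sigma>' i \<in> F)}"
      then have "i \<in> {0, 1} \<or> \<sigma>' i \<in> {0, 1}" using s(3,4) by blast
      then show "i \<in> {0, 1}" using permutes_in_image[OF s(2), of i] by blast
    qed
    then have "g \<circ> h \<in> {rose_perm \<sigma> F | \<sigma> F. \<sigma> permutes {0, 1} \<and> F \<subseteq> {0, 1}}"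
      unfolding s(5,6) rose_perm_comp using permutes_compose[OF s(2,1)] by blast
    then show ?thesis using Bottom by simp
  next
    case Middle
    then show ?thesis using theta[of "{0, 1}"] g h by (simp only: level_group.simps)
  next
    case Top
    then show ?thesis using theta[of "{0, 1, 2}"] g h by (simp only: level_group.simps)
  qed
qed

lemma level_group_right_inverse:
  assumes g: "g \<in> level_group k" shows "\<exists>h\<in>level_group k. g \<circ> h = id"
proof -
  have theta: "\<exists>h\<in>{theta_perm \<sigma> \<tau> | \<sigma> \<tau>. \<sigma> permutes S}. g \<circ> h = id"
    if g': "g \<in> {theta_perm \<sigma> \<tau> | \<sigma> \<tau>. \<sigma> permutes S}" for S
  proof -
    obtain \<sigma> \<tau> where s: "\<sigma> permutes S" "g = theta_perm \<sigma> \<tau>" using g' by blast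
    have "g \<circ> theta_perm (inv_into UNIV \<sigma>) \<tau> = id"
      unfolding s(2) theta_perm_comp permutes_inv_o(1)[OF s(1)] using theta_perm_id by simp
    then show ?thesis using permutes_inv[OF s(1)] by blast
  qed
  show ?thesis
  proof (cases k)
    case Bottom
    then obtain \<sigma> F where s: "\<sigma> permutes {0, 1}" "F \<subseteq> {0, 1}" "g = rose_perm \<sigma> F" using g by auto
    let ?F = "{i. inv_into UNIV \<sigma> i \<in> F}"
    have "?F \<subseteq> {0, 1}"
    proof
      fix i assume "i \<in> ?F"
      then have "inv_into UNIV \<sigma> i \<in> {0, 1}" using s(2) by blast
      then show "i \<in> {0, 1}" using permutes_in_image[OF permutes_inv[OF s(1)], of i] by blast
    qed
    moreover have "g \<circ> rose_perm (inv_into UNIV \<sigma>) ?F = id"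
      unfolding s(3) rose_perm_comp permutes_inv_o(1)[OF s(1)] using rose_perm_id by simp
    ultimately show ?thesis
      unfolding Bottom level_group.simps using permutes_inv[OF s(1)]
      by (intro bexI[where x="rose_perm (inv_into UNIV \<sigma>) ?F"]) blast+
  next
    case Middle
    then show ?thesis using theta[of "{0, 1}"] g by (simp only: level_group.simps)
  next
    case Top
    then show ?thesis using theta[of "{0, 1, 2}"] g by (simp only: level_group.simps)
  qed
qed

lemma pair_image: "(\<lambda>(x, y). f x y) ` (A \<times> B) = {f x y | x y. x \<in> A \<and> y \<in> B}"
  by auto

lemma level_group_image:
  "level_group Bottom = (\<lambda>(\<sigma>, F). rose_perm \<sigma> F) ` ({\<sigma>. \<sigma> permutes {0, 1}} \<times> Pow {0, 1})"
  "level_group Middle = (\<lambda>(\<sigma>, \<tau>). theta_perm \<sigma> \<tau>) ` ({\<sigma>. \<sigma> permutes {0, 1}} \<times> UNIV)"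
  "level_group Top = (\<lambda>(\<sigma>, \<tau>). theta_perm \<sigma> \<tau>) ` ({\<sigma>. \<sigma> permutes {0, 1, 2}} \<times> UNIV)"
  unfolding pair_image by simp_all

lemma sum_level_group:
  fixes f :: "(cell \<Rightarrow> cell) \<Rightarrow> int"
  shows "(\<Sum>g\<in>level_group Bottom. f g) = (\<Sum>\<sigma> | \<sigma> permutes {0, 1}. \<Sum>F\<in>Pow {0, 1}. f (rose_perm \<sigma> F))"
    "(\<Sum>g\<in>level_group Middle. f g) = (\<Sum>\<sigma> | \<sigma> permutes {0, 1}. \<Sum>\<tau>\<in>UNIV. f (theta_perm \<sigma> \<tau>))"
    "(\<Sum>g\<in>level_group Top. f g) = (\<Sum>\<sigma> | \<sigma> permutes {0, 1, 2}. \<Sum>\<tau>\<in>UNIV. f (theta_perm \<sigma> \<tau>))"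
  unfolding level_group_image sum.cartesian_product
  by (subst sum.reindex; auto simp: inj_on_def rose_perm_eq_iff theta_perm_eq_iff o_def case_prod_unfold)+

lemma finite_level_group: "finite (level_group k)"
  by (cases k) (simp_all only: level_group_image, auto intro!: finite_imageI finite_cartesian_product finite_permutations)

definition cell_sign :: "cell \<Rightarrow> int" where
  "cell_sign c = (if is_half c then -1 else 1)"

definition tuple_act :: "nat \<Rightarrow> (cell \<Rightarrow> cell) \<Rightarrow> (nat \<Rightarrow> cell) \<Rightarrow> nat \<Rightarrow> cell" where
  "tuple_act n g c = (\<lambda>i\<in>{1..n}. g (c i))"

abbreviation cell_tuples :: "nat \<Rightarrow> level \<Rightarrow> (nat \<Rightarrow> cell) set" where
  "cell_tuples n k \<equiv> {1..n} \<rightarrow>\<^sub>E level_cells k"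

definition tuple_orbit :: "nat \<Rightarrow> level \<Rightarrow> (nat \<Rightarrow> cell) \<Rightarrow> (nat \<Rightarrow> cell) set" where
  "tuple_orbit n k c = (\<lambda>g. tuple_act n g c) ` level_group k"

definition orbit_sum :: "nat \<Rightarrow> level \<Rightarrow> int" where
  "orbit_sum n k = (\<Sum>Z\<in>tuple_orbit n k ` cell_tuples n k. \<Prod>i\<in>{1..n}. cell_sign ((SOME c. c \<in> Z) i))"

lemma theta_cells_iff:
  "V j \<in> theta_cells" "M i \<in> theta_cells \<longleftrightarrow> i \<in> {0, 1, 2}" "H i j \<in> theta_cells \<longleftrightarrow> i \<in> {0, 1, 2}"
  by (cases j; simp add: theta_cells_def)+

lemma rose_cells_iff:
  "V j \<in> rose_cells \<longleftrightarrow> \<not> j" "M i \<in> rose_cells \<longleftrightarrow> i \<in> {0, 1}" "H i j \<in> rose_cells \<longleftrightarrow> i \<in> {0, 1}"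
  by (cases j; simp add: rose_cells_def)+

lemma finite_level_cells: "finite (level_cells k)"
  by (cases k) (simp_all add: theta_cells_def rose_cells_def)

lemma theta_perm_cells:
  assumes "\<sigma> permutes {0, 1, 2}" "c \<in> theta_cells" shows "theta_perm \<sigma> \<tau> c \<in> theta_cells"
proof -
  have "\<sigma> i \<in> {0, 1, 2}" if "i \<in> {0, 1, 2}" for i using permutes_in_image[OF assms(1), of i] that by simp
  then show ?thesis using assms(2) by (cases c) (simp_all only: theta_perm.simps theta_cells_iff)
qed

lemma rose_perm_cells:
  assumes "\<sigma> permutes {0, 1}" "c \<in> rose_cells" shows "rose_perm \<sigma> F c \<in> rose_cells"
proof -
  have "\<sigma> i \<in> {0, 1}" if "i \<in> {0, 1}" for i using permutes_in_image[OF assms(1), of i] that by simp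
  then show ?thesis using assms(2) by (cases c) (simp_all only: rose_perm.simps rose_cells_iff not_False_eq_True)
qed

lemma permutes_01_012: "\<sigma> permutes {0, 1 :: nat} \<Longrightarrow> \<sigma> permutes {0, 1, 2}"
  by (rule permutes_subset) auto

lemma level_group_cells:
  assumes "g \<in> level_group k" "c \<in> level_cells k" shows "g c \<in> level_cells k"
proof (cases k)
  case Bottom
  then show ?thesis using assms rose_perm_cells by auto
next
  case Middle
  then show ?thesis using assms theta_perm_cells permutes_01_012 by auto
next
  case Top
  then obtain \<sigma> \<tau> where "\<sigma> permutes {0, 1, 2}" "g = theta_perm \<sigma> \<tau>" using assms(1) by auto
  then show ?thesis using assms(2) theta_perm_cells Top by simp
qed

lemma is_half_level_group: "g \<in> level_group k \<Longrightarrow> is_half (g c) = is_half c"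
proof -
  have "is_half (theta_perm \<sigma> \<tau> c) = is_half c" "is_half (rose_perm \<sigma> F c) = is_half c" for \<sigma> \<tau> F
    by (cases c; simp)+
  then show "g \<in> level_group k \<Longrightarrow> is_half (g c) = is_half c" by (cases k) auto
qed

lemma tuple_act_closed: "g \<in> level_group k \<Longrightarrow> c \<in> cell_tuples n k \<Longrightarrow> tuple_act n g c \<in> cell_tuples n k"
  unfolding tuple_act_def using level_group_cells by (auto simp: PiE_iff)

lemma tuple_act_id: "c \<in> cell_tuples n k \<Longrightarrow> tuple_act n id c = c"
  unfolding tuple_act_def by (auto simp: PiE_iff extensional_def)

lemma tuple_act_comp: "tuple_act n (s \<circ> r) c = tuple_act n s (tuple_act n r c)"
  unfolding tuple_act_def by auto

lemma level_group_right_mult: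
  assumes r: "r \<in> level_group k" shows "bij_betw (\<lambda>s. s \<circ> r) (level_group k) (level_group k)"
proof -
  obtain h where h: "h \<in> level_group k" "r \<circ> h = id" using level_group_right_inverse[OF r] by blast
  have "inj_on (\<lambda>s. s \<circ> r) (level_group k)"
  proof (rule inj_onI)
    fix s t assume "s \<circ> r = t \<circ> r"
    then have "s \<circ> (r \<circ> h) = t \<circ> (r \<circ> h)" by (simp only: comp_assoc[symmetric])
    then show "s = t" unfolding h(2) by simp
  qed
  moreover have "(\<lambda>s. s \<circ> r) ` level_group k \<subseteq> level_group k" using level_group_comp r by blast
  ultimately show ?thesis
    unfolding bij_betw_def using endo_inj_surj[OF finite_level_group] by blast
qed

text \<open>A tuple is fixed if and only if all its entries are, and its sign is the product of theirs.\<close>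

lemma fixed_tuples_sum:
  "(\<Sum>c\<in>{c \<in> cell_tuples n k. tuple_act n g c = c}. \<Prod>i\<in>{1..n}. cell_sign (c i))
    = (\<Sum>x\<in>level_cells k. if g x = x then cell_sign x else 0) ^ n"
proof -
  have fixed: "{c \<in> cell_tuples n k. tuple_act n g c = c} = {1..n} \<rightarrow>\<^sub>E {x \<in> level_cells k. g x = x}"
  proof (intro equalityI subsetI)
    fix c assume c: "c \<in> {c \<in> cell_tuples n k. tuple_act n g c = c}"
    have "g (c i) = c i" if "i \<in> {1..n}" for i
    proof -
      have "tuple_act n g c i = c i" using c by simp
      then show ?thesis using that unfolding tuple_act_def by simp
    qed
    then show "c \<in> {1..n} \<rightarrow>\<^sub>E {x \<in> level_cells k. g x = x}" using c by (auto simp: PiE_iff)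
  next
    fix c assume c: "c \<in> {1..n} \<rightarrow>\<^sub>E {x \<in> level_cells k. g x = x}"
    have "tuple_act n g c i = c i" for i
      using c PiE_arb[OF c, of i] unfolding tuple_act_def by (cases "i \<in> {1..n}") (auto simp: PiE_iff)
    then show "c \<in> {c \<in> cell_tuples n k. tuple_act n g c = c}" using c by (auto simp: PiE_iff)
  qed
  have "(\<Sum>c\<in>{c \<in> cell_tuples n k. tuple_act n g c = c}. \<Prod>i\<in>{1..n}. cell_sign (c i))
      = (\<Prod>i\<in>{1..n}. \<Sum>x\<in>{x \<in> level_cells k. g x = x}. cell_sign x)"
    unfolding fixed by (rule prod_sum_PiE[symmetric]) (use finite_level_cells[of k] in auto)
  also have "(\<Sum>x\<in>{x \<in> level_cells k. g x = x}. cell_sign x) = (\<Sum>x\<in>level_cells k. if g x = x then cell_sign x else 0)"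
    using finite_level_cells[of k] by (intro sum.mono_neutral_cong_left) auto
  finally show ?thesis by simp
qed

lemma burnside_orbits:
  shows orbit_sum_eq: "int (card (level_group k)) * orbit_sum n k =
      (\<Sum>g\<in>level_group k. (\<Sum>x\<in>level_cells k. if g x = x then cell_sign x else 0) ^ n)"
    and tuple_orbit_eq: "\<And>c d. c \<in> cell_tuples n k \<Longrightarrow> d \<in> tuple_orbit n k c \<Longrightarrow> tuple_orbit n k d = tuple_orbit n k c"
proof -
  let ?w = "\<lambda>c. \<Prod>i\<in>{1..n}. cell_sign (c i)"
  have fin: "finite (cell_tuples n k)" using finite_level_cells by (intro finite_PiE) auto
  have w: "?w (tuple_act n g c) = ?w c" if "g \<in> level_group k" for g c
    using is_half_level_group[OF that] unfolding tuple_act_def cell_sign_def by (intro prod.cong) auto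
  have comp: "\<exists>b. bij_betw b (level_group k) (level_group k) \<and>
      (\<forall>s\<in>level_group k. \<forall>x\<in>cell_tuples n k. tuple_act n (b s) x = tuple_act n s (tuple_act n r x))"
    if "r \<in> level_group k" for r
    using level_group_right_mult[OF that] tuple_act_comp by (intro exI[of _ "\<lambda>s. s \<circ> r"]) auto
  note B = weighted_burnside[of "level_group k" "cell_tuples n k" "tuple_act n" id ?w,
      OF finite_level_group fin tuple_act_closed level_group_id tuple_act_id comp w]
  show "int (card (level_group k)) * orbit_sum n k =
      (\<Sum>g\<in>level_group k. (\<Sum>x\<in>level_cells k. if g x = x then cell_sign x else 0) ^ n)"
    using B(1) unfolding fixed_tuples_sum orbit_sum_def tuple_orbit_def by simp
  show "\<And>c d. c \<in> cell_tuples n k \<Longrightarrow> d \<in> tuple_orbit n k c \<Longrightarrow> tuple_orbit n k d = tuple_orbit n k c"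
    using B(2) unfolding tuple_orbit_def by simp
qed

text \<open>Here \<open>f\<close> counts the fixed edges. Each of them contributes its midpoint and, unless the vertices
  are exchanged, loses its two halves; the vertices contribute 2 if they are not exchanged.\<close>

lemma fixed_cells_theta:
  "(\<Sum>x\<in>theta_cells. if theta_perm \<sigma> \<tau> x = x then cell_sign x else 0) =
    (let f = (if \<sigma> 0 = 0 then 1 else 0) + (if \<sigma> 1 = 1 then 1 else 0) + (if \<sigma> 2 = 2 then 1 else 0)
     in if \<tau> then f else 2 - f)"
  unfolding theta_cells_def by (simp add: cell_sign_def Let_def)

text \<open>A fixed loop contributes its midpoint, and loses its two halves unless it is reversed.\<close>

lemma fixed_cells_rose:
  "(\<Sum>x\<in>rose_cells. if rose_perm \<sigma> F x = x then cell_sign x else 0) =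
    1 + (if \<sigma> 0 = 0 then (if 0 \<in> F then 1 else -1) else 0) + (if \<sigma> 1 = 1 then (if 1 \<in> F then 1 else -1) else 0)"
  unfolding rose_cells_def by (simp add: cell_sign_def)

lemma sum_permutes_01:
  "(\<Sum>\<sigma> | \<sigma> permutes {0, 1 :: nat}. f \<sigma>) = f id + f (Transposition.transpose 0 1)"
proof -
  have "(\<Sum>\<sigma> | \<sigma> permutes insert 0 {1 :: nat}. f \<sigma>) = f id + f (Transposition.transpose 0 1)"
    by (subst sum_over_permutations_insert; simp)+
  then show ?thesis by simp
qed

lemma orbit_sum_Bottom: "8 * orbit_sum n Bottom = (-1) ^ n + 3 ^ n + 6"
proof -
  have c: "int (card (level_group Bottom)) = 8"
    using sum_level_group(1)[of "\<lambda>_. 1"] unfolding sum_permutes_01 by (simp add: card_Pow)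
  have "int (card (level_group Bottom)) * orbit_sum n Bottom = (-1) ^ n + 3 ^ n + 6"
    unfolding orbit_sum_eq sum_level_group(1) level_cells.simps fixed_cells_rose sum_permutes_01
    by (simp add: Pow_insert Transposition.transpose_def sum.insert_if)
  then show ?thesis unfolding c .
qed

lemma orbit_sum_Middle: "4 * orbit_sum n Middle = (-1) ^ n + 3 ^ n + 2"
proof -
  have c: "int (card (level_group Middle)) = 4"
    using sum_level_group(2)[of "\<lambda>_. 1"] unfolding sum_permutes_01 by simp
  have "int (card (level_group Middle)) * orbit_sum n Middle = (-1) ^ n + 3 ^ n + 2"
    unfolding orbit_sum_eq sum_level_group(2) level_cells.simps fixed_cells_theta sum_permutes_01
    by (simp add: UNIV_bool Transposition.transpose_def Let_def)
  then show ?thesis unfolding c .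
qed

lemma sum_permutes_012:
  fixes f :: "(nat \<Rightarrow> nat) \<Rightarrow> int"
  shows "(\<Sum>\<sigma> | \<sigma> permutes {0, 1, 2 :: nat}. f \<sigma>) = f id + f (Transposition.transpose 1 2) + f (Transposition.transpose 0 1) + f (Transposition.transpose 0 1 \<circ> Transposition.transpose 1 2)
    + f (Transposition.transpose 0 2) + f (Transposition.transpose 0 2 \<circ> Transposition.transpose 1 2)"
proof -
  have 1: "(\<Sum>\<sigma> | \<sigma> permutes insert 1 {2 :: nat}. f \<sigma>) = f id + f (Transposition.transpose 1 2)" for f :: "(nat \<Rightarrow> nat) \<Rightarrow> int"
    by (subst sum_over_permutations_insert; simp)+
  have "(\<Sum>\<sigma> | \<sigma> permutes insert 0 {1, 2 :: nat}. f \<sigma>) = (\<Sum>b\<in>insert 0 {1, 2}. \<Sum>q | q permutes insert 1 {2}. f (Transposition.transpose 0 b \<circ> q))"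
    by (rule sum_over_permutations_insert) auto
  also have "\<dots> = f id + f (Transposition.transpose 1 2) + f (Transposition.transpose 0 1) + f (Transposition.transpose 0 1 \<circ> Transposition.transpose 1 2)
    + f (Transposition.transpose 0 2) + f (Transposition.transpose 0 2 \<circ> Transposition.transpose 1 2)"
    unfolding 1 by simp
  finally show ?thesis .
qed

lemma orbit_sum_Top: "12 * orbit_sum n Top = (-1) ^ n + 3 + 2 * 2 ^ n + 3 ^ n + 3 + 2 * 0 ^ n"
proof -
  have c: "int (card (level_group Top)) = 12"
    using sum_level_group(3)[of "\<lambda>_. 1"] unfolding sum_permutes_012 by simp
  have "int (card (level_group Top)) * orbit_sum n Top = (-1) ^ n + 3 + 2 * 2 ^ n + 3 ^ n + 3 + 2 * 0 ^ n"
    unfolding orbit_sum_eq sum_level_group(3) level_cells.simps fixed_cells_theta sum_permutes_012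
    by (simp add: UNIV_bool Transposition.transpose_def Let_def)
  then show ?thesis unfolding c .
qed

section \<open>The cells of the space\<close>

text \<open>The parameter of a half-edge runs from \<open>-1\<close> at the vertex to 1 at the midpoint.\<close>

fun cell_point :: "cell \<Rightarrow> real \<Rightarrow> (nat, nat) gpoint" where
  "cell_point (V j) t = Vertex (if j then 1 else 0)"
| "cell_point (M i) t = Interior i (1 / 2)"
| "cell_point (H i j) t = edge_point theta0 i (if j then 1 - (t + 1) / 4 else (t + 1) / 4)"

definition cell_marking :: "nat \<Rightarrow> (nat \<Rightarrow> cell) \<Rightarrow> (nat \<Rightarrow> real) \<Rightarrow> nat \<Rightarrow> (nat, nat) gpoint" where
  "cell_marking n c t = (\<lambda>i\<in>{1..n}. cell_point (c i) (t i))"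

lemma cell_point_half:
  assumes "t \<in> {-1<..<1}"
  shows "cell_point (H i j) t = Interior i (if j then 1 - (t + 1) / 4 else (t + 1) / 4)"
  using assms by (cases j) (simp_all add: edge_point_def)

\<comment> \<open>For interior parameters the rule above avoids the case distinction in \<open>edge_point\<close>.\<close>
declare cell_point.simps(3) [simp del]

lemma cell_point_gpoints:
  assumes "c \<in> theta_cells" "is_half c \<longrightarrow> t \<in> {-1..1}"
  shows "cell_point c t \<in> gpoints theta0"
proof (cases c)
  case (H i j)
  have "i \<in> arcs theta0" using assms(1) unfolding H theta_cells_iff by simp
  then show ?thesis
    unfolding H cell_point.simps using assms(2) H
    by (intro edge_point_gpoints wf_theta0) auto
next
  case (V j)
  then show ?thesis by (simp add: gpoints_def)
next
  case (M i)
  have "i \<in> {0, 1, 2}" using assms(1) unfolding M by (simp only: theta_cells_iff)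
  then show ?thesis unfolding M cell_point.simps gpoints_def theta0_simps
    by - (rule UnI2, rule CollectI, intro exI conjI, rule refl, simp_all)
qed

lemma cell_point_inj:
  assumes "cell_point c t = cell_point c' t'"
    and "is_half c \<longrightarrow> t \<in> {-1<..<1}" "is_half c' \<longrightarrow> t' \<in> {-1<..<1}"
  shows "c = c' \<and> (is_half c \<longrightarrow> t = t')"
  using assms by (cases c; cases c') (auto simp: cell_point_half field_simps split: if_splits)

lemma cell_point_exists:
  assumes "x \<in> gpoints theta0"
  shows "\<exists>c\<in>theta_cells. \<exists>t. (is_half c \<longrightarrow> t \<in> {-1<..<1} \<and> (\<exists>e s. x = Interior e s \<and> s \<noteq> 1 / 2)) \<and> x = cell_point c t"
proof (rule gpoints_cases[OF assms])
  fix v assume v: "x = Vertex v" "v \<in> verts theta0"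
  then have "x = cell_point (V (v = 1)) 0" by auto
  then show ?thesis by (intro bexI[of _ "V (v = 1)"] exI[of _ 0]) (simp_all add: theta_cells_iff)
next
  fix e s assume x: "x = Interior e s" "e \<in> arcs theta0" and s: "0 < s" "s < 1"
  have e: "e \<in> {0, 1, 2}" using x(2) by simp
  consider "s = 1 / 2" | "s < 1 / 2" | "1 / 2 < s" by linarith
  then show ?thesis
  proof cases
    case 1
    then show ?thesis
      using e x by (intro bexI[of _ "M e"] exI[of _ 0]) (simp_all only: theta_cells_iff is_half.simps cell_point.simps simp_thms)
  next
    case 2
    then have t: "4 * s - 1 \<in> {-1<..<1}" using s by simp
    then have "x = cell_point (H e False) (4 * s - 1)" using x by (simp add: cell_point_half)
    moreover have "H e False \<in> theta_cells" using e by (simp only: theta_cells_iff)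
    moreover have "s \<noteq> 1 / 2" using 2 by simp
    ultimately show ?thesis using t x(1) by blast
  next
    case 3
    then have t: "3 - 4 * s \<in> {-1<..<1}" using s by simp
    then have "x = cell_point (H e True) (3 - 4 * s)" using x by (simp add: cell_point_half field_simps)
    moreover have "H e True \<in> theta_cells" using e by (simp only: theta_cells_iff)
    moreover have "s \<noteq> 1 / 2" using 3 by simp
    ultimately show ?thesis using t x(1) by blast
  qed
qed

lemma cell_point_interior:
  assumes "cell_point c t = Interior e s" "s \<noteq> 1 / 2" "is_half c \<longrightarrow> t \<in> {-1..1}"
  shows "is_half c \<and> t \<in> {-1<..<1}"
proof (cases c)
  case (H i j)
  have "t \<noteq> -1 \<and> t \<noteq> 1"
    using assms(1,2) unfolding H cell_point.simps by (auto simp: edge_point_def split: if_splits)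
  then show ?thesis using assms(3) H by force
qed (use assms in auto)

lemma theta_aut_cell_point:
  assumes "is_half c \<longrightarrow> t \<in> {-1<..<1}"
  shows "theta_aut \<sigma> \<tau> (cell_point c t) = cell_point (theta_perm \<sigma> \<tau> c) t"
  using assms by (cases c) (auto simp: theta_aut_def cell_point_half)

lemma rose_aut_cell_point:
  assumes "is_half c \<longrightarrow> t \<in> {-1<..<1}"
  shows "rose_aut \<sigma> F (cell_point c t) = cell_point (rose_perm \<sigma> F c) t"
  using assms by (cases c) (auto simp: rose_aut_def cell_point_half)

lemma collapse_cell_point:
  assumes "is_half c \<longrightarrow> t \<in> {-1<..<1}" "c \<in> theta_cells"
  shows "collapse (cell_point c t) = cell_point (if c \<in> rose_cells then c else V False) t"
proof (cases c)
  case (H i j)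
  have "i \<in> {0, 1, 2}" using assms(2) unfolding H by (simp only: theta_cells_iff)
  moreover have "cell_point (H i j) t = Interior i (if j then 1 - (t + 1) / 4 else (t + 1) / 4)"
    using assms(1) H by (intro cell_point_half) simp
  ultimately show ?thesis unfolding H rose_cells_iff by auto
next
  case (V j)
  show ?thesis unfolding V rose_cells_iff by (cases j) simp_all
next
  case (M i)
  have "i \<in> {0, 1, 2}" using assms(2) unfolding M by (simp only: theta_cells_iff)
  then show ?thesis unfolding M rose_cells_iff by auto
qed

definition level_of :: "real \<Rightarrow> level" where
  "level_of a = (if a = 0 then Bottom else if a = 1 then Top else Middle)"

lemma rose_cells_theta: "rose_cells \<subseteq> theta_cells"
  unfolding rose_cells_def theta_cells_def by auto

lemma level_cells_theta: "c \<in> level_cells k \<Longrightarrow> c \<in> theta_cells"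
  using rose_cells_theta by (cases k) auto

definition half_set :: "nat \<Rightarrow> (nat \<Rightarrow> cell) \<Rightarrow> nat set" where
  "half_set n c = {i \<in> {1..n}. is_half (c i)}"

lemma cell_marking_in:
  assumes c: "c \<in> cell_tuples n k" and t: "\<forall>i\<in>half_set n c. t i \<in> {-1..1}"
  shows "cell_marking n c t \<in> markings n theta0"
proof -
  have "cell_point (c i) (t i) \<in> gpoints theta0" if i: "i \<in> {1..n}" for i
    by (rule cell_point_gpoints[OF level_cells_theta[OF PiE_mem[OF c i]]]) (use t i in \<open>simp add: half_set_def\<close>)
  then show ?thesis unfolding cell_marking_def by (simp add: PiE_iff)
qed

lemma permutes_01_iff: "\<sigma> permutes {0, 1 :: nat} \<longleftrightarrow> \<sigma> permutes {0, 1, 2} \<and> \<sigma> 2 = 2"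
proof
  assume s: "\<sigma> permutes {0, 1 :: nat}"
  then show "\<sigma> permutes {0, 1, 2} \<and> \<sigma> 2 = 2" using permutes_01_012 permutes_not_in[OF s, of 2] by simp
next
  assume s: "\<sigma> permutes {0, 1, 2 :: nat} \<and> \<sigma> 2 = 2"
  show "\<sigma> permutes {0, 1}" by (rule permutes_superset[of _ "{0, 1, 2}"]) (use s in auto)
qed

lemma bex_setcompr2: "(\<exists>z\<in>{f x y | x y. P x y}. Q z) \<longleftrightarrow> (\<exists>x y. P x y \<and> Q (f x y))"
  by blast

text \<open>Automorphisms permute the cells and preserve the parameters of the half-edges, so equivalent points
  have equal coordinates in equivalent cells.\<close>

lemma cell_class_eq_iff:
  assumes a: "a \<in> {0..1}" "a' \<in> {0..1}"
    and c: "c \<in> cell_tuples n (level_of a)" "c' \<in> cell_tuples n (level_of a')"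
    and t: "\<forall>i\<in>half_set n c. t i \<in> {-1<..<1}" "\<forall>i\<in>half_set n c'. t' i \<in> {-1<..<1}"
  shows "point_class n a (cell_marking n c t) = point_class n a' (cell_marking n c' t') \<longleftrightarrow> a = a' \<and>
    (\<exists>g\<in>level_group (level_of a). \<forall>i\<in>{1..n}. c' i = g (c i) \<and> (is_half (c i) \<longrightarrow> t' i = t i))"
    (is "?L \<longleftrightarrow> a = a' \<and> ?R")
proof -
  have m: "cell_marking n c t \<in> markings n theta0" "cell_marking n c' t' \<in> markings n theta0"
    by (rule cell_marking_in[OF c(1)], use t(1) in force) (rule cell_marking_in[OF c(2)], use t(2) in force)
  have open1: "is_half (c i) \<longrightarrow> t i \<in> {-1<..<1}" and open2: "is_half (c' i) \<longrightarrow> t' i \<in> {-1<..<1}" if "i \<in> {1..n}" for i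
    using t that unfolding half_set_def by blast+
  have cm: "cell_marking n c t i = cell_point (c i) (t i)" "cell_marking n c' t' i = cell_point (c' i) (t' i)"
    if "i \<in> {1..n}" for i using that unfolding cell_marking_def by simp_all
  have pt: "cell_point (c' i) (t' i) = cell_point (g (c i)) (t i) \<longleftrightarrow> c' i = g (c i) \<and> (is_half (c i) \<longrightarrow> t' i = t i)"
    if g: "g \<in> level_group k" and i: "i \<in> {1..n}" for g k i
  proof
    assume "cell_point (c' i) (t' i) = cell_point (g (c i)) (t i)"
    have "is_half (g (c i)) \<longrightarrow> t i \<in> {-1<..<1}" using open1[OF i] is_half_level_group[OF g, of "c i"] by simp
    from cell_point_inj[OF \<open>cell_point (c' i) (t' i) = cell_point (g (c i)) (t i)\<close> open2[OF i] this] show "c' i = g (c i) \<and> (is_half (c i) \<longrightarrow> t' i = t i)"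
      using is_half_level_group[OF g, of "c i"] by metis
  next
    assume r: "c' i = g (c i) \<and> (is_half (c i) \<longrightarrow> t' i = t i)"
    show "cell_point (c' i) (t' i) = cell_point (g (c i)) (t i)"
    proof (cases "is_half (c i)")
      case False
      then have "\<not> is_half (g (c i))" using is_half_level_group[OF g] by simp
      then show ?thesis using r by (cases "g (c i)") auto
    qed (use r in simp)
  qed
  show ?thesis
  proof (cases "a = a'")
    case False
    then show ?thesis unfolding point_class_eq_iff[OF a m] by simp
  next
    case eq: True
    show ?thesis
    proof (cases "a = 0")
      case True
      have lev: "level_of a = Bottom" "level_of a' = Bottom" using True eq unfolding level_of_def by simp_all
      have col: "collapse (cell_point (c i) (t i)) = cell_point (c i) (t i)"
        "collapse (cell_point (c' i) (t' i)) = cell_point (c' i) (t' i)" if i: "i \<in> {1..n}" for i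
        using PiE_mem[OF c(1) i] PiE_mem[OF c(2) i] collapse_cell_point[OF open1[OF i]] collapse_cell_point[OF open2[OF i]]
        unfolding lev level_cells.simps using rose_cells_theta by (simp_all add: subset_iff)
      have step: "(\<forall>i\<in>{1..n}. collapse (cell_marking n c' t' i) = rose_aut \<sigma> F (collapse (cell_marking n c t i)))
          \<longleftrightarrow> (\<forall>i\<in>{1..n}. c' i = rose_perm \<sigma> F (c i) \<and> (is_half (c i) \<longrightarrow> t' i = t i))"
        if s: "\<sigma> permutes {0, 1}" "F \<subseteq> {0, 1}" for \<sigma> F
      proof (rule ball_cong[OF refl])
        fix i assume i: "i \<in> {1..n}"
        have g: "rose_perm \<sigma> F \<in> level_group Bottom" using s by auto
        show "(collapse (cell_marking n c' t' i) = rose_aut \<sigma> F (collapse (cell_marking n c t i))) \<longleftrightarrow>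
          c' i = rose_perm \<sigma> F (c i) \<and> (is_half (c i) \<longrightarrow> t' i = t i)"
          unfolding cm[OF i] col[OF i] rose_aut_cell_point[OF open1[OF i]] by (rule pt[OF g i])
      qed
      have "?L \<longleftrightarrow> (\<exists>\<sigma> F. \<sigma> permutes {0, 1} \<and> F \<subseteq> {0, 1} \<and>
          (\<forall>i\<in>{1..n}. collapse (cell_marking n c' t' i) = rose_aut \<sigma> F (collapse (cell_marking n c t i))))"
        unfolding point_class_eq_iff[OF a m] if_P[OF True] by (simp only: eq simp_thms)
      also have "\<dots> \<longleftrightarrow> (\<exists>\<sigma> F. \<sigma> permutes {0, 1} \<and> F \<subseteq> {0, 1} \<and>
          (\<forall>i\<in>{1..n}. c' i = rose_perm \<sigma> F (c i) \<and> (is_half (c i) \<longrightarrow> t' i = t i)))"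
        by (intro ex_cong1 conj_cong refl) (rule step; assumption)
      also have "\<dots> \<longleftrightarrow> ?R" unfolding lev level_group.simps bex_setcompr2 conj_assoc ..
      finally show ?thesis by (simp only: eq simp_thms)
    next
      case False
      have grp: "level_group (level_of a) = {theta_perm \<sigma> \<tau> | \<sigma> \<tau>. \<sigma> permutes {0, 1, 2} \<and> (a < 1 \<longrightarrow> \<sigma> 2 = 2)}"
      proof (cases "a = 1")
        case True
        then show ?thesis by (simp add: level_of_def)
      next
        case a1: False
        have "level_of a = Middle" using False a1 unfolding level_of_def by simp
        moreover have "a < 1" using a1 a(1) by simp
        ultimately show ?thesis by (simp only: level_group.simps permutes_01_iff simp_thms)
      qed
      have step: "(\<forall>i\<in>{1..n}. cell_marking n c' t' i = theta_aut \<sigma> \<tau> (cell_marking n c t i))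
          \<longleftrightarrow> (\<forall>i\<in>{1..n}. c' i = theta_perm \<sigma> \<tau> (c i) \<and> (is_half (c i) \<longrightarrow> t' i = t i))"
        if s: "\<sigma> permutes {0, 1, 2}" for \<sigma> \<tau>
      proof (rule ball_cong[OF refl])
        fix i assume i: "i \<in> {1..n}"
        have g: "theta_perm \<sigma> \<tau> \<in> level_group Top" using s by auto
        show "(cell_marking n c' t' i = theta_aut \<sigma> \<tau> (cell_marking n c t i)) \<longleftrightarrow>
          c' i = theta_perm \<sigma> \<tau> (c i) \<and> (is_half (c i) \<longrightarrow> t' i = t i)"
          unfolding cm[OF i] theta_aut_cell_point[OF open1[OF i]] by (rule pt[OF g i])
      qed
      have "?L \<longleftrightarrow> (\<exists>\<sigma> \<tau>. \<sigma> permutes {0, 1, 2} \<and> (a < 1 \<longrightarrow> \<sigma> 2 = 2) \<and>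
          (\<forall>i\<in>{1..n}. cell_marking n c' t' i = theta_aut \<sigma> \<tau> (cell_marking n c t i)))"
        unfolding point_class_eq_iff[OF a m] if_not_P[OF False] by (simp only: eq simp_thms)
      also have "\<dots> \<longleftrightarrow> (\<exists>\<sigma> \<tau>. \<sigma> permutes {0, 1, 2} \<and> (a < 1 \<longrightarrow> \<sigma> 2 = 2) \<and>
          (\<forall>i\<in>{1..n}. c' i = theta_perm \<sigma> \<tau> (c i) \<and> (is_half (c i) \<longrightarrow> t' i = t i)))"
        by (intro ex_cong1 conj_cong refl) (rule step; assumption)
      also have "\<dots> \<longleftrightarrow> ?R" unfolding grp bex_setcompr2 conj_assoc ..
      finally show ?thesis by (simp only: eq simp_thms)
    qed
  qed
qed

text \<open>At the parameter 0 the marked points on the edge 2 and at the vertex 1 can be moved to the vertex 0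
  without changing the class, which leaves only cells of the rose.\<close>

lemma cell_class_exists:
  assumes a: "a \<in> {0..1}" and P: "P \<in> markings n theta0"
  shows "\<exists>c\<in>cell_tuples n (level_of a). \<exists>t.
    (\<forall>i\<in>half_set n c. t i \<in> {-1<..<1} \<and> (\<exists>e s. P i = Interior e s \<and> s \<noteq> 1 / 2)) \<and>
    point_class n a P = point_class n a (cell_marking n c t)"
proof -
  have "\<forall>i\<in>{1..n}. \<exists>c t. c \<in> theta_cells \<and>
      (is_half c \<longrightarrow> t \<in> {-1<..<1} \<and> (\<exists>e s. P i = Interior e s \<and> s \<noteq> 1 / 2)) \<and> P i = cell_point c t"
    using cell_point_exists[OF PiE_mem[OF P]] by blast
  then obtain c t where ct: "\<And>i. i \<in> {1..n} \<Longrightarrow> c i \<in> theta_cells"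
      "\<And>i. i \<in> {1..n} \<Longrightarrow> is_half (c i) \<Longrightarrow> t i \<in> {-1<..<1} \<and> (\<exists>e s. P i = Interior e s \<and> s \<noteq> 1 / 2)"
      "\<And>i. i \<in> {1..n} \<Longrightarrow> P i = cell_point (c i) (t i)"
    by (metis (lifting))
  show ?thesis
  proof (cases "a = 0")
    case False
    let ?c = "\<lambda>i\<in>{1..n}. c i"
    have lev: "level_cells (level_of a) = theta_cells" using False unfolding level_of_def by simp
    have "?c \<in> cell_tuples n (level_of a)" unfolding lev using ct(1) by (simp add: PiE_iff)
    moreover have "cell_marking n ?c t = P"
    proof
      fix i show "cell_marking n ?c t i = P i"
        using ct(3)[of i] PiE_arb[OF P, of i] unfolding cell_marking_def by (cases "i \<in> {1..n}") simp_all
    qed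
    moreover have "t i \<in> {-1<..<1} \<and> (\<exists>e s. P i = Interior e s \<and> s \<noteq> 1 / 2)" if "i \<in> half_set n ?c" for i
    proof -
      have i: "i \<in> {1..n}" "is_half (?c i)" using that unfolding half_set_def by blast+
      then have "is_half (c i)" by (simp only: restrict_apply if_True)
      then show ?thesis by (rule ct(2)[OF i(1)])
    qed
    ultimately show ?thesis by (intro bexI[of _ ?c] exI[of _ t] conjI ballI) simp_all
  next
    case True
    let ?d = "\<lambda>i. if c i \<in> rose_cells then c i else V False"
    let ?c = "\<lambda>i\<in>{1..n}. ?d i"
    have lev: "level_of a = Bottom" using True unfolding level_of_def by simp
    have c: "?c \<in> cell_tuples n Bottom" by (simp add: PiE_iff rose_cells_iff)
    have h: "is_half (?c i) \<Longrightarrow> is_half (c i)" if "i \<in> {1..n}" for i using that by (simp split: if_splits)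
    have t: "is_half (?c i) \<longrightarrow> t i \<in> {-1<..<1}" if "i \<in> {1..n}" for i using ct(2)[OF that] h[OF that] by blast
    have hs: "t i \<in> {-1<..<1} \<and> (\<exists>e s. P i = Interior e s \<and> s \<noteq> 1 / 2)" if "i \<in> half_set n ?c" for i
    proof -
      have i: "i \<in> {1..n}" "is_half (?c i)" using that unfolding half_set_def by blast+
      show ?thesis by (rule ct(2)[OF i(1) h[OF i]])
    qed
    have m: "cell_marking n ?c t \<in> markings n theta0"
      by (rule cell_marking_in[OF c]) (use hs in force)
    have id: "rose_aut id {} x = x" for x unfolding rose_aut_def by (cases x) auto
    have col: "collapse (cell_marking n ?c t i) = collapse (P i)" if i: "i \<in> {1..n}" for i
    proof -
      have "collapse (P i) = cell_point (?c i) (t i)"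
        using collapse_cell_point[of "c i" "t i"] ct(1)[OF i] ct(2)[OF i] unfolding ct(3)[OF i] restrict_apply if_P[OF i] by blast
      moreover have "collapse (cell_point (?c i) (t i)) = cell_point (?c i) (t i)"
      proof -
        have r: "?c i \<in> rose_cells" using PiE_mem[OF c i] by simp
        show ?thesis using collapse_cell_point[OF t[OF i] subsetD[OF rose_cells_theta r]] unfolding if_P[OF r] by simp
      qed
      ultimately show ?thesis using i unfolding cell_marking_def by simp
    qed
    have "point_class n a P = point_class n a (cell_marking n ?c t)"
      unfolding point_class_eq_iff[OF a a P m] if_P[OF True] using col
      by (intro conjI refl exI[of _ id] exI[of _ "{}"]) (simp_all add: id permutes_id)
    then show ?thesis
      unfolding lev by - (rule bexI[OF _ c], rule exI[of _ t], rule conjI, rule ballI, erule hs, assumption)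
  qed
qed

definition orbit_rep :: "(nat \<Rightarrow> cell) set \<Rightarrow> nat \<Rightarrow> cell" where
  "orbit_rep Z = (SOME c. c \<in> Z)"

fun height :: "level \<Rightarrow> real \<Rightarrow> real" where
  "height Bottom s = 0"
| "height Middle s = (s + 1) / 2"
| "height Top s = 1"

text \<open>The coordinates of a cell are the marked points on half-edges; as these are numbered from 1, the
  coordinate 0 is free for the length parameter.\<close>

definition cell_dims :: "nat \<Rightarrow> level \<Rightarrow> (nat \<Rightarrow> cell) set \<Rightarrow> nat set" where
  "cell_dims n k Z = half_set n (orbit_rep Z) \<union> (if k = Middle then {0} else {})"

definition cell_map ::
  "nat \<Rightarrow> level \<Rightarrow> (nat \<Rightarrow> cell) set \<Rightarrow> (nat \<Rightarrow> real) \<Rightarrow> (nat, nat) marked_graph set" where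
  "cell_map n k Z x = point_class n (height k (x 0)) (cell_marking n (orbit_rep Z) x)"

definition cell_orbits :: "nat \<Rightarrow> level \<Rightarrow> (nat \<Rightarrow> cell) set set" where
  "cell_orbits n k = tuple_orbit n k ` cell_tuples n k"

lemma finite_cell_orbits: "finite (cell_orbits n k)"
  unfolding cell_orbits_def using finite_level_cells[of k] by (intro finite_imageI finite_PiE) auto

lemma tuple_orbit_self: "c \<in> cell_tuples n k \<Longrightarrow> c \<in> tuple_orbit n k c"
  unfolding tuple_orbit_def by (rule image_eqI[where x = id]) (simp_all only: tuple_act_id level_group_id)

lemma orbit_rep:
  assumes "Z \<in> cell_orbits n k"
  shows "orbit_rep Z \<in> cell_tuples n k" "Z = tuple_orbit n k (orbit_rep Z)"
proof -
  obtain c where c: "c \<in> cell_tuples n k" "Z = tuple_orbit n k c" using assms unfolding cell_orbits_def by blast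
  have Z: "orbit_rep Z \<in> tuple_orbit n k c"
    unfolding orbit_rep_def c(2) by (rule someI[of "\<lambda>d. d \<in> tuple_orbit n k c", OF tuple_orbit_self[OF c(1)]])
  then obtain g where g: "g \<in> level_group k" "orbit_rep Z = tuple_act n g c"
    unfolding tuple_orbit_def by (elim imageE)
  show "orbit_rep Z \<in> cell_tuples n k" unfolding g(2) by (rule tuple_act_closed[OF g(1) c(1)])
  show "Z = tuple_orbit n k (orbit_rep Z)" using tuple_orbit_eq[OF c(1) Z] c(2) by simp
qed

lemma half_set_bounds: "i \<in> half_set n c \<longleftrightarrow> i \<in> {1..n} \<and> is_half (c i)" and finite_half_set: "finite (half_set n c)"
  and zero_half_set: "0 \<notin> half_set n c"
  unfolding half_set_def by auto

lemma half_set_tuple_act: "g \<in> level_group k \<Longrightarrow> half_set n (tuple_act n g c) = half_set n c"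
  unfolding half_set_def tuple_act_def using is_half_level_group by auto

lemma height_bounds: "(k = Middle \<longrightarrow> s \<in> {-1..1}) \<Longrightarrow> height k s \<in> {0..1}"
  by (cases k) auto

lemma level_of_height: "(k = Middle \<longrightarrow> s \<in> {-1<..<1}) \<Longrightarrow> level_of (height k s) = k"
  by (cases k) (auto simp: level_of_def)

lemma height_exists:
  assumes "a \<in> {0..1}"
  shows "\<exists>s. height (level_of a) s = a \<and> (level_of a = Middle \<longrightarrow> s \<in> {-1<..<1})"
proof -
  consider "a = 0" | "a = 1" | "a \<noteq> 0" "a \<noteq> 1" by blast
  then show ?thesis
  proof cases
    case 3
    then show ?thesis using assms by (intro exI[of _ "2 * a - 1"]) (auto simp: level_of_def)
  qed (simp_all add: level_of_def)
qed

lemma cell_box_coordinates: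
  shows "x \<in> closed_box (cell_dims n k Z) \<Longrightarrow> \<forall>i\<in>half_set n (orbit_rep Z). x i \<in> {-1..1}"
    and "x \<in> closed_box (cell_dims n k Z) \<Longrightarrow> k = Middle \<longrightarrow> x 0 \<in> {-1..1}"
    and "x \<in> open_box (cell_dims n k Z) \<Longrightarrow> \<forall>i\<in>half_set n (orbit_rep Z). x i \<in> {-1<..<1}"
    and "x \<in> open_box (cell_dims n k Z) \<Longrightarrow> k = Middle \<longrightarrow> x 0 \<in> {-1<..<1}"
  unfolding closed_box_def open_box_def cell_dims_def by (auto simp: PiE_iff)

lemma cell_map_eq_iff:
  assumes Z: "Z \<in> cell_orbits n k" and x: "x \<in> open_box (cell_dims n k Z)"
    and c: "c \<in> cell_tuples n (level_of a)" and a: "a \<in> {0..1}"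
    and t: "\<forall>i\<in>half_set n c. t i \<in> {-1<..<1}"
  shows "cell_map n k Z x = point_class n a (cell_marking n c t) \<longleftrightarrow> height k (x 0) = a \<and>
    (\<exists>g\<in>level_group k. \<forall>i\<in>{1..n}. c i = g (orbit_rep Z i) \<and> (is_half (orbit_rep Z i) \<longrightarrow> t i = x i))"
proof -
  have lev: "level_of (height k (x 0)) = k" by (rule level_of_height[OF cell_box_coordinates(4)[OF x]])
  have h: "height k (x 0) \<in> {0..1}" by (rule height_bounds) (use cell_box_coordinates(4)[OF x] in auto)
  have r: "orbit_rep Z \<in> cell_tuples n (level_of (height k (x 0)))" unfolding lev by (rule orbit_rep(1)[OF Z])
  show ?thesis
    unfolding cell_map_def cell_class_eq_iff[OF h a r c cell_box_coordinates(3)[OF x] t] lev ..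
qed

lemma cell_map_inj:
  assumes Z: "Z \<in> cell_orbits n k"
  shows "inj_on (cell_map n k Z) (open_box (cell_dims n k Z))"
proof (rule inj_onI)
  fix x y assume x: "x \<in> open_box (cell_dims n k Z)" and y: "y \<in> open_box (cell_dims n k Z)"
    and eq: "cell_map n k Z x = cell_map n k Z y"
  have lev: "level_of (height k (y 0)) = k" by (rule level_of_height[OF cell_box_coordinates(4)[OF y]])
  have h: "height k (y 0) \<in> {0..1}" by (rule height_bounds) (use cell_box_coordinates(4)[OF y] in auto)
  have r: "orbit_rep Z \<in> cell_tuples n (level_of (height k (y 0)))" unfolding lev by (rule orbit_rep(1)[OF Z])
  from eq[unfolded cell_map_def[of n k Z y] cell_map_eq_iff[OF Z x r h cell_box_coordinates(3)[OF y]]]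
  have e: "height k (x 0) = height k (y 0)" and "\<exists>g\<in>level_group k. \<forall>i\<in>{1..n}. orbit_rep Z i = g (orbit_rep Z i) \<and>
      (is_half (orbit_rep Z i) \<longrightarrow> y i = x i)" by (rule conjunct1, rule conjunct2)
  from this(2) have "\<forall>i\<in>{1..n}. is_half (orbit_rep Z i) \<longrightarrow> y i = x i" by (elim bexE) simp
  then have "x i = y i" if "i \<in> half_set n (orbit_rep Z)" for i using that unfolding half_set_bounds by simp
  moreover have "x 0 = y 0" if "k = Middle" using e that by simp
  ultimately show "x = y"
    using x y unfolding open_box_def cell_dims_def by (intro PiE_ext[of x _ _ y]) (auto split: if_splits)
qed

lemma cell_map_disjoint:
  assumes Z: "Z \<in> cell_orbits n k" "Z' \<in> cell_orbits n k'"
    and x: "x \<in> open_box (cell_dims n k Z)" "x' \<in> open_box (cell_dims n k' Z')"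
    and eq: "cell_map n k Z x = cell_map n k' Z' x'"
  shows "k = k' \<and> Z = Z'"
proof -
  have lev: "level_of (height k (x 0)) = k" by (rule level_of_height[OF cell_box_coordinates(4)[OF x(1)]])
  have lev': "level_of (height k' (x' 0)) = k'" by (rule level_of_height[OF cell_box_coordinates(4)[OF x(2)]])
  have h: "height k' (x' 0) \<in> {0..1}" by (rule height_bounds) (use cell_box_coordinates(4)[OF x(2)] in auto)
  have r: "orbit_rep Z' \<in> cell_tuples n (level_of (height k' (x' 0)))" unfolding lev' by (rule orbit_rep(1)[OF Z(2)])
  from eq[unfolded cell_map_def[of n k' Z' x'] cell_map_eq_iff[OF Z(1) x(1) r h cell_box_coordinates(3)[OF x(2)]]]
  have e: "height k (x 0) = height k' (x' 0)"
    and "\<exists>g\<in>level_group k. \<forall>i\<in>{1..n}. orbit_rep Z' i = g (orbit_rep Z i) \<and>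
      (is_half (orbit_rep Z i) \<longrightarrow> x' i = x i)" by (rule conjunct1, rule conjunct2)
  then obtain g where g: "g \<in> level_group k" "\<forall>i\<in>{1..n}. orbit_rep Z' i = g (orbit_rep Z i)" by (elim bexE) blast
  have k: "k = k'" using e lev lev' by simp
  have "orbit_rep Z' = tuple_act n g (orbit_rep Z)"
  proof
    fix i show "orbit_rep Z' i = tuple_act n g (orbit_rep Z) i"
    proof (cases "i \<in> {1..n}")
      case True
      then show ?thesis using bspec[OF g(2) True] by (simp only: tuple_act_def restrict_apply if_True)
    next
      case False
      then show ?thesis
        using PiE_arb[OF orbit_rep(1)[OF Z(2)] False] by (simp only: tuple_act_def restrict_apply if_False)
    qed
  qed
  then have "orbit_rep Z' \<in> tuple_orbit n k (orbit_rep Z)" unfolding tuple_orbit_def by (rule image_eqI[OF _ g(1)])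
  from tuple_orbit_eq[OF orbit_rep(1)[OF Z(1)] this] have "Z' = Z"
    using orbit_rep(2)[OF Z(1)] orbit_rep(2)[OF Z(2)] k by simp
  then show ?thesis using k by simp
qed

text \<open>The bound on the half-edges is what will put the boundary of a cell into cells of smaller
  dimension.\<close>

lemma class_in_cell:
  assumes a: "a \<in> {0..1}" and P: "P \<in> markings n theta0"
  shows "\<exists>Z\<in>cell_orbits n (level_of a).
    half_set n (orbit_rep Z) \<subseteq> {i \<in> {1..n}. \<exists>e s. P i = Interior e s \<and> s \<noteq> 1 / 2} \<and>
    point_class n a P \<in> cell_map n (level_of a) Z ` open_box (cell_dims n (level_of a) Z)"
proof -
  define k where "k = level_of a"
  obtain c t where c: "c \<in> cell_tuples n k"
    and t: "\<forall>i\<in>half_set n c. t i \<in> {-1<..<1}"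
    and int: "\<forall>i\<in>half_set n c. \<exists>e s. P i = Interior e s \<and> s \<noteq> 1 / 2"
    and cl: "point_class n a P = point_class n a (cell_marking n c t)"
    using cell_class_exists[OF a P] unfolding k_def by blast
  define Z where "Z = tuple_orbit n k c"
  have Z: "Z \<in> cell_orbits n k" unfolding Z_def cell_orbits_def using c by blast
  have "c \<in> Z" unfolding Z_def by (rule tuple_orbit_self[OF c])
  then have "c \<in> tuple_orbit n k (orbit_rep Z)" by (rule subst[OF orbit_rep(2)[OF Z]])
  then obtain g where g: "g \<in> level_group k" "c = tuple_act n g (orbit_rep Z)"
    unfolding tuple_orbit_def by (elim imageE)
  have half: "half_set n (orbit_rep Z) = half_set n c" using half_set_tuple_act[OF g(1)] g(2) by simp
  obtain s where s: "height k s = a" "k = Middle \<longrightarrow> s \<in> {-1<..<1}" using height_exists[OF a] unfolding k_def by blast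
  define x where "x = (\<lambda>i\<in>cell_dims n k Z. if i = 0 then s else t i)"
  have zero: "0 \<notin> half_set n c" by (rule zero_half_set)
  have xt: "x i = t i" if "i \<in> {1..n}" "is_half (orbit_rep Z i)" for i
    using that unfolding x_def cell_dims_def by (simp add: half_set_bounds)
  have x: "x \<in> open_box (cell_dims n k Z)"
  proof -
    have "(if i = 0 then s else t i) \<in> {-1<..<1}" if "i \<in> cell_dims n k Z" for i
      using that s(2) t zero unfolding cell_dims_def half by (auto split: if_splits)
    then show ?thesis unfolding x_def open_box_def by (simp add: PiE_iff)
  qed
  have "height k (x 0) = a" using s(1) unfolding x_def cell_dims_def by (cases k) auto
  moreover have "\<forall>i\<in>{1..n}. c i = g (orbit_rep Z i) \<and> (is_half (orbit_rep Z i) \<longrightarrow> t i = x i)"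
    using xt g(2) unfolding tuple_act_def by simp
  ultimately have "cell_map n k Z x = point_class n a (cell_marking n c t)"
    unfolding cell_map_eq_iff[OF Z x c[unfolded k_def] a t] by (intro conjI bexI[OF _ g(1)])
  then have "point_class n a P = cell_map n k Z x" using cl by simp
  then have "point_class n a P \<in> cell_map n k Z ` open_box (cell_dims n k Z)" using x by (rule image_eqI)
  moreover have "half_set n (orbit_rep Z) \<subseteq> {i \<in> {1..n}. \<exists>e s. P i = Interior e s \<and> s \<noteq> 1 / 2}"
    unfolding half using int by (auto simp: half_set_bounds)
  ultimately show ?thesis using Z unfolding k_def by blast
qed

lemma closed_box_marking:
  assumes Z: "Z \<in> cell_orbits n k" and x: "x \<in> closed_box (cell_dims n k Z)"
  shows "height k (x 0) \<in> {0..1}" "cell_marking n (orbit_rep Z) x \<in> markings n theta0"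
proof -
  show "height k (x 0) \<in> {0..1}" by (rule height_bounds[OF cell_box_coordinates(2)[OF x]])
  show "cell_marking n (orbit_rep Z) x \<in> markings n theta0"
    by (rule cell_marking_in[OF orbit_rep(1)[OF Z] cell_box_coordinates(1)[OF x]])
qed

text \<open>At the boundary of the cell either a marked point reaches an end or the midpoint of its edge,
  or the length of the third edge becomes 0 or 1.\<close>

lemma cell_map_boundary:
  assumes Z: "Z \<in> cell_orbits n k" and x: "x \<in> closed_box (cell_dims n k Z) - open_box (cell_dims n k Z)"
  shows "\<exists>k'. \<exists>Z'\<in>cell_orbits n k'. card (cell_dims n k' Z') < card (cell_dims n k Z) \<and>
    cell_map n k Z x \<in> cell_map n k' Z' ` open_box (cell_dims n k' Z')"
proof -
  let ?a = "height k (x 0)" and ?P = "cell_marking n (orbit_rep Z) x"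
  have xc: "x \<in> closed_box (cell_dims n k Z)" and xo: "x \<notin> open_box (cell_dims n k Z)" using x by auto
  obtain Z' where Z': "Z' \<in> cell_orbits n (level_of ?a)"
    and half: "half_set n (orbit_rep Z') \<subseteq> {i \<in> {1..n}. \<exists>e s. ?P i = Interior e s \<and> s \<noteq> 1 / 2}"
    and mem: "point_class n ?a ?P \<in> cell_map n (level_of ?a) Z' ` open_box (cell_dims n (level_of ?a) Z')"
    using class_in_cell[OF closed_box_marking[OF Z xc]] by blast
  let ?O = "{i \<in> cell_dims n k Z. x i \<in> {-1<..<1}}"
  have fin: "finite (cell_dims n k Z)" unfolding cell_dims_def by (simp add: finite_half_set)
  have "?O \<noteq> cell_dims n k Z"
  proof
    assume all: "?O = cell_dims n k Z"
    have "x i \<in> {-1<..<1}" if "i \<in> cell_dims n k Z" for i using all that by blast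
    then have "x \<in> open_box (cell_dims n k Z)" using xc unfolding open_box_def closed_box_def by (simp add: PiE_iff)
    then show False using xo by blast
  qed
  then have less: "?O \<subset> cell_dims n k Z" by blast
  have sub: "cell_dims n (level_of ?a) Z' \<subseteq> ?O"
  proof
    fix i assume i: "i \<in> cell_dims n (level_of ?a) Z'"
    show "i \<in> ?O"
    proof (cases "i \<in> half_set n (orbit_rep Z')")
      case True
      then obtain e s where e: "i \<in> {1..n}" "?P i = Interior e s" "s \<noteq> 1 / 2" using half by blast
      have "is_half (orbit_rep Z i) \<and> x i \<in> {-1<..<1}"
        by (rule cell_point_interior[OF _ e(3)])
          (use e(1,2) cell_box_coordinates(1)[OF xc] in \<open>simp_all add: cell_marking_def half_set_bounds\<close>)
      then show ?thesis using e(1) unfolding cell_dims_def by (simp add: half_set_bounds)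
    next
      case False
      then have i0: "i = 0" and lev: "level_of ?a = Middle" using i unfolding cell_dims_def by (auto split: if_splits)
      have k: "k = Middle" using lev by (cases k) (simp_all add: level_of_def)
      have "x 0 \<noteq> -1 \<and> x 0 \<noteq> 1" using lev unfolding k by (auto simp: level_of_def)
      then show ?thesis using cell_box_coordinates(2)[OF xc] unfolding i0 cell_dims_def by (simp add: k)
    qed
  qed
  have "card (cell_dims n (level_of ?a) Z') < card (cell_dims n k Z)"
    by (rule psubset_card_mono[OF fin]) (use sub less in blast)
  then show ?thesis using Z' mem unfolding cell_map_def[of n k Z x] by blast
qed

lemma continuous_map_cell:
  assumes Z: "Z \<in> cell_orbits n k"
  shows "continuous_map (cube (cell_dims n k Z)) (cylinder n) (\<lambda>x. (height k (x 0), cell_marking n (orbit_rep Z) x))"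
proof -
  let ?J = "cell_dims n k Z"
  have coord: "continuous_map (cube ?J) euclideanreal (\<lambda>x. x i)" if "i \<in> ?J" for i
    unfolding cube_def by (rule continuous_map_coordinate[OF continuous_map_id[unfolded id_def] that])
  have "continuous_map (cube ?J) euclideanreal (\<lambda>x. height k (x 0))"
  proof (cases k)
    case Middle
    then have "0 \<in> ?J" unfolding cell_dims_def by simp
    from coord[OF this] show ?thesis unfolding Middle height.simps
      by (intro continuous_map_real_divide continuous_map_add) auto
  qed auto
  moreover have "height k (x 0) \<in> {0..1}" if "x \<in> topspace (cube ?J)" for x
    using closed_box_marking(1)[OF Z] that by simp
  ultimately have 1: "continuous_map (cube ?J) (top_of_set {0..1}) (\<lambda>x. height k (x 0))"
    by (simp add: continuous_map_in_subtopology image_subset_iff_funcset Pi_iff)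
  have comp: "continuous_map (cube ?J) (realization theta0) (\<lambda>x. cell_point (orbit_rep Z i) (x i))" if i: "i \<in> {1..n}" for i
  proof (cases "is_half (orbit_rep Z i)")
    case False
    have ci: "orbit_rep Z i \<in> theta_cells" by (rule level_cells_theta[OF PiE_mem[OF orbit_rep(1)[OF Z] i]])
    have "cell_point (orbit_rep Z i) (x i) = cell_point (orbit_rep Z i) 0" for x :: "nat \<Rightarrow> real"
      using False by (cases "orbit_rep Z i") simp_all
    moreover have "cell_point (orbit_rep Z i) 0 \<in> topspace (realization theta0)"
      unfolding topspace_realization[OF wf_theta0] using False by (intro cell_point_gpoints[OF ci]) simp
    ultimately show ?thesis by simp
  next
    case True
    then obtain e j where e: "orbit_rep Z i = H e j" by (cases "orbit_rep Z i") auto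
    have "H e j \<in> theta_cells" using level_cells_theta[OF PiE_mem[OF orbit_rep(1)[OF Z] i]] unfolding e .
    then have ea: "e \<in> arcs theta0" unfolding theta_cells_iff theta0_simps .
    have iJ: "i \<in> ?J" using i True unfolding cell_dims_def by (simp add: half_set_bounds)
    let ?f = "\<lambda>x :: nat \<Rightarrow> real. if j then 1 - (x i + 1) / 4 else (x i + 1) / 4"
    have "continuous_map (cube ?J) euclideanreal ?f"
      using coord[OF iJ] by (cases j) (auto intro!: continuous_map_diff continuous_map_real_divide continuous_map_add)
    moreover have "?f x \<in> {0..1}" if "x \<in> topspace (cube ?J)" for x
    proof -
      have "x i \<in> {-1..1}" using cell_box_coordinates(1)[of x n k Z] i True that by (simp add: half_set_bounds)
      then show ?thesis by auto
    qed
    ultimately have "continuous_map (cube ?J) (top_of_set {0..1}) ?f"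
      unfolding continuous_map_in_subtopology by blast
    from continuous_map_compose[OF this continuous_map_edge_point[OF wf_theta0 ea]]
    show ?thesis unfolding e cell_point.simps o_def .
  qed
  have 2: "continuous_map (cube ?J) (marking_space n theta0) (cell_marking n (orbit_rep Z))"
    unfolding marking_space_def continuous_map_componentwise
    using comp by (auto simp: cell_marking_def)
  show ?thesis unfolding cylinder_def continuous_map_paired using 1 2 by (rule conjI)
qed

lemma
  assumes Z: "Z \<in> cell_orbits n k"
  shows continuous_cell_map: "continuous_map (cube (cell_dims n k Z)) (X_space 2 n) (cell_map n k Z)"
    and closed_cell_map: "closed_map (cube (cell_dims n k Z)) (X_space 2 n) (cell_map n k Z)"
proof -
  note c = continuous_map_cell[OF Z]
  have eq: "cell_map n k Z = cylinder_class n \<circ> (\<lambda>x. (height k (x 0), cell_marking n (orbit_rep Z) x))"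
    unfolding cell_map_def cylinder_class_def o_def fst_conv snd_conv ..
  show "continuous_map (cube (cell_dims n k Z)) (X_space 2 n) (cell_map n k Z)"
    unfolding eq by (rule continuous_map_compose[OF c cylinder_class_continuous])
  show "closed_map (cube (cell_dims n k Z)) (X_space 2 n) (cell_map n k Z)"
    unfolding eq
    by (rule closed_map_compose[OF continuous_imp_closed_map[OF c compact_cube Hausdorff_cylinder] cylinder_class_closed])
qed

lemma cell_cover:
  "topspace (X_space 2 n) = (\<Union>(k, Z)\<in>Sigma UNIV (cell_orbits n). cell_map n k Z ` open_box (cell_dims n k Z))"
proof (intro equalityI subsetI)
  fix y assume "y \<in> topspace (X_space 2 n)"
  then obtain x where "x \<in> topspace (cylinder n)" and y: "y = cylinder_class n x"
    unfolding cylinder_class_surj[symmetric] by blast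
  then have "fst x \<in> {0..1}" "snd x \<in> markings n theta0" unfolding topspace_cylinder mem_Times_iff by blast+
  from class_in_cell[OF this] obtain Z where "Z \<in> cell_orbits n (level_of (fst x))"
    "y \<in> cell_map n (level_of (fst x)) Z ` open_box (cell_dims n (level_of (fst x)) Z)"
    unfolding y cylinder_class_def by blast
  then show "y \<in> (\<Union>(k, Z)\<in>Sigma UNIV (cell_orbits n). cell_map n k Z ` open_box (cell_dims n k Z))" by blast
next
  fix y assume "y \<in> (\<Union>(k, Z)\<in>Sigma UNIV (cell_orbits n). cell_map n k Z ` open_box (cell_dims n k Z))"
  then obtain k Z x where "Z \<in> cell_orbits n k" "x \<in> open_box (cell_dims n k Z)" and y: "y = cell_map n k Z x" by blast
  then show "y \<in> topspace (X_space 2 n)"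
    using continuous_map_funspace[OF continuous_cell_map] open_box_subset unfolding topspace_cube by blast
qed

lemma UNIV_level: "UNIV = {Bottom, Middle, Top}"
  using level.exhaust by auto

lemma sum_cells: "(\<Sum>Z\<in>cell_orbits n k. (- 1) ^ card (cell_dims n k Z)) = (if k = Middle then - orbit_sum n k else orbit_sum n k)"
proof -
  have "(- 1) ^ card (cell_dims n k Z) = (if k = Middle then -1 else 1) * (\<Prod>i\<in>{1..n}. cell_sign (orbit_rep Z i))" for Z
  proof -
    have "(\<Prod>i\<in>{1..n}. cell_sign (orbit_rep Z i)) = (\<Prod>i\<in>half_set n (orbit_rep Z). -1)"
      by (rule prod.mono_neutral_cong_right) (auto simp: half_set_def cell_sign_def)
    then have "(\<Prod>i\<in>{1..n}. cell_sign (orbit_rep Z i)) = (- 1) ^ card (half_set n (orbit_rep Z))" by simp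
    then show ?thesis
      unfolding cell_dims_def using zero_half_set[of n "orbit_rep Z"] finite_half_set[of n "orbit_rep Z"] by simp
  qed
  then show ?thesis
    unfolding orbit_sum_def cell_orbits_def orbit_rep_def by (simp add: sum_negf)
qed

theorem mainTheorem8:
  fixes n :: nat
  shows "finite_homology (X_space 2 n) \<and>
    real_of_int (euler_characteristic (X_space 2 n)) =
      1 / 24 * (- (3 ^ n) + (- 1) ^ (n + 1) + 2 ^ (n + 2) + 18 + 4 * 0 ^ n)"
proof -
  let ?I = "Sigma UNIV (cell_orbits n)" and ?J = "\<lambda>(k, Z). cell_dims n k Z" and ?f = "\<lambda>(k, Z). cell_map n k Z"
  have finI: "finite ?I" unfolding UNIV_level by (intro finite_SigmaI finite_cell_orbits) simp
  have "finite_homology (X_space 2 n) \<and> euler_characteristic (X_space 2 n) = (\<Sum>i\<in>?I. (- 1) ^ card (?J i))"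
  proof (rule euler_characteristic_cells[where \<phi> = ?f, OF finI])
    show "topspace (X_space 2 n) = (\<Union>i\<in>?I. ?f i ` open_box (?J i))"
      unfolding cell_cover by (rule SUP_cong) auto
  next
    fix i j assume i: "i \<in> ?I" and j: "j \<in> ?I" and "i \<noteq> j"
    then show "?f i ` open_box (?J i) \<inter> ?f j ` open_box (?J j) = {}"
      using cell_map_disjoint[of "snd i" n "fst i" "snd j" "fst j"] by (force simp: split_beta prod_eq_iff mem_Sigma_iff)
  next
    fix i assume i: "i \<in> ?I"
    obtain k Z where kZ: "i = (k, Z)" and Z: "Z \<in> cell_orbits n k" using i by blast
    show "finite (?J i)" unfolding kZ prod.case cell_dims_def using finite_half_set by simp
    show "continuous_map (cube (?J i)) (X_space 2 n) (?f i)" unfolding kZ prod.case by (rule continuous_cell_map[OF Z])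
    show "closed_map (cube (?J i)) (X_space 2 n) (?f i)" unfolding kZ prod.case by (rule closed_cell_map[OF Z])
    show "inj_on (?f i) (open_box (?J i))" unfolding kZ prod.case by (rule cell_map_inj[OF Z])
    show "?f i ` (closed_box (?J i) - open_box (?J i)) \<subseteq>
        (\<Union>j\<in>{j \<in> ?I. card (?J j) < card (?J i)}. ?f j ` open_box (?J j))"
    proof
      fix y assume "y \<in> ?f i ` (closed_box (?J i) - open_box (?J i))"
      then obtain x where x: "x \<in> closed_box (cell_dims n k Z) - open_box (cell_dims n k Z)" "y = cell_map n k Z x"
        unfolding kZ prod.case by blast
      from cell_map_boundary[OF Z x(1)] obtain k' Z' where Z': "Z' \<in> cell_orbits n k'"
        "card (cell_dims n k' Z') < card (cell_dims n k Z)" "y \<in> cell_map n k' Z' ` open_box (cell_dims n k' Z')"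
        unfolding x(2) by blast
      show "y \<in> (\<Union>j\<in>{j \<in> ?I. card (?J j) < card (?J i)}. ?f j ` open_box (?J j))"
        by (rule UN_I[of "(k', Z')"]) (use Z' in \<open>simp_all add: kZ\<close>)
    qed
  qed
  moreover have "(\<Sum>i\<in>?I. (- 1) ^ card (?J i)) = orbit_sum n Bottom - orbit_sum n Middle + orbit_sum n Top"
  proof -
    have "(\<Sum>i\<in>?I. (- 1) ^ card (?J i)) = (\<Sum>k\<in>UNIV. \<Sum>Z\<in>cell_orbits n k. (- 1) ^ card (cell_dims n k Z) :: int)"
      using finite_cell_orbits by (subst sum.Sigma) (auto simp: UNIV_level split_beta)
    then show ?thesis unfolding sum_cells UNIV_level by simp
  qed
  ultimately have fh: "finite_homology (X_space 2 n)"
    and chi: "euler_characteristic (X_space 2 n) = orbit_sum n Bottom - orbit_sum n Middle + orbit_sum n Top" by simp_all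
  \<comment> \<open>24 is the least common multiple of the group orders 8, 4 and 12.\<close>
  have "24 * euler_characteristic (X_space 2 n) =
      3 * (8 * orbit_sum n Bottom) - 6 * (4 * orbit_sum n Middle) + 2 * (12 * orbit_sum n Top)"
    unfolding chi by simp
  also have "\<dots> = - (3 ^ n) + (- 1) ^ (n + 1) + 2 ^ (n + 2) + 18 + 4 * 0 ^ n"
    unfolding orbit_sum_Bottom orbit_sum_Middle orbit_sum_Top by simp
  finally have "real_of_int (24 * euler_characteristic (X_space 2 n)) =
      real_of_int (- (3 ^ n) + (- 1) ^ (n + 1) + 2 ^ (n + 2) + 18 + 4 * 0 ^ n)" by (rule arg_cong)
  then have "24 * real_of_int (euler_characteristic (X_space 2 n)) =
      - (3 ^ n) + (- 1) ^ (n + 1) + 2 ^ (n + 2) + 18 + 4 * 0 ^ n" by simp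
  then show ?thesis using fh by simp
qed

end
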